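(* Let $\Gamma$ be a finite group, $p$ a prime, and $\mathbb{F}$ an algebraically closed field of characteristic $p$. Homomorphisms $\varphi:\mathcal{R}_\Gamma\to\mathbb{F}$ are given by evaluating $$T(c)\mapsto\sum_u\omega_c^u\,t_u,$$ where the sum is over the blocks $C_u$ of $\mathbb{F}\Gamma$, and $t_u\in\mathbb{Z}_p$ are arbitrary $p$-adic integers (one for each block $C_u$).
   Context: $\Gamma_*$ is the set of conjugacy classes of $\Gamma$, each identified with its class sum. The blocks $C_u$ of $\mathbb{F}\Gamma$ are its minimal indecomposable two-sided ideals, so that $\mathbb{F}\Gamma=\bigoplus_u C_u$. The scalar $\omega_c^u\in\mathbb{F}$ is the central character of the block $C_u$ at $c\in\Gamma_*$: the scalar by which the class sum $c$ acts on any simple $\mathbb{F}\Gamma$-module belonging to $C_u$. $\mathbb{Z}_p$ is the ring of $p$-adic integers. Definition of $\mathcal{R}_\Gamma$: let $\mathfrak{g}=\mathbb{Q}\Gamma_*=Z(\mathbb{Q}\Gamma)$, viewed as an abelian Lie algebra, with canonical map $\iota:\mathfrak{g}\to\mathcal{U}(\mathfrak{g})$ to its universal enveloping algebra, and let $T:\mathfrak{g}[[x_c:c\in\Gamma_*]]\to\mathcal{U}(\mathfrak{g})[[x_c:c\in\Gamma_*]]$ apply $\iota$ coefficientwise; in particular $T(c)=\iota(c)$. For $\mathbf{N}\in\mathbb{Z}_{\ge0}^{\Gamma_*}$ write $x^{\mathbf{N}}=\prod_{c}x_c^{\mathbf{N}(c)}$ and define $B_{\mathbf{N}}\in\mathcal{U}(\mathfrak{g})$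 by $\exp\big(T\big(\log(1+\sum_{c}c\,x_c)\big)\big)=\sum_{\mathbf{N}}B_{\mathbf{N}}x^{\mathbf{N}}$, the logarithm being computed with the associative product of $\mathbb{Q}\Gamma_*$. $\mathcal{R}_\Gamma$ is the $\mathbb{Z}$-span of the $B_{\mathbf{N}}$ in $\mathcal{U}(\mathfrak{g})$; it is a commutative ring with $\mathbb{Z}$-basis the $B_{\mathbf{N}}$. Meaning of "evaluating": the $T(c)$ alone do not generate $\mathcal{R}_\Gamma$, so the evaluation attached to a family $(t_u)$ is understood as the map sending $B_{\mathbf{N}}$ to the coefficient of $x^{\mathbf{N}}$ in $\prod_u(1+\sum_{c}\omega_c^u x_c)^{t_u}$, where $(1+y)^t=\sum_{r\ge0}\binom{t}{r}y^r$ and $\binom{t}{r}\in\mathbb{Z}_p$ is viewed in $\mathbb{F}$ via $\mathbb{Z}_p\to\mathbb{Z}/p\mathbb{Z}\subseteq\mathbb{F}$. *)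

theory Defs
  imports
    "HOL-Library.Poly_Mapping"
    "HOL-Library.Multiset"
    "HOL-Library.FuncSet"
    "HOL-Computational_Algebra.Polynomial"
    "HOL-Computational_Algebra.Primes"
begin

section \<open>Multivariate formal power series\<close>

text \<open>
  Power series over \<open>'a\<close> in commuting variables indexed by \<open>'v\<close>. The exponent of a monomial is a
  multiset \<open>N\<close> of variables, standing for \<open>\<Prod>v. x\<^sub>v ^ count N v\<close>.
\<close>

typedef ('v, 'a) mps = "UNIV :: ('v multiset \<Rightarrow> 'a) set"
  morphisms mps_nth Abs_mps ..

setup_lifting type_definition_mps

lemma mps_eqI: "(\<And>N. mps_nth f N = mps_nth g N) \<Longrightarrow> f = g"
  by transfer auto

lemma finite_submultisets: "finite {A. A \<subseteq># N}"
proof (induction N)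
  case empty
  then show ?case by simp
next
  case (add x N)
  have "{A. A \<subseteq># add_mset x N} \<subseteq> {A. A \<subseteq># N} \<union> add_mset x ` {A. A \<subseteq># N}"
  proof
    fix A assume "A \<in> {A. A \<subseteq># add_mset x N}"
    then have A: "A \<subseteq># add_mset x N" by simp
    show "A \<in> {A. A \<subseteq># N} \<union> add_mset x ` {A. A \<subseteq># N}"
    proof (cases "x \<in># A")
      case True
      then obtain B where "A = add_mset x B" by (meson multi_member_split)
      with A show ?thesis by auto
    next
      case False
      with A have "A \<subseteq># N"
        by (metis diff_single_trivial subset_eq_diff_conv add_mset_add_single)
      then show ?thesis by auto
    qed
  qed
  then show ?case
    by (rule finite_subset) (use add in auto)
qed

instantiation mps :: (type, comm_ring_1) comm_ring_1
begin

lift_definition zero_mps :: "('a, 'b) mps" is "\<lambda>_. 0" .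
lift_definition one_mps :: "('a, 'b) mps" is "\<lambda>N. if N = {#} then 1 else 0" .
lift_definition plus_mps :: "('a, 'b) mps \<Rightarrow> ('a, 'b) mps \<Rightarrow> ('a, 'b) mps"
  is "\<lambda>f g N. f N + g N" .
lift_definition uminus_mps :: "('a, 'b) mps \<Rightarrow> ('a, 'b) mps"
  is "\<lambda>f N. - f N" .
lift_definition minus_mps :: "('a, 'b) mps \<Rightarrow> ('a, 'b) mps \<Rightarrow> ('a, 'b) mps"
  is "\<lambda>f g N. f N - g N" .
lift_definition times_mps :: "('a, 'b) mps \<Rightarrow> ('a, 'b) mps \<Rightarrow> ('a, 'b) mps"
  is "\<lambda>f g N. \<Sum>A | A \<subseteq># N. f A * g (N - A)" .

instance
proof
  fix f g h :: "('a, 'b) mps"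
  show "f + g + h = f + (g + h)" by transfer (simp add: add.assoc)
  show "f + g = g + f" by transfer (simp add: add.commute)
  show "0 + f = f" by transfer simp
  show "- f + f = 0" by transfer simp
  show "f - g = f + - g" by transfer simp
  show "(0 :: ('a, 'b) mps) \<noteq> 1"
    by transfer (metis zero_neq_one)
  show "(f + g) * h = f * h + g * h"
    by transfer (simp add: distrib_right sum.distrib)
  show "f * g = g * f"
  proof (transfer, rule ext)
    fix f g :: "'a multiset \<Rightarrow> 'b" and N
    show "(\<Sum>A | A \<subseteq># N. f A * g (N - A)) = (\<Sum>A | A \<subseteq># N. g A * f (N - A))"
      by (rule sum.reindex_bij_witness[of _ "\<lambda>A. N - A" "\<lambda>A. N - A"])
         (auto simp: mult.commute subset_mset.diff_diff_right)
  qed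
  show "1 * f = f"
  proof (transfer, rule ext)
    fix f :: "'a multiset \<Rightarrow> 'b" and N
    have "(\<Sum>A | A \<subseteq># N. (if A = {#} then 1 else 0) * f (N - A))
        = (\<Sum>A\<in>{{#}}. (if A = {#} then 1 else 0) * f (N - A))"
      by (rule sum.mono_neutral_right) (auto simp: finite_submultisets)
    then show "(\<Sum>A | A \<subseteq># N. (if A = {#} then 1 else 0) * f (N - A)) = f N"
      by simp
  qed
  show "f * g * h = f * (g * h)"
  proof (transfer, rule ext)
    fix f g h :: "'a multiset \<Rightarrow> 'b" and N
    have "(\<Sum>A | A \<subseteq># N. (\<Sum>B | B \<subseteq># A. f B * g (A - B)) * h (N - A))
        = (\<Sum>(A, B) \<in> Sigma {A. A \<subseteq># N} (\<lambda>A. {B. B \<subseteq># A}). f B * g (A - B) * h (N - A))"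
      by (simp add: sum_distrib_right sum.Sigma finite_submultisets)
    also have "\<dots> = (\<Sum>(B, C) \<in> Sigma {B. B \<subseteq># N} (\<lambda>B. {C. C \<subseteq># N - B}).
                       f B * g C * h (N - B - C))"
      by (rule sum.reindex_bij_witness[of _ "\<lambda>(B, C). (B + C, B)" "\<lambda>(A, B). (B, A - B)"])
         (auto simp: mset_subset_eq_exists_conv ac_simps)
    also have "\<dots> = (\<Sum>B | B \<subseteq># N. f B * (\<Sum>C | C \<subseteq># N - B. g C * h (N - B - C)))"
      by (simp add: sum_distrib_left sum.Sigma finite_submultisets mult.assoc)
    finally show "(\<Sum>A | A \<subseteq># N. (\<Sum>B | B \<subseteq># A. f B * g (A - B)) * h (N - A))
        = (\<Sum>B | B \<subseteq># N. f B * (\<Sum>C | C \<subseteq># N - B. g C * h (N - B - C)))" .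
  qed
qed

end

lift_definition mps_const :: "'a::zero \<Rightarrow> ('v, 'a) mps" is "\<lambda>a N. if N = {#} then a else 0" .

lift_definition mps_var :: "'v \<Rightarrow> ('v, 'a::zero_neq_one) mps" is "\<lambda>v N. if N = {#v#} then 1 else 0" .

lift_definition mps_map :: "('a \<Rightarrow> 'b) \<Rightarrow> ('v, 'a) mps \<Rightarrow> ('v, 'b) mps" is "\<lambda>\<phi> f N. \<phi> (f N)" .

text \<open>
  \<open>\<Sum>r. a r * f ^ r\<close> for a series \<open>f\<close> without constant term. As \<open>f ^ r\<close> then only involves monomials
  of total degree at least \<open>r\<close>, the sum for the coefficient at \<open>N\<close> can be cut off at \<open>size N\<close>.
\<close>

definition mps_subst :: "(nat \<Rightarrow> 'a::comm_ring_1) \<Rightarrow> ('v, 'a) mps \<Rightarrow> ('v, 'a) mps" where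
  "mps_subst a f = Abs_mps (\<lambda>N. \<Sum>r\<le>size N. a r * mps_nth (f ^ r) N)"


section \<open>Rational vector spaces and commutative rational algebras\<close>

class rat_vector = ab_group_add +
  fixes scaleQ :: "rat \<Rightarrow> 'a \<Rightarrow> 'a"  (infixr \<open>*\<^sub>Q\<close> 75)
  assumes scaleQ_add_right: "q *\<^sub>Q (x + y) = q *\<^sub>Q x + q *\<^sub>Q y"
    and scaleQ_add_left: "(q + r) *\<^sub>Q x = q *\<^sub>Q x + r *\<^sub>Q x"
    and scaleQ_scaleQ: "q *\<^sub>Q (r *\<^sub>Q x) = (q * r) *\<^sub>Q x"
    and scaleQ_one: "1 *\<^sub>Q x = x"

class rat_algebra = rat_vector + comm_ring_1 +
  assumes mult_scaleQ_left: "(q *\<^sub>Q x) * y = q *\<^sub>Q (x * y)"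

definition mps_exp :: "('v, 'a::rat_algebra) mps \<Rightarrow> ('v, 'a) mps" where
  "mps_exp = mps_subst (\<lambda>r. (1 / fact r) *\<^sub>Q 1)"

text \<open>\<open>log (1 + f)\<close>\<close>

definition mps_ln1p :: "('v, 'a::rat_algebra) mps \<Rightarrow> ('v, 'a) mps" where
  "mps_ln1p = mps_subst (\<lambda>r. if r = 0 then 0 else ((-1) ^ (r + 1) / of_nat r) *\<^sub>Q 1)"


section \<open>The universal enveloping algebra of an abelian Lie algebra\<close>

text \<open>
  For a rational vector space \<open>'a\<close> regarded as an abelian Lie algebra, this is the free associative
  unital rational algebra on the set \<open>'a\<close> modulo the two-sided ideal that makes the inclusion of
  the generators linear and imposes \<open>x y - y x = [x, y] = 0\<close>; this is the tensor algebra modulo the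
  relations \<open>x \<otimes> y - y \<otimes> x - [x, y]\<close>. The free algebra is the monoid algebra of the free monoid.
\<close>

datatype 'a free_word = Word (letters: "'a list")

instantiation free_word :: (type) monoid_add
begin

definition zero_free_word :: "'a free_word" where "0 = Word []"

definition plus_free_word :: "'a free_word \<Rightarrow> 'a free_word \<Rightarrow> 'a free_word" where
  "v + w = Word (letters v @ letters w)"

instance
  by standard (auto simp: zero_free_word_def plus_free_word_def)

end

type_synonym 'a free_rat_algebra = "'a free_word \<Rightarrow>\<^sub>0 rat"

definition free_gen :: "'a \<Rightarrow> 'a free_rat_algebra" where
  "free_gen x = Poly_Mapping.single (Word [x]) 1"

inductive_set uea_ideal :: "'a::rat_vector free_rat_algebra set" where
  gen_add: "free_gen (x + y) - (free_gen x + free_gen y) \<in> uea_ideal"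
| gen_scale: "free_gen (q *\<^sub>Q x) - Poly_Mapping.single 0 q * free_gen x \<in> uea_ideal"
| gen_bracket: "free_gen x * free_gen y - free_gen y * free_gen x \<in> uea_ideal"
| add: "P \<in> uea_ideal \<Longrightarrow> Q \<in> uea_ideal \<Longrightarrow> P + Q \<in> uea_ideal"
| mult_left: "P \<in> uea_ideal \<Longrightarrow> R * P \<in> uea_ideal"
| mult_right: "P \<in> uea_ideal \<Longrightarrow> P * R \<in> uea_ideal"

lemma uea_ideal_zero: "0 \<in> uea_ideal"
  using uea_ideal.mult_left[OF uea_ideal.gen_bracket, of 0] by simp

lemma uea_ideal_uminus: "P \<in> uea_ideal \<Longrightarrow> - P \<in> uea_ideal"
  using uea_ideal.mult_left[of P "-1"] by simp

definition uea_eq :: "'a::rat_vector free_rat_algebra \<Rightarrow> 'a free_rat_algebra \<Rightarrow> bool" where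
  "uea_eq P Q \<longleftrightarrow> P - Q \<in> uea_ideal"

quotient_type (overloaded) 'a uea = "'a::rat_vector free_rat_algebra" / uea_eq
proof (rule equivpI)
  show "reflp (uea_eq :: 'a free_rat_algebra \<Rightarrow> _)"
    by (auto simp: reflp_def uea_eq_def uea_ideal_zero)
  show "symp (uea_eq :: 'a free_rat_algebra \<Rightarrow> _)"
    unfolding symp_def uea_eq_def using uea_ideal_uminus by fastforce
  show "transp (uea_eq :: 'a free_rat_algebra \<Rightarrow> _)"
    unfolding transp_def uea_eq_def using uea_ideal.add by fastforce
qed

instantiation uea :: (rat_vector) ring_1
begin

lift_definition zero_uea :: "'a uea" is 0 .
lift_definition one_uea :: "'a uea" is 1 .
lift_definition plus_uea :: "'a uea \<Rightarrow> 'a uea \<Rightarrow> 'a uea" is "(+)"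
  by (simp add: uea_eq_def add_diff_add uea_ideal.add)
lift_definition uminus_uea :: "'a uea \<Rightarrow> 'a uea" is uminus
proof -
  fix P P' :: "'a free_rat_algebra"
  assume "uea_eq P P'"
  then have "- (P - P') \<in> uea_ideal" unfolding uea_eq_def by (rule uea_ideal_uminus)
  then show "uea_eq (- P) (- P')" by (simp add: uea_eq_def)
qed
lift_definition minus_uea :: "'a uea \<Rightarrow> 'a uea \<Rightarrow> 'a uea" is "(-)"
proof -
  fix P P' Q Q' :: "'a free_rat_algebra"
  assume *: "uea_eq P P'" "uea_eq Q Q'"
  have "P - Q - (P' - Q') = (P - P') + - (Q - Q')" by simp
  moreover have "(P - P') + - (Q - Q') \<in> uea_ideal"
    using * unfolding uea_eq_def by (intro uea_ideal.add uea_ideal_uminus)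
  ultimately show "uea_eq (P - Q) (P' - Q')"
    by (simp only: uea_eq_def)
qed
lift_definition times_uea :: "'a uea \<Rightarrow> 'a uea \<Rightarrow> 'a uea" is "(*)"
proof -
  fix P P' Q Q' :: "'a free_rat_algebra"
  assume *: "uea_eq P P'" "uea_eq Q Q'"
  have "P * Q - P' * Q' = (P - P') * Q + P' * (Q - Q')" by (simp add: algebra_simps)
  moreover have "(P - P') * Q + P' * (Q - Q') \<in> uea_ideal"
    using * unfolding uea_eq_def by (intro uea_ideal.add uea_ideal.mult_left uea_ideal.mult_right)
  ultimately show "uea_eq (P * Q) (P' * Q')"
    by (simp only: uea_eq_def)
qed

lemma uea_one_neq_zero_aux:
  assumes "P \<in> uea_ideal"
  shows "Poly_Mapping.lookup P (0 :: 'b::rat_vector free_word) = 0"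
proof -
  have mult0: "Poly_Mapping.lookup (A * B) 0 = Poly_Mapping.lookup A 0 * Poly_Mapping.lookup B 0"
    for A B :: "'b free_rat_algebra"
  proof -
    have *: "(0 = v + w) \<longleftrightarrow> v = 0 \<and> w = 0" for v w :: "'b free_word"
      by (cases v; cases w) (auto simp: zero_free_word_def plus_free_word_def)
    have inner: "Sum_any (\<lambda>w. Poly_Mapping.lookup B w when 0 = v + w)
        = (Poly_Mapping.lookup B 0 when v = 0)" for v :: "'b free_word"
    proof (cases "v = 0")
      case True
      then show ?thesis by simp
    next
      case False
      then have "\<not> 0 = v + w" for w using * by blast
      with False show ?thesis by simp
    qed
    show ?thesis
      unfolding lookup_mult inner by (simp add: mult_when)
  qed
  have gen0: "Poly_Mapping.lookup (free_gen x) 0 = 0" for x :: 'b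
    by (simp add: free_gen_def lookup_single zero_free_word_def)
  show ?thesis
    using assms
    by induction (auto simp: mult0 gen0 lookup_add lookup_minus)
qed

instance
proof
  fix x y z :: "'a uea"
  show "x + y + z = x + (y + z)" by transfer (simp add: uea_eq_def add.assoc uea_ideal_zero)
  show "x + y = y + x" by transfer (simp add: uea_eq_def add.commute uea_ideal_zero)
  show "0 + x = x" by transfer (simp add: uea_eq_def uea_ideal_zero)
  show "- x + x = 0" by transfer (simp add: uea_eq_def uea_ideal_zero)
  show "x - y = x + - y" by transfer (simp add: uea_eq_def uea_ideal_zero)
  show "x * y * z = x * (y * z)" by transfer (simp add: uea_eq_def mult.assoc uea_ideal_zero)
  show "1 * x = x" by transfer (simp add: uea_eq_def uea_ideal_zero)
  show "x * 1 = x" by transfer (simp add: uea_eq_def uea_ideal_zero)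
  show "(x + y) * z = x * z + y * z" by transfer (simp add: uea_eq_def distrib_right uea_ideal_zero)
  show "x * (y + z) = x * y + x * z" by transfer (simp add: uea_eq_def distrib_left uea_ideal_zero)
  show "(0 :: 'a uea) \<noteq> 1"
    by transfer (auto simp: uea_eq_def lookup_one dest!: uea_one_neq_zero_aux)
qed

end

definition uea_gen :: "'a::rat_vector \<Rightarrow> 'a uea" where
  "uea_gen x = abs_uea (free_gen x)"

lemma uea_gen_commute: "uea_gen x * uea_gen y = uea_gen y * uea_gen x"
  by (simp add: uea_gen_def times_uea.abs_eq uea.abs_eq_iff uea_eq_def uea_ideal.gen_bracket)

lemma uea_induct [case_names const gen add mult]:
  assumes const: "\<And>q. Q (abs_uea (Poly_Mapping.single 0 q))"
    and gen: "\<And>x. Q (uea_gen x)"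
    and add: "\<And>a b. Q a \<Longrightarrow> Q b \<Longrightarrow> Q (a + b)"
    and mult: "\<And>a b. Q a \<Longrightarrow> Q b \<Longrightarrow> Q (a * b)"
  shows "Q a"
proof -
  have word: "Q (abs_uea (Poly_Mapping.single (Word xs) 1))" for xs
  proof (induction xs)
    case Nil
    then show ?case using const[of 1] by (simp add: zero_free_word_def)
  next
    case (Cons x xs)
    have "Poly_Mapping.single (Word (x # xs)) 1
        = (free_gen x * Poly_Mapping.single (Word xs) 1 :: 'a free_rat_algebra)"
      by (simp add: free_gen_def mult_single plus_free_word_def)
    then show ?case
      using mult[OF gen Cons.IH] by (simp add: uea_gen_def times_uea.abs_eq)
  qed
  have mono: "Q (abs_uea (Poly_Mapping.single w q))" for w q
  proof -
    have "Poly_Mapping.single w q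
        = (Poly_Mapping.single 0 q * Poly_Mapping.single w 1 :: 'a free_rat_algebra)"
      by (simp add: mult_single)
    then show ?thesis
      using mult[OF const word] by (cases w) (simp add: times_uea.abs_eq)
  qed
  have "Q (abs_uea P)" for P
  proof (induction P rule: update_induct)
    case const
    then show ?case using assms(1)[of 0] by simp
  next
    case (update f a b)
    have "Poly_Mapping.update a b f = Poly_Mapping.single a b + f"
      using update(1)
      by (intro poly_mapping_eqI) (auto simp: lookup_update lookup_add lookup_single in_keys_iff when_def)
    then show ?case using add[OF mono update.IH] by (simp add: plus_uea.abs_eq)
  qed
  then show ?thesis by (induction a rule: uea.abs_induct) auto
qed

lemma single_zero_commute:
  fixes P :: "'a::monoid_add \<Rightarrow>\<^sub>0 'b::comm_semiring_1"
  shows "Poly_Mapping.single 0 q * P = P * Poly_Mapping.single 0 q"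
proof (induction P rule: update_induct)
  case const
  then show ?case by simp
next
  case (update f a b)
  have "Poly_Mapping.update a b f = Poly_Mapping.single a b + f"
    using update(1)
    by (intro poly_mapping_eqI) (auto simp: lookup_update lookup_add lookup_single in_keys_iff when_def)
  then show ?case using update.IH by (simp add: distrib_left distrib_right mult_single mult.commute)
qed

lemma uea_const_commute:
  "abs_uea (Poly_Mapping.single 0 q) * x = x * abs_uea (Poly_Mapping.single 0 q)"
  by (induction x rule: uea.abs_induct) (simp add: times_uea.abs_eq single_zero_commute)

lemma uea_mult_commute: "a * b = b * (a :: 'a::rat_vector uea)"
proof -
  have "uea_gen x * b = b * uea_gen x" for x :: 'a
  proof (induction b rule: uea_induct)
    case (mult a b)
    then show ?case by (metis mult.assoc)
  qed (auto simp: uea_const_commute uea_gen_commute algebra_simps)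
  then show ?thesis
  proof (induction a rule: uea_induct)
    case (mult c d)
    then show ?case by (metis mult.assoc)
  qed (auto simp: uea_const_commute algebra_simps)
qed

instantiation uea :: (rat_vector) rat_algebra
begin

definition scaleQ_uea :: "rat \<Rightarrow> 'a uea \<Rightarrow> 'a uea" where
  "q *\<^sub>Q x = abs_uea (Poly_Mapping.single 0 q) * x"

instance
proof
  fix q r :: rat and x y z :: "'a uea"
  show "x * y = y * x" by (rule uea_mult_commute)
  show "1 * x = x" by simp
  show "(x + y) * z = x * z + y * z" by (rule distrib_right)
  show "q *\<^sub>Q (x + y) = q *\<^sub>Q x + q *\<^sub>Q y" by (simp add: scaleQ_uea_def distrib_left)
  show "(q + r) *\<^sub>Q x = q *\<^sub>Q x + r *\<^sub>Q x"
    by (simp add: scaleQ_uea_def single_add distrib_right flip: plus_uea.abs_eq)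
  show "q *\<^sub>Q (r *\<^sub>Q x) = (q * r) *\<^sub>Q x"
    by (simp add: scaleQ_uea_def mult_single times_uea.abs_eq flip: mult.assoc)
  show "1 *\<^sub>Q x = x"
    by (simp add: scaleQ_uea_def flip: one_uea.abs_eq)
  show "(q *\<^sub>Q x) * y = q *\<^sub>Q (x * y)"
    by (simp add: scaleQ_uea_def mult.assoc)
qed

end


section \<open>Conjugacy classes and the centre of the rational group algebra\<close>

text \<open>
  A group is a type of class \<open>group_add\<close>; despite the additive notation, this class does not
  assume commutativity. The group algebra over \<open>'a\<close> is \<open>'g \<Rightarrow>\<^sub>0 'a\<close>, whose multiplication is
  convolution; its scalars are the elements \<open>Poly_Mapping.single 0 a\<close>.
\<close>

definition conjugate :: "'g::group_add \<Rightarrow> 'g \<Rightarrow> bool" where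
  "conjugate x y \<longleftrightarrow> (\<exists>g. y = g + x - g)"

quotient_type (overloaded) 'g conj_class = "'g::group_add" / conjugate
proof (rule equivpI)
  show "reflp (conjugate :: 'g \<Rightarrow> _)"
  proof (rule reflpI)
    fix x :: 'g
    have "x = 0 + x - 0" by simp
    then show "conjugate x x" unfolding conjugate_def by (rule exI)
  qed
  show "symp (conjugate :: 'g \<Rightarrow> _)"
  proof (rule sympI)
    fix x y :: 'g assume "conjugate x y"
    then obtain g where "y = g + x - g" by (auto simp: conjugate_def)
    then have "x = - g + y - - g" 
      by (simp only: diff_minus_eq_add add_diff_eq minus_add_cancel diff_add_cancel)
    then show "conjugate y x" unfolding conjugate_def by (rule exI)
  qed
  show "transp (conjugate :: 'g \<Rightarrow> _)"
  proof (rule transpI)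
    fix x y z :: 'g assume "conjugate x y" "conjugate y z"
    then obtain g h where "y = g + x - g" "z = h + y - h" by (auto simp: conjugate_def)
    then have "z = (h + g) + x - (h + g)"
      by (simp only: diff_add_eq_diff_diff_swap add_diff_eq add.assoc[symmetric])
    then show "conjugate x z" unfolding conjugate_def by (rule exI)
  qed
qed

instance conj_class :: ("{group_add, finite}") finite
proof
  have "c \<in> range abs_conj_class" for c :: "'a conj_class"
    by (induction c rule: conj_class.abs_induct) (rule rangeI)
  then have "(UNIV :: 'a conj_class set) \<subseteq> range abs_conj_class" by blast
  moreover have "finite (range (abs_conj_class :: 'a \<Rightarrow> 'a conj_class))"
    by (rule finite_imageI[OF finite])
  ultimately show "finite (UNIV :: 'a conj_class set)"
    by (rule finite_subset)
qed

definition class_sum :: "'g::{group_add, finite} conj_class \<Rightarrow> ('g \<Rightarrow>\<^sub>0 'a::comm_ring_1)" where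
  "class_sum c = (\<Sum>g | abs_conj_class g = c. Poly_Mapping.single g 1)"

lemma class_sum_central: "class_sum c * P = P * class_sum c"
proof (induction P rule: update_induct)
  case const
  then show ?case by simp
next
  case (update f a b)
  have upd: "Poly_Mapping.update a b f = Poly_Mapping.single a b + f"
    using update(1)
    by (intro poly_mapping_eqI) (auto simp: lookup_update lookup_add lookup_single in_keys_iff when_def)
  have conj: "abs_conj_class (h + g - h) = abs_conj_class g" for g h :: 'a
    by (metis conj_class.abs_eq_iff conjugate_def)
  have conj': "abs_conj_class (- h + g + h) = abs_conj_class g" for g h :: 'a
    using conj[of "- h" g] by simp
  have cancel: "- a + (a + g - a) + a = g" for g
    by (simp only: add_diff_eq minus_add_cancel diff_add_cancel)
  have shift: "a + (- a + g + a) = g + a" for g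
    by (simp only: add.assoc add_minus_cancel)
  have "(\<Sum>g | abs_conj_class g = c. Poly_Mapping.single (g + a) b)
      = (\<Sum>g | abs_conj_class g = c. Poly_Mapping.single (a + g) b)"
    by (rule sum.reindex_bij_witness[of _ "\<lambda>g. a + g - a" "\<lambda>g. - a + g + a"])
       (simp_all only: mem_Collect_eq conj conj' cancel shift add_diff_cancel)
  then have "class_sum c * Poly_Mapping.single a b = Poly_Mapping.single a b * class_sum c"
    by (simp only: class_sum_def sum_distrib_left sum_distrib_right mult_single mult_1_left mult_1_right)
  then show ?case by (simp only: upd distrib_left distrib_right update.IH)
qed

typedef (overloaded) 'g rat_centre = "{z :: 'g::group_add \<Rightarrow>\<^sub>0 rat. \<forall>w. z * w = w * z}"
  morphisms centre_elem Abs_rat_centre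
  by (rule exI[of _ 0]) simp

setup_lifting type_definition_rat_centre

instantiation rat_centre :: (group_add) rat_algebra
begin

lift_definition zero_rat_centre :: "'a rat_centre" is 0 by simp
lift_definition one_rat_centre :: "'a rat_centre" is 1 by simp
lift_definition plus_rat_centre :: "'a rat_centre \<Rightarrow> 'a rat_centre \<Rightarrow> 'a rat_centre" is "(+)"
  by (simp only: mem_Collect_eq distrib_left distrib_right)
lift_definition uminus_rat_centre :: "'a rat_centre \<Rightarrow> 'a rat_centre" is uminus
  by (simp only: mem_Collect_eq mult_minus_left mult_minus_right)
lift_definition minus_rat_centre :: "'a rat_centre \<Rightarrow> 'a rat_centre \<Rightarrow> 'a rat_centre" is "(-)"
  by (simp only: mem_Collect_eq left_diff_distrib right_diff_distrib)
lift_definition times_rat_centre :: "'a rat_centre \<Rightarrow> 'a rat_centre \<Rightarrow> 'a rat_centre" is "(*)"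
  by (metis mult.assoc)
lift_definition scaleQ_rat_centre :: "rat \<Rightarrow> 'a rat_centre \<Rightarrow> 'a rat_centre"
  is "\<lambda>q z. Poly_Mapping.single 0 q * z"
  by (metis mult.assoc single_zero_commute)

instance
proof
  fix q r :: rat and x y z :: "'a rat_centre"
  show "x + y + z = x + (y + z)" by transfer (rule add.assoc)
  show "x + y = y + x" by transfer (rule add.commute)
  show "0 + x = x" by transfer (rule add_0_left)
  show "- x + x = 0" by transfer (rule left_minus)
  show "x - y = x + - y" by transfer (rule diff_conv_add_uminus)
  show "x * y * z = x * (y * z)" by transfer (rule mult.assoc)
  show "x * y = y * x" by transfer blast
  show "1 * x = x" by transfer (rule mult_1_left)
  show "(x + y) * z = x * z + y * z" by transfer (rule distrib_right)
  show "(0 :: 'a rat_centre) \<noteq> 1" by transfer simp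
  show "q *\<^sub>Q (x + y) = q *\<^sub>Q x + q *\<^sub>Q y" by transfer (rule distrib_left)
  show "(q + r) *\<^sub>Q x = q *\<^sub>Q x + r *\<^sub>Q x" by transfer (simp only: single_add distrib_right)
  show "q *\<^sub>Q (r *\<^sub>Q x) = (q * r) *\<^sub>Q x" by transfer (simp only: mult.assoc[symmetric] mult_single add_0_left)
  show "1 *\<^sub>Q x = x" by transfer (simp only: single_one mult_1_left)
  show "(q *\<^sub>Q x) * y = q *\<^sub>Q (x * y)" by transfer (rule mult.assoc)
qed

end

lift_definition class_elem :: "'g::{group_add, finite} conj_class \<Rightarrow> 'g rat_centre" is class_sum
  by (simp add: class_sum_central)


section \<open>The subring spanned by the coefficients B\<close>

definition B_coeff :: "'g::{group_add, finite} conj_class multiset \<Rightarrow> 'g rat_centre uea" where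
  "B_coeff = mps_nth (mps_exp (mps_map uea_gen
     (mps_ln1p (\<Sum>c\<in>UNIV. mps_const (class_elem c) * mps_var c))))"

definition R_Gamma :: "'g::{group_add, finite} rat_centre uea set" where
  "R_Gamma = {\<Sum>N\<in>S. of_int (a N) * B_coeff N | S a. finite S}"

definition additive_on :: "'a::ring_1 set \<Rightarrow> ('a \<Rightarrow> 'b::ring_1) \<Rightarrow> bool" where
  "additive_on R \<phi> \<longleftrightarrow> (\<forall>x\<in>R. \<forall>y\<in>R. \<phi> (x + y) = \<phi> x + \<phi> y)"

definition ring_hom_on :: "'a::ring_1 set \<Rightarrow> ('a \<Rightarrow> 'b::ring_1) \<Rightarrow> bool" where
  "ring_hom_on R \<phi> \<longleftrightarrow>
     additive_on R \<phi> \<and> (\<forall>x\<in>R. \<forall>y\<in>R. \<phi> (x * y) = \<phi> x * \<phi> y) \<and> \<phi> 1 = 1"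


section \<open>Blocks and central characters\<close>

definition two_sided_ideal :: "'r::ring_1 set \<Rightarrow> bool" where
  "two_sided_ideal I \<longleftrightarrow>
     0 \<in> I \<and> (\<forall>x\<in>I. \<forall>y\<in>I. x + y \<in> I) \<and> (\<forall>r. \<forall>x\<in>I. r * x \<in> I \<and> x * r \<in> I)"

definition direct_sum_of :: "'r::ring_1 set \<Rightarrow> 'r set \<Rightarrow> 'r set \<Rightarrow> bool" where
  "direct_sum_of A B C \<longleftrightarrow> two_sided_ideal A \<and> two_sided_ideal B \<and>
     C = {a + b | a b. a \<in> A \<and> b \<in> B} \<and> A \<inter> B = {0}"

text \<open>
  Blocks are the indecomposable two-sided ideals occurring in a decomposition of the ring, i.e.
  the indecomposable direct summands. Being a direct summand is essential: an ideal such as the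
  radical may be indecomposable without being a block.
\<close>

definition blocks :: "'r::ring_1 set set" where
  "blocks = {C. two_sided_ideal C \<and> C \<noteq> {0} \<and> (\<exists>D. direct_sum_of C D UNIV) \<and>
     (\<forall>A B. direct_sum_of A B C \<longrightarrow> A = {0} \<or> B = {0})}"

text \<open>A left module structure on the additive subgroup \<open>V\<close> of \<open>'v\<close>\<close>

definition left_module :: "'v::ab_group_add set \<Rightarrow> ('r::ring_1 \<Rightarrow> 'v \<Rightarrow> 'v) \<Rightarrow> bool" where
  "left_module V act \<longleftrightarrow>
     0 \<in> V \<and> (\<forall>v\<in>V. \<forall>w\<in>V. v - w \<in> V) \<and> (\<forall>r. \<forall>v\<in>V. act r v \<in> V) \<and>
     (\<forall>r. \<forall>v\<in>V. \<forall>w\<in>V. act r (v + w) = act r v + act r w) \<and>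
     (\<forall>r s. \<forall>v\<in>V. act (r + s) v = act r v + act s v) \<and>
     (\<forall>r s. \<forall>v\<in>V. act (r * s) v = act r (act s v)) \<and>
     (\<forall>v\<in>V. act 1 v = v)"

definition simple_module :: "'v::ab_group_add set \<Rightarrow> ('r::ring_1 \<Rightarrow> 'v \<Rightarrow> 'v) \<Rightarrow> bool" where
  "simple_module V act \<longleftrightarrow> left_module V act \<and> V \<noteq> {0} \<and>
     (\<forall>W \<subseteq> V. left_module W act \<longrightarrow> W = {0} \<or> W = V)"

text \<open>A simple module \<open>V\<close> belongs to the block \<open>C\<close> if \<open>C V = V\<close>, equivalently \<open>C V \<noteq> 0\<close>.\<close>

definition belongs_to :: "'v::ab_group_add set \<Rightarrow> ('r::ring_1 \<Rightarrow> 'v \<Rightarrow> 'v) \<Rightarrow> 'r set \<Rightarrow> bool" where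
  "belongs_to V act C \<longleftrightarrow> (\<exists>x\<in>C. \<exists>v\<in>V. act x v \<noteq> 0)"

text \<open>
  The simple modules are taken with underlying additive group inside the vector space
  \<open>'g \<Rightarrow>\<^sub>0 'f\<close>, but with an arbitrary action. Up to isomorphism these are all simple modules, since
  the dimension of a simple module is at most the order of the group.
\<close>

definition central_char ::
    "('g::{group_add, finite} \<Rightarrow>\<^sub>0 'f::field) set \<Rightarrow> 'g conj_class \<Rightarrow> 'f" where
  "central_char C c = (THE \<omega>. \<forall>(V :: ('g \<Rightarrow>\<^sub>0 'f) set) act.
     simple_module V act \<and> belongs_to V act C \<longrightarrow>
       (\<forall>v\<in>V. act (class_sum c) v = act (Poly_Mapping.single 0 \<omega>) v))"


section \<open>p-adic integers and evaluations\<close>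

text \<open>
  The p-adic integers as the inverse limit of the rings \<open>\<int>/p\<^sup>n\<close>: \<open>t n\<close> is the residue of \<open>t\<close>
  modulo \<open>p ^ n\<close>, and ring operations are performed componentwise modulo \<open>p ^ n\<close>.
\<close>

definition padic_ints :: "nat \<Rightarrow> (nat \<Rightarrow> int) set" where
  "padic_ints p = {t. \<forall>n. 0 \<le> t n \<and> t n < int p ^ n \<and> t (Suc n) mod int p ^ n = t n}"

text \<open>
  \<open>t choose r\<close> is the p-adic integer \<open>b\<close> with \<open>r! b = t (t - 1) \<cdots> (t - r + 1)\<close>.
\<close>

definition padic_binomial :: "nat \<Rightarrow> (nat \<Rightarrow> int) \<Rightarrow> nat \<Rightarrow> (nat \<Rightarrow> int)" where
  "padic_binomial p t r = (THE b. b \<in> padic_ints p \<and>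
     (\<forall>n. (fact r * b n) mod int p ^ n = (\<Prod>i<r. t n - int i) mod int p ^ n))"

text \<open>
  The map from the p-adic integers through \<open>\<int>/p\<close> to a ring; it is a ring homomorphism
  if the ring has characteristic \<open>p\<close>.
\<close>

definition padic_reduce :: "(nat \<Rightarrow> int) \<Rightarrow> 'f::comm_ring_1" where
  "padic_reduce t = of_int (t 1)"

text \<open>\<open>(1 + f) ^ t\<close> for a series \<open>f\<close> without constant term\<close>

definition mps_padic_power ::
    "nat \<Rightarrow> (nat \<Rightarrow> int) \<Rightarrow> ('v, 'f::comm_ring_1) mps \<Rightarrow> ('v, 'f) mps" where
  "mps_padic_power p t = mps_subst (\<lambda>r. padic_reduce (padic_binomial p t r))"

definition eval_series ::
    "nat \<Rightarrow> (('g::{group_add, finite} \<Rightarrow>\<^sub>0 'f::field) set \<Rightarrow> nat \<Rightarrow> int) \<Rightarrow> ('g conj_class, 'f) mps" where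
  "eval_series p t =
     (\<Prod>C\<in>blocks. mps_padic_power p (t C) (\<Sum>c\<in>UNIV. mps_const (central_char C c) * mps_var c))"

text \<open>
  \<open>\<phi>\<close> is the evaluation attached to the family \<open>t\<close>, i.e. the additive map on \<open>R_Gamma\<close> that sends
  each basis element \<open>B_coeff N\<close> to the coefficient at \<open>N\<close>. Only the values of \<open>\<phi>\<close> on \<open>R_Gamma\<close> matter.
\<close>

definition is_evaluation ::
    "nat \<Rightarrow> (('g::{group_add, finite} \<Rightarrow>\<^sub>0 'f::field) set \<Rightarrow> nat \<Rightarrow> int) \<Rightarrow>
     ('g rat_centre uea \<Rightarrow> 'f) \<Rightarrow> bool" where
  "is_evaluation p t \<phi> \<longleftrightarrow>
     additive_on R_Gamma \<phi> \<and> (\<forall>N. \<phi> (B_coeff N) = mps_nth (eval_series p t) N)"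

end

theory Submission imports Defs begin

text \<open>
  Write \<open>B(x) = \<Sum>N. B_coeff N x\<^sup>N\<close>. The logarithm turns products into sums and the exponential turns sums
  into products, so \<open>B(x) B(y) = B(x \<star> y)\<close>, where \<open>x \<star> y\<close> (\<open>star\<close> below) is the product of the units
  \<open>1 + \<Sum>c. c x\<^sub>c\<close> and \<open>1 + \<Sum>c. c y\<^sub>c\<close> in coordinates. This is a formal group law whose coefficients are the
  integral multiplication constants of the class sums. Hence products of the \<open>B_coeff N\<close> are integral
  combinations of them with universal coefficients. As the \<open>B_coeff N\<close> are linearly independent
  (\<open>B_linear_independent\<close>), a homomorphism from \<open>R_Gamma\<close> to \<open>F\<close> is the same thing as a power series \<open>b\<close> over
  \<open>F\<close> with constant term \<open>1\<close> and \<open>b(x) b(y) = b(x \<star> y)\<close> (\<open>ring_hom_on_iff_multiplicative\<close>), that is, a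
  character of the formal group of units of the centre of \<open>F\<Gamma>\<close>.

  Evaluations are such characters (\<open>multiplicative_eval_series\<close>): a central character \<open>\<omega>\<close> is multiplicative on
  the centre, hence \<open>1 + \<Sum>c. \<omega>\<^sub>c x\<^sub>c\<close> is multiplicative for \<open>\<star>\<close>, and so is each of its p-adic powers.

  Conversely, the centre is the direct sum of the components of the primitive central idempotents \<open>e\<close>,
  which correspond to the blocks (\<open>blocks_eq\<close>), and in the component of \<open>e\<close> a class sum \<open>c\<close> is \<open>\<omega>\<^sub>c e\<close>
  up to a nilpotent element (\<open>block_scalar_exists\<close>, \<open>central_char_eq\<close>). For a sufficiently high power \<open>q\<close> of \<open>p\<close> this
  gives \<open>(1 + \<Sum>c. c x\<^sub>c)\<^sup>q = \<Prod>e. (1 + (\<Sum>c. \<omega>\<^sub>c x\<^sub>c) e)\<^sup>q\<close>. The map \<open>f \<mapsto> f\<^sup>q\<close> is injective on power series over \<open>F\<close>, so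
  a character \<open>b\<close> is the product of the series \<open>G\<^sub>e(\<Sum>c. \<omega>\<^sub>c x\<^sub>c)\<close>, where \<open>G\<^sub>e(y)\<close> is the value of the character at
  \<open>1 + y e\<close>. Each \<open>G\<^sub>e\<close> is a character of the multiplicative formal group. In characteristic \<open>p\<close> such a series
  has the form \<open>(1 + y)\<^sup>d H(y\<^sup>p)\<close> with \<open>0 \<le> d < p\<close> and \<open>H\<close> again a character, and repeating this reads off the
  digits of a p-adic integer \<open>t\<close> with \<open>G\<^sub>e(y) = (1 + y)\<^sup>t\<close> (\<open>grouplike_padic\<close>).
\<close>

section \<open>Power series up to a given degree\<close>

lemma mps_nth_simps [simp]:
  fixes f g :: "('v, 'a::comm_ring_1) mps"
  shows "mps_nth 0 N = (0::'a)"
    and "mps_nth 1 N = (if N = {#} then 1 else (0::'a))"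
    and "mps_nth (f + g) N = mps_nth f N + mps_nth g N"
    and "mps_nth (f - g) N = mps_nth f N - mps_nth g N"
    and "mps_nth (- f) N = - mps_nth f N"
    and "mps_nth (mps_const x) N = (if N = {#} then x else (0::'a))"
    and "mps_nth (mps_var v) N = (if N = {#v#} then 1 else (0::'a))"
  by (transfer; simp)+

lemma mps_nth_map [simp]: "mps_nth (mps_map \<phi> f) N = \<phi> (mps_nth f N)"
  by transfer simp

lemma mps_nth_Abs [simp]: "mps_nth (Abs_mps f) = f"
  by (simp add: Abs_mps_inverse)

lemma mps_nth_mult:
  fixes f g :: "('v, 'a::comm_ring_1) mps"
  shows "mps_nth (f * g) N = (\<Sum>A | A \<subseteq># N. mps_nth f A * mps_nth g (N - A))"
  by transfer simp

lemma mps_nth_sum: "mps_nth (sum h S) N = (\<Sum>i\<in>S. mps_nth (h i :: ('v, 'a::comm_ring_1) mps) N)"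
  by (induction S rule: infinite_finite_induct) auto

lemma mps_nth_mult_empty [simp]:
  "mps_nth (f * g) {#} = mps_nth f {#} * mps_nth (g :: ('v, 'a::comm_ring_1) mps) {#}"
  by (simp add: mps_nth_mult)

lemma mps_nth_power_empty [simp]:
  "mps_nth (f ^ n) {#} = mps_nth (f :: ('v, 'a::comm_ring_1) mps) {#} ^ n"
  by (induction n) auto

lemma mps_nth_prod_empty:
  "mps_nth (prod h S) {#} = (\<Prod>i\<in>S. mps_nth (h i :: ('v, 'a::comm_ring_1) mps) {#})"
  by (induction S rule: infinite_finite_induct) auto

lemma mps_nth_const_mult [simp]:
  "mps_nth (mps_const a * f) N = a * mps_nth (f :: ('v, 'a::comm_ring_1) mps) N"
proof -
  have "mps_nth (mps_const a * f) N = (\<Sum>A\<in>{{#}}. mps_nth (mps_const a) A * mps_nth f (N - A))"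
    unfolding mps_nth_mult by (rule sum.mono_neutral_right) (auto simp: finite_submultisets)
  then show ?thesis by simp
qed

lemma mps_const_simps:
  shows "mps_const (0 :: 'a::comm_ring_1) = 0" "mps_const (1 :: 'a) = 1"
    and "mps_const (a + b) = mps_const a + mps_const (b :: 'a)"
    and "mps_const (a * b) = mps_const a * mps_const (b :: 'a)"
    and "mps_const (a ^ n) = mps_const (a :: 'a) ^ n"
    and "mps_const (sum h S) = (\<Sum>i\<in>S. mps_const (h i :: 'a))"
proof -
  show 0: "mps_const (0 :: 'a) = 0" and 1: "mps_const (1 :: 'a) = 1"
    by (auto intro!: mps_eqI)
  have add: "mps_const (a + b) = mps_const a + mps_const (b :: 'a)" for a b
    by (auto intro!: mps_eqI)
  have mult: "mps_const (a * b) = mps_const a * mps_const (b :: 'a)" for a b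
    by (auto intro!: mps_eqI)
  show "mps_const (a + b) = mps_const a + mps_const (b :: 'a)"
    and "mps_const (a * b) = mps_const a * mps_const (b :: 'a)"
    by (rule add mult)+
  show "mps_const (a ^ n) = mps_const (a :: 'a) ^ n"
    by (induction n) (auto simp: 1 mult)
  show "mps_const (sum h S) = (\<Sum>i\<in>S. mps_const (h i :: 'a))"
    by (induction S rule: infinite_finite_induct) (auto simp: 0 add)
qed

text \<open>
  Infinite sums of series are handled modulo the monomials of degree above \<open>n\<close>, where they become
  finite; two series that agree up to every degree are equal.
\<close>

definition mps_agree :: "nat \<Rightarrow> ('v, 'a) mps \<Rightarrow> ('v, 'a) mps \<Rightarrow> bool" where
  "mps_agree n f g \<longleftrightarrow> (\<forall>N. size N \<le> n \<longrightarrow> mps_nth f N = mps_nth g N)"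

lemma mps_agree_refl [simp]: "mps_agree n f f"
  by (simp add: mps_agree_def)

lemma mps_agree_sym: "mps_agree n f g \<Longrightarrow> mps_agree n g f"
  by (simp add: mps_agree_def)

lemma mps_agree_trans [trans]: "mps_agree n f g \<Longrightarrow> mps_agree n g h \<Longrightarrow> mps_agree n f h"
  by (simp add: mps_agree_def)

lemma mps_agree_all_imp_eq: "(\<And>n. mps_agree n f g) \<Longrightarrow> f = g"
  by (rule mps_eqI) (auto simp: mps_agree_def)

lemma mps_agree_mult:
  fixes f g :: "('v, 'a::comm_ring_1) mps"
  assumes "mps_agree n f f'" "mps_agree n g g'"
  shows "mps_agree n (f * g) (f' * g')"
proof -
  have "mps_nth f A * mps_nth g (N - A) = mps_nth f' A * mps_nth g' (N - A)"
    if "size N \<le> n" "A \<subseteq># N" for N A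
    using that assms size_mset_mono[OF that(2)] by (simp add: mps_agree_def size_Diff_submset)
  then show ?thesis
    by (simp add: mps_agree_def mps_nth_mult)
qed

lemma mps_agree_sum:
  "(\<And>i. i \<in> S \<Longrightarrow> mps_agree n (f i) (g i :: ('v, 'a::comm_ring_1) mps)) \<Longrightarrow> mps_agree n (sum f S) (sum g S)"
  by (simp add: mps_agree_def mps_nth_sum)

lemma mps_agree_power:
  "mps_agree n f g \<Longrightarrow> mps_agree n (f ^ k) (g ^ k :: ('v, 'a::comm_ring_1) mps)"
  by (induction k) (auto intro: mps_agree_mult)

text \<open>
  The order of \<open>f\<close> is at least \<open>n\<close>.
\<close>

definition mps_vanishes :: "nat \<Rightarrow> ('v, 'a::zero) mps \<Rightarrow> bool" where
  "mps_vanishes n f \<longleftrightarrow> (\<forall>N. size N < n \<longrightarrow> mps_nth f N = 0)"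

lemma mps_vanishes_mult:
  fixes f g :: "('v, 'a::comm_ring_1) mps"
  assumes "mps_vanishes m f" "mps_vanishes n g"
  shows "mps_vanishes (m + n) (f * g)"
proof -
  have "mps_nth f A * mps_nth g (N - A) = 0" if "size N < m + n" "A \<subseteq># N" for N A
  proof (cases "size A < m")
    case False
    then have "size (N - A) < n"
      using that size_mset_mono[OF that(2)] by (simp add: size_Diff_submset)
    then show ?thesis using assms by (simp add: mps_vanishes_def)
  qed (use assms in \<open>simp add: mps_vanishes_def\<close>)
  then show ?thesis by (auto simp: mps_vanishes_def mps_nth_mult intro!: sum.neutral)
qed

lemma mps_vanishes_power:
  fixes f :: "('v, 'a::comm_ring_1) mps"
  assumes "mps_nth f {#} = 0"
  shows "mps_vanishes r (f ^ r)"
proof (induction r)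
  case (Suc r)
  have "mps_vanishes 1 f" using assms by (simp add: mps_vanishes_def)
  from mps_vanishes_mult[OF this Suc] show ?case by simp
qed (simp add: mps_vanishes_def)

lemma mps_nth_power_eq_0:
  "mps_nth f {#} = (0 :: 'a::comm_ring_1) \<Longrightarrow> size N < r \<Longrightarrow> mps_nth (f ^ r) N = 0"
  using mps_vanishes_power[of f r] by (simp add: mps_vanishes_def)

lemma mps_nth_subst:
  assumes "mps_nth f {#} = 0" "size N \<le> n"
  shows "mps_nth (mps_subst a f) N = (\<Sum>r\<le>n. a r * mps_nth (f ^ r) N)"
  unfolding mps_subst_def mps_nth_Abs
  by (rule sum.mono_neutral_left) (use assms in \<open>auto simp: mps_nth_power_eq_0\<close>)

lemma mps_agree_subst:
  assumes "mps_nth f {#} = 0"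
  shows "mps_agree n (mps_subst a f) (\<Sum>r\<le>n. mps_const (a r) * f ^ r)"
  using assms by (simp add: mps_agree_def mps_nth_sum mps_nth_subst)

lemma mps_nth_subst_empty [simp]: "mps_nth (mps_subst a f) {#} = a 0"
  by (simp add: mps_subst_def)

lemma mps_agree_subst_cong:
  assumes "mps_agree n f g" "\<And>r. r \<le> n \<Longrightarrow> a r = b r"
  shows "mps_agree n (mps_subst a f) (mps_subst b g)"
  using assms mps_agree_power[OF assms(1)] unfolding mps_agree_def mps_subst_def mps_nth_Abs
  by (auto intro!: sum.cong)

lemma mps_map_mult:
  fixes \<phi> :: "'a::comm_ring_1 \<Rightarrow> 'b::comm_ring_1" and f g :: "('v, 'a) mps"
  assumes "\<And>x y. \<phi> (x + y) = \<phi> x + \<phi> y" "\<And>x y. \<phi> (x * y) = \<phi> x * \<phi> y"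
  shows "mps_map \<phi> (f * g) = mps_map \<phi> f * mps_map \<phi> g"
proof -
  have "\<phi> 0 = 0" using assms(1)[of 0 0] by simp
  then have "\<phi> (sum h S) = (\<Sum>i\<in>S. \<phi> (h i))" for h :: "'v multiset \<Rightarrow> 'a" and S
    by (induction S rule: infinite_finite_induct) (auto simp: assms)
  then show ?thesis by (intro mps_eqI) (simp add: mps_nth_mult assms)
qed


section \<open>Composition of power series\<close>

lemma finite_multisets_size_le: "finite {M :: 'v::finite multiset. size M \<le> n}"
proof (induction n)
  case (Suc n)
  have "{M :: 'v multiset. size M \<le> Suc n} \<subseteq> insert {#} (\<Union>v. add_mset v ` {M. size M \<le> n})"
  proof
    fix M :: "'v multiset" assume "M \<in> {M. size M \<le> Suc n}"
    then show "M \<in> insert {#} (\<Union>v. add_mset v ` {M. size M \<le> n})" by (cases M) auto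
  qed
  then show ?case by (rule finite_subset) (use Suc in auto)
qed simp

definition mps_monom :: "('v \<Rightarrow> 'r::comm_monoid_mult) \<Rightarrow> 'v multiset \<Rightarrow> 'r" where
  "mps_monom s M = prod_mset (image_mset s M)"

lemma mps_monom_simps [simp]:
  "mps_monom s {#} = 1"
  "mps_monom s (add_mset v M) = s v * mps_monom s M"
  "mps_monom s (M + N) = mps_monom s M * mps_monom s N"
  by (simp_all add: mps_monom_def)

lemma mps_monom_var:
  "mps_nth (mps_monom mps_var M) N = (if N = M then 1 else 0 :: 'a::comm_ring_1)"
proof (induction M arbitrary: N)
  case (add v M)
  have "mps_nth (mps_var v * mps_monom mps_var M) N
      = (\<Sum>A | A \<subseteq># N. if A = {#v#} then if N - A = M then 1 else 0 else (0 :: 'a))"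
    unfolding mps_nth_mult by (rule sum.cong) (auto simp: add)
  also have "\<dots> = (if N = add_mset v M then 1 else 0)"
    by (subst sum.delta) (auto simp: finite_submultisets)
  finally show ?case by simp
qed simp

text \<open>
  Substitution of the series \<open>s v\<close> for the variables. It is meaningful when the \<open>s v\<close> have no constant
  term: the monomial \<open>M\<close> in the \<open>s v\<close> then has order at least \<open>size M\<close>, so that the coefficient at \<open>N\<close>
  only involves monomials of degree at most \<open>size N\<close>, of which there are finitely many.
\<close>

definition mps_comp :: "('v::finite, 'a::comm_ring_1) mps \<Rightarrow> ('v \<Rightarrow> ('w, 'a) mps) \<Rightarrow> ('w, 'a) mps" where
  "mps_comp f s = Abs_mps (\<lambda>N. \<Sum>M | size M \<le> size N. mps_nth f M * mps_nth (mps_monom s M) N)"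

lemma mps_vanishes_monom:
  fixes s :: "'v \<Rightarrow> ('w, 'a::comm_ring_1) mps"
  assumes "\<And>v. mps_nth (s v) {#} = 0"
  shows "mps_vanishes (size M) (mps_monom s M)"
proof (induction M)
  case (add v M)
  have "mps_vanishes 1 (s v)" using assms by (simp add: mps_vanishes_def)
  from mps_vanishes_mult[OF this add] show ?case by simp
qed (simp add: mps_vanishes_def)

lemma mps_nth_comp:
  assumes "\<And>v. mps_nth (s v) {#} = 0" "size N \<le> n"
  shows "mps_nth (mps_comp f s) N = (\<Sum>M | size M \<le> n. mps_nth f M * mps_nth (mps_monom s M) N)"
  unfolding mps_comp_def mps_nth_Abs
  by (rule sum.mono_neutral_left)
     (use assms mps_vanishes_monom[of s] in \<open>auto simp: mps_vanishes_def finite_multisets_size_le\<close>)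

lemma mps_agree_comp:
  assumes "\<And>v. mps_nth (s v) {#} = 0"
  shows "mps_agree n (mps_comp f s) (\<Sum>M | size M \<le> n. mps_const (mps_nth f M) * mps_monom s M)"
  using assms by (simp add: mps_agree_def mps_nth_sum mps_nth_comp)

lemma mps_nth_comp_empty [simp]: "mps_nth (mps_comp f s) {#} = mps_nth f {#}"
  by (simp add: mps_comp_def)

lemma mps_comp_add: "mps_comp (f + g) s = mps_comp f s + mps_comp g s"
  by (rule mps_eqI) (simp add: mps_comp_def distrib_right sum.distrib)

lemma mps_comp_sum: "mps_comp (sum h S) s = (\<Sum>i\<in>S. mps_comp (h i) s)"
proof (induction S rule: infinite_finite_induct)
  case (infinite S)
  then show ?case by (intro mps_eqI) (simp add: mps_comp_def)
qed (auto simp: mps_comp_add intro!: mps_eqI, simp add: mps_comp_def)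

lemma mps_comp_const [simp]: "mps_comp (mps_const a) s = mps_const a"
proof (rule mps_eqI)
  fix N
  have "mps_nth (mps_comp (mps_const a) s) N
      = (\<Sum>M\<in>{{#}}. mps_nth (mps_const a) M * mps_nth (mps_monom s M) N)"
    unfolding mps_comp_def mps_nth_Abs
    by (rule sum.mono_neutral_right) (auto simp: finite_multisets_size_le)
  then show "mps_nth (mps_comp (mps_const a) s) N = mps_nth (mps_const a) N" by simp
qed

lemma mps_comp_one [simp]: "mps_comp 1 s = 1"
  using mps_comp_const[of 1 s] by (simp add: mps_const_simps)

lemma mps_comp_var:
  assumes "mps_nth (s v) {#} = 0"
  shows "mps_comp (mps_var v) s = s v"
proof (rule mps_eqI)
  fix N :: "'b multiset"
  show "mps_nth (mps_comp (mps_var v) s) N = mps_nth (s v) N"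
  proof (cases "N = {#}")
    case False
    then have "size N \<ge> 1" by (cases N) auto
    then have "mps_nth (mps_comp (mps_var v) s) N
        = (\<Sum>M\<in>{{#v#}}. mps_nth (mps_var v) M * mps_nth (mps_monom s M) N)"
      unfolding mps_comp_def mps_nth_Abs
      by (intro sum.mono_neutral_right) (auto simp: finite_multisets_size_le)
    then show ?thesis by simp
  qed (use assms in simp)
qed

lemma mps_comp_mult:
  assumes s: "\<And>v. mps_nth (s v) {#} = 0"
  shows "mps_comp (f * g) s = mps_comp f s * mps_comp g s"
proof (rule mps_agree_all_imp_eq)
  fix n
  let ?S = "{M. size M \<le> n}"
  let ?t = "\<lambda>A B. mps_const (mps_nth f A) * mps_monom s A * (mps_const (mps_nth g B) * mps_monom s B)"
  note fin = finite_multisets_size_le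
  have eq: "mps_const (mps_nth (f * g) M) * mps_monom s M = (\<Sum>A | A \<subseteq># M. ?t A (M - A))" for M
  proof -
    have "mps_monom s M = mps_monom s A * mps_monom s (M - A)" if "A \<subseteq># M" for A
      using that mps_monom_simps(3)[of s A "M - A"] by simp
    then have "mps_const (mps_nth f A * mps_nth g (M - A)) * mps_monom s M = ?t A (M - A)" if "A \<subseteq># M" for A
      using that by (simp add: mps_const_simps ac_simps)
    then show ?thesis
      unfolding mps_nth_mult mps_const_simps(6) sum_distrib_right by (intro sum.cong) auto
  qed
  have "mps_agree n (mps_comp f s * mps_comp g s) (\<Sum>A\<in>?S. \<Sum>B\<in>?S. ?t A B)"
    unfolding sum_product[symmetric] by (intro mps_agree_mult mps_agree_comp s)
  also have "mps_agree n \<dots> (\<Sum>A\<in>?S. \<Sum>B | size A + size B \<le> n. ?t A B)"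
  proof (rule mps_agree_sum)
    fix A :: "'a multiset" assume "A \<in> ?S"
    have zero: "mps_nth (?t A B) N = 0" if "size N \<le> n" "size A + size B > n" for N B
    proof -
      have "mps_nth (mps_monom s (A + B)) N = 0"
        using mps_vanishes_monom[of s "A + B"] s that unfolding mps_vanishes_def by simp
      moreover have "?t A B = mps_const (mps_nth f A * mps_nth g B) * mps_monom s (A + B)"
        by (simp add: mps_const_simps ac_simps)
      ultimately show ?thesis by (simp only: mps_nth_const_mult mult_zero_right)
    qed
    show "mps_agree n (\<Sum>B\<in>?S. ?t A B) (\<Sum>B | size A + size B \<le> n. ?t A B)"
      unfolding mps_agree_def mps_nth_sum
    proof (intro allI impI sum.mono_neutral_right)
      fix N :: "'c multiset" assume "size N \<le> n"
      then show "\<forall>B\<in>?S - {B. size A + size B \<le> n}. mps_nth (?t A B) N = 0"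
        using zero by (auto simp: not_le)
    qed (auto simp: fin)
  qed
  also have "(\<Sum>A\<in>?S. \<Sum>B | size A + size B \<le> n. ?t A B)
      = (\<Sum>(A, B) \<in> Sigma ?S (\<lambda>A. {B. size A + size B \<le> n}). ?t A B)"
    by (intro sum.Sigma) (auto simp: fin intro: finite_subset[OF _ fin[of n]])
  also have "\<dots> = (\<Sum>(M, A) \<in> Sigma ?S (\<lambda>M. {A. A \<subseteq># M}). ?t A (M - A))"
    by (rule sum.reindex_bij_witness[of _ "\<lambda>(M, A). (A, M - A)" "\<lambda>(A, B). (A + B, A)"])
       (auto simp: size_Diff_submset size_mset_mono intro: order_trans[OF size_mset_mono])
  also have "\<dots> = (\<Sum>M\<in>?S. mps_const (mps_nth (f * g) M) * mps_monom s M)"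
    unfolding eq by (intro sum.Sigma[symmetric]) (auto simp: fin finite_submultisets)
  finally have "mps_agree n (mps_comp f s * mps_comp g s) \<dots>" .
  with mps_agree_comp[of s n "f * g"] s show "mps_agree n (mps_comp (f * g) s) (mps_comp f s * mps_comp g s)"
    by (meson mps_agree_sym mps_agree_trans)
qed

lemma mps_comp_power:
  "(\<And>v. mps_nth (s v) {#} = 0) \<Longrightarrow> mps_comp (f ^ n) s = mps_comp f s ^ n"
  by (induction n) (simp_all add: mps_comp_mult)

lemma mps_comp_prod:
  "(\<And>v. mps_nth (s v) {#} = 0) \<Longrightarrow> mps_comp (prod h S) s = (\<Prod>i\<in>S. mps_comp (h i) s)"
  by (induction S rule: infinite_finite_induct) (simp_all add: mps_comp_mult)

lemma mps_comp_monom: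
  "(\<And>v. mps_nth (s v) {#} = 0) \<Longrightarrow> mps_comp (mps_monom h M) s = mps_monom (\<lambda>v. mps_comp (h v) s) M"
  by (induction M) (simp_all add: mps_comp_mult)

lemma mps_agree_comp_cong:
  assumes "mps_agree n f g"
  shows "mps_agree n (mps_comp f s) (mps_comp g s)"
  using assms unfolding mps_agree_def mps_comp_def mps_nth_Abs by (auto intro!: sum.cong)

lemma mps_comp_subst:
  assumes s: "\<And>v. mps_nth (s v) {#} = 0" and f: "mps_nth f {#} = 0"
  shows "mps_comp (mps_subst a f) s = mps_subst a (mps_comp f s)"
proof (rule mps_agree_all_imp_eq)
  fix n
  have "mps_agree n (mps_comp (mps_subst a f) s) (mps_comp (\<Sum>r\<le>n. mps_const (a r) * f ^ r) s)"
    by (intro mps_agree_comp_cong mps_agree_subst f)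
  also have "mps_comp (\<Sum>r\<le>n. mps_const (a r) * f ^ r) s = (\<Sum>r\<le>n. mps_const (a r) * mps_comp f s ^ r)"
    by (simp add: mps_comp_sum mps_comp_mult mps_comp_power s)
  also have "mps_agree n \<dots> (mps_subst a (mps_comp f s))"
    by (intro mps_agree_sym[OF mps_agree_subst]) (simp add: f)
  finally show "mps_agree n (mps_comp (mps_subst a f) s) (mps_subst a (mps_comp f s))" .
qed

lemma mps_comp_comp:
  assumes s: "\<And>v. mps_nth (s v) {#} = 0" and u: "\<And>v. mps_nth (u v) {#} = 0"
  shows "mps_comp (mps_comp f u) s = mps_comp f (\<lambda>v. mps_comp (u v) s)"
proof (rule mps_agree_all_imp_eq)
  fix n
  have "mps_agree n (mps_comp (mps_comp f u) s)
      (mps_comp (\<Sum>M | size M \<le> n. mps_const (mps_nth f M) * mps_monom u M) s)"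
    by (intro mps_agree_comp_cong mps_agree_comp u)
  also have "mps_comp (\<Sum>M | size M \<le> n. mps_const (mps_nth f M) * mps_monom u M) s
      = (\<Sum>M | size M \<le> n. mps_const (mps_nth f M) * mps_monom (\<lambda>v. mps_comp (u v) s) M)"
    by (simp add: mps_comp_sum mps_comp_mult mps_comp_monom s)
  also have "mps_agree n \<dots> (mps_comp f (\<lambda>v. mps_comp (u v) s))"
    by (intro mps_agree_sym[OF mps_agree_comp]) (simp add: u)
  finally show "mps_agree n (mps_comp (mps_comp f u) s) (mps_comp f (\<lambda>v. mps_comp (u v) s))" .
qed

lemma mps_comp_var_id: "mps_comp f mps_var = f"
proof (rule mps_eqI)
  fix N
  have "mps_nth (mps_comp f mps_var) N = (\<Sum>M | size M \<le> size N. if N = M then mps_nth f M else 0)"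
    unfolding mps_comp_def mps_nth_Abs mps_monom_var by (rule sum.cong) auto
  then show "mps_nth (mps_comp f mps_var) N = mps_nth f N"
    by (simp add: sum.delta finite_multisets_size_le)
qed

lemma mps_map_of_int_mult:
  "mps_map of_int (f * g) = mps_map of_int f * (mps_map of_int g :: ('v, 'a::comm_ring_1) mps)"
  by (rule mps_map_mult) auto

lemma mps_map_of_int_monom:
  "mps_map of_int (mps_monom s M) = mps_monom (\<lambda>v. mps_map of_int (s v) :: ('w, 'a::comm_ring_1) mps) M"
proof (induction M)
  case empty
  show ?case by (auto intro!: mps_eqI)
qed (simp add: mps_map_of_int_mult)

lemma mps_nth_comp_of_int:
  assumes "\<And>v. mps_nth (s v) {#} = 0" "size N \<le> n"
  shows "mps_nth (mps_comp f (\<lambda>v. mps_map of_int (s v))) N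
       = (\<Sum>M | size M \<le> n. mps_nth f M * of_int (mps_nth (mps_monom s M) N))"
  using assms by (subst mps_nth_comp[of _ _ n]) (auto simp flip: mps_map_of_int_monom)

text \<open>
  An additive map \<open>T\<close> need not be multiplicative, but it commutes with multiplication by integers. So applying
  \<open>T\<close> to the coefficients commutes with substitution as soon as the substituted series are integral.
\<close>

lemma mps_map_comp_of_int:
  fixes T :: "'a::comm_ring_1 \<Rightarrow> 'b::comm_ring_1"
  assumes s: "\<And>v. mps_nth (s v) {#} = 0"
    and T: "\<And>x y. T (x + y) = T x + T y"
  shows "mps_map T (mps_comp f (\<lambda>v. mps_map of_int (s v))) = mps_comp (mps_map T f) (\<lambda>v. mps_map of_int (s v))"
proof (rule mps_eqI)
  fix N :: "'d multiset"
  have T0: "T 0 = 0" using T[of 0 0] by simp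
  have sum: "T (sum h S) = (\<Sum>i\<in>S. T (h i))" for h :: "'c multiset \<Rightarrow> 'a" and S
    using T0 by (induction S rule: infinite_finite_induct) (auto simp: T)
  have nat: "T (x * of_nat k) = T x * of_nat k" for x k
    by (induction k) (auto simp: T0 T distrib_left)
  have "T (- x) = - T x" for x using T[of x "- x"] T0 by (simp add: eq_neg_iff_add_eq_0 add.commute)
  then have int: "T (x * of_int k) = T x * of_int k" for x k
    by (cases k rule: int_cases2) (simp_all add: nat)
  show "mps_nth (mps_map T (mps_comp f (\<lambda>v. mps_map of_int (s v)))) N
      = mps_nth (mps_comp (mps_map T f) (\<lambda>v. mps_map of_int (s v))) N"
    by (simp add: mps_nth_comp_of_int[OF s order_refl] sum int)
qed

section \<open>Multiplication of class sums\<close>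

text \<open>
  The structure constants of the class algebra. They are natural numbers independent of the
  coefficient ring, which is what makes all later constructions integral.
\<close>

definition class_mult :: "'g::{group_add, finite} conj_class \<Rightarrow> 'g conj_class \<Rightarrow> 'g conj_class \<Rightarrow> nat" where
  "class_mult c d e = card {(g, h). abs_conj_class g = c \<and> abs_conj_class h = d \<and> g + h = rep_conj_class e}"

lemma abs_rep_conj_class [simp]: "abs_conj_class (rep_conj_class c) = c"
  by (rule Quotient_abs_rep[OF Quotient_conj_class])

lemma lookup_class_sum:
  "Poly_Mapping.lookup (class_sum c :: 'g::{group_add, finite} \<Rightarrow>\<^sub>0 'a::comm_ring_1) g
     = (if abs_conj_class g = c then 1 else 0)"
proof -
  have "Poly_Mapping.lookup (class_sum c :: 'g \<Rightarrow>\<^sub>0 'a) g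
      = (\<Sum>h | abs_conj_class h = c. if h = g then 1 else (0 :: 'a))"
    unfolding class_sum_def lookup_sum by (rule sum.cong) (auto simp: lookup_single when_def)
  then show ?thesis by (simp add: sum.delta)
qed

lemma update_eq_single_add:
  "a \<notin> Poly_Mapping.keys f \<Longrightarrow> Poly_Mapping.update a b f = Poly_Mapping.single a b + (f :: 'k \<Rightarrow>\<^sub>0 'b::comm_monoid_add)"
  by (intro poly_mapping_eqI) (auto simp: lookup_update lookup_add lookup_single in_keys_iff when_def)

lemma poly_mapping_add_induct [case_names zero single add]:
  fixes P :: "'k \<Rightarrow>\<^sub>0 'b::comm_monoid_add"
  assumes "Q 0" "\<And>a b. Q (Poly_Mapping.single a b)" "\<And>f g. Q f \<Longrightarrow> Q g \<Longrightarrow> Q (f + g)"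
  shows "Q P"
  by (induction P rule: update_induct) (auto simp: assms update_eq_single_add)

lemma lookup_single_mult_group:
  fixes P :: "'g::group_add \<Rightarrow>\<^sub>0 'a::comm_semiring_1"
  shows "Poly_Mapping.lookup (Poly_Mapping.single h b * P) (h + k) = b * Poly_Mapping.lookup P k"
    and "Poly_Mapping.lookup (P * Poly_Mapping.single h b) (k + h) = b * Poly_Mapping.lookup P k"
  by (induction P rule: poly_mapping_add_induct)
     (simp_all add: distrib_left distrib_right mult_single lookup_add lookup_single when_def mult.commute)

lemma lookup_single_zero_mult:
  fixes P :: "'g::group_add \<Rightarrow>\<^sub>0 'a::comm_semiring_1"
  shows "Poly_Mapping.lookup (Poly_Mapping.single 0 b * P) k = b * Poly_Mapping.lookup P k"
  using lookup_single_mult_group(1)[of 0 b P k] by simp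

lemma lookup_central_conj:
  fixes z :: "'g::group_add \<Rightarrow>\<^sub>0 'a::comm_ring_1"
  assumes "\<forall>w. z * w = w * z"
  shows "Poly_Mapping.lookup z (h + k - h) = Poly_Mapping.lookup z k"
proof -
  have "Poly_Mapping.lookup z k = Poly_Mapping.lookup (Poly_Mapping.single h 1 * z) (h + k)"
    by (simp add: lookup_single_mult_group)
  also have "\<dots> = Poly_Mapping.lookup (z * Poly_Mapping.single h 1) ((h + k - h) + h)"
    using assms by simp
  also have "\<dots> = Poly_Mapping.lookup z (h + k - h)"
    by (simp only: lookup_single_mult_group mult_1_left)
  finally show ?thesis by simp
qed

lemma lookup_central_rep:
  fixes z :: "'g::group_add \<Rightarrow>\<^sub>0 'a::comm_ring_1"
  assumes "\<forall>w. z * w = w * z"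
  shows "Poly_Mapping.lookup z (rep_conj_class (abs_conj_class k)) = Poly_Mapping.lookup z k"
proof -
  have "conjugate k (rep_conj_class (abs_conj_class k))"
    by (simp flip: conj_class.abs_eq_iff)
  then show ?thesis using lookup_central_conj[OF assms] by (auto simp: conjugate_def)
qed

text \<open>
  Central elements of a group algebra are class functions, hence combinations of class sums.
\<close>

lemma central_eq_sum_class_sums:
  fixes z :: "'g::{group_add, finite} \<Rightarrow>\<^sub>0 'a::comm_ring_1"
  assumes "\<forall>w. z * w = w * z"
  shows "z = (\<Sum>c\<in>UNIV. Poly_Mapping.single 0 (Poly_Mapping.lookup z (rep_conj_class c)) * class_sum c)"
proof (rule poly_mapping_eqI)
  fix k
  have "Poly_Mapping.lookup (\<Sum>c\<in>UNIV. Poly_Mapping.single 0 (Poly_Mapping.lookup z (rep_conj_class c)) * class_sum c) k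
      = (\<Sum>c\<in>UNIV. if abs_conj_class k = c then Poly_Mapping.lookup z (rep_conj_class c) else 0)"
    unfolding lookup_sum lookup_single_zero_mult lookup_class_sum by (rule sum.cong) auto
  then show "Poly_Mapping.lookup z k = Poly_Mapping.lookup (\<Sum>c\<in>UNIV.
      Poly_Mapping.single 0 (Poly_Mapping.lookup z (rep_conj_class c)) * class_sum c) k"
    by (simp add: sum.delta lookup_central_rep[OF assms])
qed

lemma class_sum_mult:
  "class_sum c * class_sum d
     = (\<Sum>e\<in>UNIV. of_nat (class_mult c d e) * (class_sum e :: 'g::{group_add, finite} \<Rightarrow>\<^sub>0 'a::comm_ring_1))"
proof -
  let ?z = "class_sum c * class_sum d :: 'g \<Rightarrow>\<^sub>0 'a"
  have "\<forall>w. ?z * w = w * ?z" by (metis class_sum_central mult.assoc)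
  note central_eq_sum_class_sums[OF this]
  moreover have "Poly_Mapping.lookup ?z (rep_conj_class e) = of_nat (class_mult c d e)" for e
  proof -
    have "Poly_Mapping.lookup ?z (rep_conj_class e)
        = (\<Sum>(g, h)\<in>{g. abs_conj_class g = c} \<times> {h. abs_conj_class h = d}.
             if g + h = rep_conj_class e then 1 else 0)"
      unfolding class_sum_def sum_product sum.cartesian_product lookup_sum
      by (rule sum.cong) (auto simp: mult_single lookup_single when_def)
    also have "\<dots> = of_nat (card {(g, h). abs_conj_class g = c \<and> abs_conj_class h = d \<and> g + h = rep_conj_class e})"
      unfolding sum.If_cases[OF finite] split_def
      by (simp add: sum.If_cases) (rule arg_cong[where f = "\<lambda>A. of_nat (card A)"], auto)
    finally show ?thesis by (simp add: class_mult_def)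
  qed
  ultimately show ?thesis by simp
qed

lemma class_elem_mult:
  "class_elem c * class_elem d
     = (\<Sum>e\<in>UNIV. of_nat (class_mult c d e) * (class_elem e :: 'g::{group_add, finite} rat_centre))"
proof -
  have 1: "centre_elem (sum h S) = (\<Sum>i\<in>S. centre_elem (h i :: 'g rat_centre))" for h :: "'g conj_class \<Rightarrow> _" and S
    by (induction S rule: infinite_finite_induct) (auto simp: zero_rat_centre.rep_eq plus_rat_centre.rep_eq)
  have 2: "centre_elem (of_nat n :: 'g rat_centre) = of_nat n" for n
    by (induction n) (auto simp: zero_rat_centre.rep_eq one_rat_centre.rep_eq plus_rat_centre.rep_eq)
  show ?thesis
    by (rule centre_elem_inject[THEN iffD1])
       (simp add: 1 2 times_rat_centre.rep_eq class_elem.rep_eq class_sum_mult)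
qed

text \<open>
  The group law on the units \<open>1 + \<Sum>c. c s\<^sub>c\<close> of the class algebra, written in the coordinates \<open>s\<^sub>c\<close>:
  \<open>(1 + \<Sum>c. c s\<^sub>c) (1 + \<Sum>c. c s'\<^sub>c) = 1 + \<Sum>c. c (star s s')\<^sub>c\<close>. It is a formal group law over the integers.
\<close>

definition star :: "('g::{group_add, finite} conj_class \<Rightarrow> 'r::comm_ring_1) \<Rightarrow> ('g conj_class \<Rightarrow> 'r) \<Rightarrow> 'g conj_class \<Rightarrow> 'r" where
  "star s s' e = s e + s' e + (\<Sum>c\<in>UNIV. \<Sum>d\<in>UNIV. of_nat (class_mult c d e) * s c * s' d)"

text \<open>
  Only the multiplication table of the class sums enters, so \<open>K\<close> may be the family of class sums in any
  coefficient ring, and also the family of values of a central character.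
\<close>

lemma star_prod:
  fixes K :: "'g::{group_add, finite} conj_class \<Rightarrow> 'r::comm_ring_1"
  assumes "\<And>c d. K c * K d = (\<Sum>e\<in>UNIV. of_nat (class_mult c d e) * K e)"
  shows "(\<Sum>c\<in>UNIV. K c * s c) + (\<Sum>c\<in>UNIV. K c * s' c) + (\<Sum>c\<in>UNIV. K c * s c) * (\<Sum>c\<in>UNIV. K c * s' c)
       = (\<Sum>c\<in>UNIV. K c * star s s' c)"
proof -
  have "(\<Sum>c\<in>UNIV. K c * s c) * (\<Sum>c\<in>UNIV. K c * s' c)
      = (\<Sum>c\<in>UNIV. \<Sum>d\<in>UNIV. (K c * K d) * (s c * s' d))"
    by (simp add: sum_product ac_simps)
  also have "\<dots> = (\<Sum>c\<in>UNIV. \<Sum>d\<in>UNIV. \<Sum>e\<in>UNIV. K e * (of_nat (class_mult c d e) * s c * s' d))"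
    unfolding assms sum_distrib_right by (simp add: ac_simps)
  also have "\<dots> = (\<Sum>c\<in>UNIV. \<Sum>e\<in>UNIV. \<Sum>d\<in>UNIV. K e * (of_nat (class_mult c d e) * s c * s' d))"
    by (rule sum.cong[OF refl], rule sum.swap)
  also have "\<dots> = (\<Sum>e\<in>UNIV. \<Sum>c\<in>UNIV. \<Sum>d\<in>UNIV. K e * (of_nat (class_mult c d e) * s c * s' d))"
    by (rule sum.swap)
  finally show ?thesis
    by (simp add: star_def distrib_left sum.distrib sum_distrib_left)
qed


section \<open>Multiplicative series\<close>

text \<open>
  The characters of this formal group: \<open>b(x) b(y) = b(star x y)\<close>. The two independent sets of variables
  \<open>x\<close> and \<open>y\<close> are the two summands of a sum type.
\<close>

definition multiplicative :: "('g::{group_add, finite} conj_class, 'a::comm_ring_1) mps \<Rightarrow> bool" where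
  "multiplicative b \<longleftrightarrow>
     mps_comp b (\<lambda>c. mps_var (Inl c)) * mps_comp b (\<lambda>c. mps_var (Inr c))
   = mps_comp b (star (\<lambda>c. mps_var (Inl c)) (\<lambda>c. mps_var (Inr c) :: ('g conj_class + 'g conj_class, 'a) mps))"

lemma mps_nth_of_nat_empty [simp]: "mps_nth (of_nat n) {#} = (of_nat n :: 'a::comm_ring_1)"
  by (induction n) auto

lemma star_empty:
  assumes "\<And>c. mps_nth (s c) {#} = (0 :: 'a::comm_ring_1)" "\<And>c. mps_nth (s' c) {#} = 0"
  shows "mps_nth (star s s' c) {#} = 0"
  by (simp add: star_def assms mps_nth_sum)

lemma star_hom:
  assumes add: "\<And>x y. h (x + y) = h x + h y" and mult: "\<And>x y. h (x * y) = h x * h y" and one: "h 1 = 1"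
  shows "h (star s s' c) = star (\<lambda>c. h (s c)) (\<lambda>c. h (s' c)) c"
proof -
  have 0: "h 0 = 0" using add[of 0 0] by simp
  have sum: "h (sum u S) = (\<Sum>i\<in>S. h (u i))" for u :: "'d \<Rightarrow> 'a" and S
    by (induction S rule: infinite_finite_induct) (auto simp: 0 add)
  have nat: "h (of_nat n) = of_nat n" for n
    by (induction n) (auto simp: 0 add one)
  show ?thesis by (simp add: star_def add sum mult nat)
qed

lemma mps_comp_star:
  assumes "\<And>v. mps_nth (z v) {#} = 0"
  shows "mps_comp (star s s' c) z = star (\<lambda>c. mps_comp (s c) z) (\<lambda>c. mps_comp (s' c) z) c"
  by (rule star_hom) (simp_all add: mps_comp_add mps_comp_mult[OF assms])

text \<open>
  The identity for independent variables specializes to all arguments, by substitution.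
\<close>

lemma multiplicative_comp:
  assumes b: "multiplicative b"
    and s: "\<And>c. mps_nth (s c) {#} = 0" and s': "\<And>c. mps_nth (s' c) {#} = 0"
  shows "mps_comp b s * mps_comp b s' = mps_comp b (star s s')"
proof -
  have z: "mps_nth (case_sum s s' v) {#} = 0" for v by (cases v) (auto simp: s s')
  note comp = mps_comp_comp[OF z] mps_comp_mult[OF z] mps_comp_var[OF z]
  have "mps_comp (mps_comp b (\<lambda>c. mps_var (Inl c)) * mps_comp b (\<lambda>c. mps_var (Inr c))) (case_sum s s')
      = mps_comp (mps_comp b (star (\<lambda>c. mps_var (Inl c)) (\<lambda>c. mps_var (Inr c)))) (case_sum s s')"
    using b unfolding multiplicative_def by simp
  then show ?thesis
    by (simp add: comp mps_comp_star[OF z] star_empty)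
qed

text \<open>
  The coefficient of \<open>x\<^sup>M y\<^sup>N\<close> in the monomial \<open>K\<close> in the variables \<open>star x y\<close>. In terms of these integers
  multiplicativity is a system of equations between the coefficients of \<open>b\<close>, in which the
  coefficient ring no longer matters.
\<close>

definition star_coeff :: "'g::{group_add, finite} conj_class multiset \<Rightarrow> 'g conj_class multiset \<Rightarrow> 'g conj_class multiset \<Rightarrow> int" where
  "star_coeff M N K = mps_nth (mps_monom (star (\<lambda>c. mps_var (Inl c)) (\<lambda>c. mps_var (Inr c))) K)
     (image_mset Inl M + image_mset Inr N)"

lemma mps_map_of_int_var: "mps_map of_int (mps_var v) = (mps_var v :: ('v, 'a::comm_ring_1) mps)"
  by (rule mps_eqI) simp

lemma mps_map_of_int_star:
  "mps_map of_int (star s s' c) = star (\<lambda>c. mps_map of_int (s c)) (\<lambda>c. mps_map of_int (s' c) :: ('v, 'a::comm_ring_1) mps) c"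
  by (rule star_hom) (auto simp: mps_map_of_int_mult intro!: mps_eqI)

lemma mps_comp_inj_var:
  assumes "inj h"
  shows "mps_nth (mps_comp b (\<lambda>c. mps_var (h c))) K
       = (if set_mset K \<subseteq> range h then mps_nth b (image_mset (inv h) K) else 0)"
proof -
  have mon: "mps_monom (\<lambda>c. mps_var (h c)) M = mps_monom mps_var (image_mset h M)" for M
    by (simp add: mps_monom_def image_mset.compositionality o_def)
  have "mps_nth (mps_comp b (\<lambda>c. mps_var (h c))) K
      = (\<Sum>M | size M \<le> size K. if K = image_mset h M then mps_nth b M else 0)"
    unfolding mps_comp_def mps_nth_Abs mon mps_monom_var by (rule sum.cong) auto
  also have "\<dots> = (\<Sum>M | size M \<le> size K. if image_mset (inv h) K = M then (if set_mset K \<subseteq> range h then mps_nth b M else 0) else 0)"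
  proof (rule sum.cong[OF refl])
    fix M
    have "K = image_mset h M \<longleftrightarrow> image_mset (inv h) K = M \<and> set_mset K \<subseteq> range h"
    proof
      assume "K = image_mset h M"
      then show "image_mset (inv h) K = M \<and> set_mset K \<subseteq> range h"
        using assms by (auto simp: image_mset.compositionality o_def)
    next
      assume *: "image_mset (inv h) K = M \<and> set_mset K \<subseteq> range h"
      have "image_mset (\<lambda>x. h (inv h x)) K = image_mset (\<lambda>x. x) K"
        using * by (intro image_mset_cong) (auto simp: f_inv_into_f)
      with * show "K = image_mset h M" by (auto simp: image_mset.compositionality o_def)
    qed
    then show "(if K = image_mset h M then mps_nth b M else 0)
        = (if image_mset (inv h) K = M then (if set_mset K \<subseteq> range h then mps_nth b M else 0) else 0)"
      by auto
  qed
  also have "\<dots> = (if set_mset K \<subseteq> range h then mps_nth b (image_mset (inv h) K) else 0)"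
    by (subst sum.delta') (auto simp: finite_multisets_size_le)
  finally show ?thesis .
qed

lemma mps_nth_comp_Inl_times_Inr:
  "mps_nth (mps_comp b (\<lambda>c. mps_var (Inl c)) * mps_comp b' (\<lambda>c. mps_var (Inr c)))
     (image_mset Inl M + image_mset Inr N) = mps_nth b M * mps_nth b' N"
proof -
  let ?K = "image_mset Inl M + image_mset Inr N"
  let ?f = "mps_comp b (\<lambda>c. mps_var (Inl c))" and ?g = "mps_comp b' (\<lambda>c. mps_var (Inr c))"
  have "mps_nth ?f A * mps_nth ?g (?K - A) = 0" if A: "A \<subseteq># ?K" "A \<noteq> image_mset Inl M" for A
  proof (rule ccontr)
    assume "mps_nth ?f A * mps_nth ?g (?K - A) \<noteq> 0"
    then have *: "set_mset A \<subseteq> range Inl" "set_mset (?K - A) \<subseteq> range Inr"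
      by (auto simp: mps_comp_inj_var split: if_splits)
    have "count A x = count (image_mset Inl M) x" for x
    proof (cases x)
      case (Inl c)
      then have "x \<notin># ?K - A" using *(2) by auto
      then have "count (?K - A) x = 0" by (rule not_in_iff[THEN iffD1])
      moreover have "count (image_mset Inr N) x = 0" using Inl by (auto simp: count_eq_zero_iff)
      ultimately show ?thesis using mset_subset_eq_count[OF A(1), of x] by simp
    next
      case (Inr c)
      then have "count A x = 0" "count (image_mset Inl M) x = 0" using *(1) by (auto simp: count_eq_zero_iff)
      then show ?thesis by simp
    qed
    then show False using A(2) by (auto intro: multiset_eqI)
  qed
  then have "mps_nth (?f * ?g) ?K = (\<Sum>A\<in>{image_mset Inl M}. mps_nth ?f A * mps_nth ?g (?K - A))"
    unfolding mps_nth_mult by (intro sum.mono_neutral_right) (auto simp: finite_submultisets)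
  also have "\<dots> = mps_nth b M * mps_nth b' N"
    by (simp add: mps_comp_inj_var image_mset.compositionality o_def) auto
  finally show ?thesis .
qed

lemma mset_sum_split:
  obtains M N where "K = image_mset Inl M + image_mset Inr N"
proof -
  have "\<exists>M N. K = image_mset Inl M + image_mset Inr N"
  proof (induction K)
    case (add x K)
    then obtain M N where "K = image_mset Inl M + image_mset Inr N" by blast
    then have "add_mset (Inl c) K = image_mset Inl (add_mset c M) + image_mset Inr N"
        "add_mset (Inr d) K = image_mset Inl M + image_mset Inr (add_mset d N)" for c d
      by auto
    then show ?case by (cases x) blast+
  qed auto
  with that show thesis by blast
qed

lemma multiplicative_iff_coeffs:
  "multiplicative b \<longleftrightarrow> (\<forall>M N. mps_nth b M * mps_nth b N
     = (\<Sum>K | size K \<le> size M + size N. mps_nth b K * of_int (star_coeff M N K)))"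
proof -
  let ?x = "\<lambda>c. mps_var (Inl c)" and ?y = "\<lambda>c. mps_var (Inr c)"
  have var: "mps_nth (star ?x ?y c) {#} = (0 :: 'c::comm_ring_1)" for c :: "'a conj_class"
    by (intro star_empty) auto
  have star_eq: "star ?x ?y = (\<lambda>c. mps_map of_int (star ?x ?y c) :: ('a conj_class + 'a conj_class, 'b) mps)"
    by (simp add: mps_map_of_int_star mps_map_of_int_var fun_eq_iff)
  have comp: "mps_nth (mps_comp b (star ?x ?y)) (image_mset Inl M + image_mset Inr N)
      = (\<Sum>K | size K \<le> size M + size N. mps_nth b K * of_int (star_coeff M N K))" for M N
    by (subst star_eq) (simp add: star_coeff_def mps_nth_comp_of_int[OF var order_refl])
  show ?thesis
  proof
    assume "multiplicative b"
    then show "\<forall>M N. mps_nth b M * mps_nth b N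
        = (\<Sum>K | size K \<le> size M + size N. mps_nth b K * of_int (star_coeff M N K))"
      by (simp only: multiplicative_def flip: comp mps_nth_comp_Inl_times_Inr) simp
  next
    assume *: "\<forall>M N. mps_nth b M * mps_nth b N
        = (\<Sum>K | size K \<le> size M + size N. mps_nth b K * of_int (star_coeff M N K))"
    show "multiplicative b"
      unfolding multiplicative_def
    proof (rule mps_eqI)
      fix K :: "('a conj_class + 'a conj_class) multiset"
      obtain M N where K: "K = image_mset Inl M + image_mset Inr N" by (rule mset_sum_split)
      show "mps_nth (mps_comp b ?x * mps_comp b ?y) K = mps_nth (mps_comp b (star ?x ?y)) K"
        unfolding K mps_nth_comp_Inl_times_Inr comp using * by simp
    qed
  qed
qed

section \<open>Exponential and logarithm\<close>

text \<open>
  The Euler derivation, which multiplies a monomial by its degree. Over a rational algebra it kills only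
  the constants, so a single derivation suffices to characterize series in several variables by
  differential equations.
\<close>

definition mps_theta :: "('v, 'a::comm_ring_1) mps \<Rightarrow> ('v, 'a) mps" where
  "mps_theta f = Abs_mps (\<lambda>N. of_nat (size N) * mps_nth f N)"

lemma mps_nth_theta [simp]: "mps_nth (mps_theta f) N = of_nat (size N) * mps_nth f N"
  by (simp add: mps_theta_def)

lemma mps_theta_add: "mps_theta (f + g) = mps_theta f + mps_theta g"
  by (rule mps_eqI) (simp add: distrib_left)

lemma mps_theta_diff: "mps_theta (f - g) = mps_theta f - mps_theta g"
  by (rule mps_eqI) (simp add: right_diff_distrib)

lemma mps_theta_sum: "mps_theta (sum h S) = (\<Sum>i\<in>S. mps_theta (h i))"
  by (rule mps_eqI) (simp add: mps_nth_sum sum_distrib_left)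

lemma mps_theta_const [simp]: "mps_theta (mps_const a) = 0"
  by (rule mps_eqI) simp

lemma mps_theta_one [simp]: "mps_theta 1 = 0"
  by (rule mps_eqI) simp

lemma mps_theta_mult:
  fixes f g :: "('v, 'b::comm_ring_1) mps"
  shows "mps_theta (f * g) = mps_theta f * g + f * mps_theta g"
proof (rule mps_eqI)
  fix N :: "'v multiset"
  have "of_nat (size N) = (of_nat (size A) + of_nat (size (N - A)) :: 'b)" if "A \<subseteq># N" for A
    using size_mset_mono[OF that] by (simp add: size_Diff_submset[OF that] flip: of_nat_add)
  then have "of_nat (size N) * (mps_nth f A * mps_nth g (N - A))
      = of_nat (size A) * mps_nth f A * mps_nth g (N - A)
      + mps_nth f A * (of_nat (size (N - A)) * mps_nth g (N - A))" if "A \<subseteq># N" for A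
    using that by (simp add: algebra_simps)
  then show "mps_nth (mps_theta (f * g)) N = mps_nth (mps_theta f * g + f * mps_theta g) N"
    by (simp add: mps_nth_mult sum_distrib_left flip: sum.distrib)
qed

lemma mps_theta_power: "mps_theta (f ^ Suc r) = of_nat (Suc r) * f ^ r * mps_theta f"
  by (induction r) (simp_all add: mps_theta_mult algebra_simps)

lemma mps_agree_theta: "mps_agree n f g \<Longrightarrow> mps_agree n (mps_theta f) (mps_theta g)"
  by (simp add: mps_agree_def)

lemma mps_agree_subst_le:
  assumes "mps_nth f {#} = 0" "n \<le> m"
  shows "mps_agree n (mps_subst a f) (\<Sum>r\<le>m. mps_const (a r) * f ^ r)"
  using mps_agree_subst[OF assms(1), of m a] assms(2) by (simp add: mps_agree_def)

lemma mps_const_of_nat: "mps_const (of_nat n :: 'a::comm_ring_1) = of_nat n"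
  by (induction n) (simp_all add: mps_const_simps)

lemma mps_theta_subst:
  assumes f: "mps_nth f {#} = 0"
  shows "mps_theta (mps_subst a f) = mps_subst (\<lambda>r. of_nat (Suc r) * a (Suc r)) f * mps_theta f"
proof (rule mps_agree_all_imp_eq)
  fix n
  have "mps_agree n (mps_theta (mps_subst a f)) (mps_theta (\<Sum>r\<le>Suc n. mps_const (a r) * f ^ r))"
    by (intro mps_agree_theta mps_agree_subst_le f) simp
  also have "mps_theta (\<Sum>r\<le>Suc n. mps_const (a r) * f ^ r)
      = (\<Sum>r\<le>Suc n. mps_const (a r) * mps_theta (f ^ r))"
    by (simp only: mps_theta_sum mps_theta_mult mps_theta_const mult_zero_left add_0_left)
  also have "\<dots> = (\<Sum>r\<le>n. mps_const (a (Suc r)) * mps_theta (f ^ Suc r))"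
    by (subst sum.atMost_Suc_shift) simp
  also have "\<dots> = (\<Sum>r\<le>n. mps_const (of_nat (Suc r) * a (Suc r)) * f ^ r) * mps_theta f"
    unfolding mps_theta_power mps_const_simps mps_const_of_nat sum_distrib_right
    by (intro sum.cong refl) (simp only: ac_simps)
  also have "mps_agree n \<dots> (mps_subst (\<lambda>r. of_nat (Suc r) * a (Suc r)) f * mps_theta f)"
    by (intro mps_agree_mult mps_agree_refl mps_agree_sym[OF mps_agree_subst] f)
  finally show "mps_agree n (mps_theta (mps_subst a f))
      (mps_subst (\<lambda>r. of_nat (Suc r) * a (Suc r)) f * mps_theta f)" .
qed

lemma scaleQ_zero_left [simp]: "0 *\<^sub>Q x = (0 :: 'a::rat_vector)"
  using scaleQ_add_left[of 0 0 x] by simp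

lemma scaleQ_of_nat: "of_nat n *\<^sub>Q x = of_nat n * (x :: 'a::rat_algebra)"
  by (induction n) (simp_all add: scaleQ_add_left scaleQ_one distrib_right)

lemma scaleQ_of_nat_mult: "of_nat n * (q *\<^sub>Q 1) = (of_nat n * q) *\<^sub>Q (1 :: 'a::rat_algebra)"
  by (simp add: scaleQ_scaleQ flip: scaleQ_of_nat)

lemma rat_algebra_torsion_free:
  assumes "of_nat n * (x :: 'a::rat_algebra) = 0" "n > 0"
  shows "x = 0"
proof -
  have "x = (1 / of_nat n) *\<^sub>Q (of_nat n *\<^sub>Q x)"
    using assms(2) by (simp add: scaleQ_scaleQ scaleQ_one)
  also have "\<dots> = 0"
    using assms(1) scaleQ_add_right[of "1 / of_nat n" 0 "0 :: 'a"] by (simp add: scaleQ_of_nat)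
  finally show ?thesis .
qed

text \<open>
  In degree \<open>n > 0\<close> the equation \<open>\<theta> f = h f\<close> expresses \<open>n f\<^sub>n\<close> by coefficients of lower degree, because \<open>h\<close>
  has no constant term.
\<close>

lemma mps_theta_unique:
  fixes f g h :: "('v, 'a::rat_algebra) mps"
  assumes "mps_theta f = h * f" "mps_theta g = h * g" "mps_nth h {#} = 0" "mps_nth f {#} = mps_nth g {#}"
  shows "f = g"
proof -
  let ?d = "f - g"
  have d: "mps_theta ?d = h * ?d" "mps_nth ?d {#} = 0"
    using assms by (simp_all add: mps_theta_diff right_diff_distrib)
  have "mps_nth ?d N = 0" for N
  proof (induction "size N" arbitrary: N rule: less_induct)
    case less
    show ?case
    proof (cases "N = {#}")
      case False
      have "mps_nth h A * mps_nth ?d (N - A) = 0" if "A \<subseteq># N" for A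
      proof (cases "A = {#}")
        case False
        then have "size (N - A) < size N"
          using that \<open>N \<noteq> {#}\<close> by (simp add: size_Diff_submset diff_less nonempty_has_size)
        then show ?thesis using less by (simp del: mps_nth_simps)
      qed (use assms in simp)
      then have "mps_nth (mps_theta ?d) N = 0"
        unfolding d(1) mps_nth_mult by (intro sum.neutral) blast
      then have "of_nat (size N) * mps_nth ?d N = 0" by (simp only: mps_nth_theta)
      then show ?thesis by (rule rat_algebra_torsion_free) (use False in \<open>simp add: nonempty_has_size\<close>)
    qed (use d in simp)
  qed
  then have "?d = 0" by (intro mps_eqI) (simp only: mps_nth_simps)
  then show ?thesis by simp
qed

lemma mps_theta_exp:
  fixes f :: "('v, 'b::rat_algebra) mps"
  assumes "mps_nth f {#} = 0"
  shows "mps_theta (mps_exp f) = mps_theta f * mps_exp f"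
proof -
  have "of_nat (Suc r) * ((1 / fact (Suc r)) *\<^sub>Q 1) = (1 / fact r) *\<^sub>Q (1 :: 'b)" for r
    unfolding scaleQ_of_nat_mult by (simp add: divide_simps)
  then show ?thesis
    using assms by (simp add: mps_exp_def mps_theta_subst mult.commute)
qed

lemma mps_nth_exp_empty [simp]: "mps_nth (mps_exp f) {#} = 1"
  by (simp add: mps_exp_def scaleQ_one)

lemma mps_nth_ln1p_empty [simp]: "mps_nth (mps_ln1p f) {#} = 0"
  by (simp add: mps_ln1p_def)

text \<open>
  Both sides solve the equation \<open>\<theta> u = (\<theta> f + \<theta> g) u\<close>.
\<close>

lemma mps_exp_add:
  assumes "mps_nth f {#} = 0" "mps_nth g {#} = 0"
  shows "mps_exp (f + g) = mps_exp f * mps_exp g"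
  by (rule mps_theta_unique[where h = "mps_theta f + mps_theta g"])
     (use assms in \<open>simp_all add: mps_theta_exp mps_theta_mult mps_theta_add algebra_simps\<close>)

lemma mps_geometric:
  fixes f :: "('v, 'a::comm_ring_1) mps"
  assumes "mps_nth f {#} = 0"
  shows "(1 + f) * mps_subst (\<lambda>r. (-1) ^ r) f = 1"
proof (rule mps_agree_all_imp_eq)
  fix n
  have "mps_agree n ((1 + f) * mps_subst (\<lambda>r. (-1) ^ r) f) ((1 + f) * (\<Sum>r\<le>n. mps_const ((-1) ^ r) * f ^ r))"
    by (intro mps_agree_mult mps_agree_refl mps_agree_subst assms)
  also have "(\<Sum>r\<le>n. mps_const ((-1) ^ r) * f ^ r) = (\<Sum>r<Suc n. (- f) ^ r)"
  proof (rule sum.cong)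
    have "mps_const (-1 :: 'a) * f = - f" by (rule mps_eqI) simp
    then show "mps_const ((-1) ^ r) * f ^ r = (- f) ^ r" for r
      by (simp only: mps_const_simps flip: power_mult_distrib)
  qed auto
  also have "(1 + f) * \<dots> = 1 - (- f) ^ Suc n"
    using one_diff_power_eq[of "- f" "Suc n"] by simp
  also have "mps_agree n \<dots> 1"
    using mps_nth_power_eq_0[of "- f" _ "Suc n"] assms unfolding mps_agree_def by (simp del: power_Suc)
  finally show "mps_agree n ((1 + f) * mps_subst (\<lambda>r. (-1) ^ r) f) 1" .
qed

lemma mps_theta_ln1p:
  fixes f :: "('v, 'b::rat_algebra) mps"
  assumes "mps_nth f {#} = 0"
  shows "(1 + f) * mps_theta (mps_ln1p f) = mps_theta f"
proof -
  have minus: "(-1) ^ r = ((-1) ^ r) *\<^sub>Q (1 :: 'b)" for r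
  proof -
    have "((-1) *\<^sub>Q 1 :: 'b) + 1 = 0"
      using scaleQ_add_left[of "-1" 1 "1 :: 'b"] by (simp add: scaleQ_one)
    then have "(-1) *\<^sub>Q 1 = (- 1 :: 'b)" by (simp add: eq_neg_iff_add_eq_0)
    then show ?thesis by (cases "even r") (simp_all add: scaleQ_one)
  qed
  have "of_nat (Suc r) * (((-1) ^ (Suc r + 1) / of_nat (Suc r)) *\<^sub>Q 1) = (-1 :: 'b) ^ r" for r
    unfolding scaleQ_of_nat_mult minus by (simp del: of_nat_Suc)
  then have "mps_theta (mps_ln1p f) = mps_subst (\<lambda>r. (-1) ^ r) f * mps_theta f"
    using assms by (simp add: mps_ln1p_def mps_theta_subst del: of_nat_Suc)
  then show ?thesis
    by (simp add: mps_geometric[OF assms] flip: mult.assoc)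
qed

text \<open>
  The functional equation of the logarithm: both sides have the same logarithmic derivative.
\<close>

lemma mps_ln1p_star:
  fixes f g :: "('v, 'a::rat_algebra) mps"
  assumes f: "mps_nth f {#} = 0" and g: "mps_nth g {#} = 0"
  shows "mps_ln1p (f + g + f * g) = mps_ln1p f + mps_ln1p g"
proof -
  let ?h = "f + g + f * g" and ?d = "mps_ln1p (f + g + f * g) - (mps_ln1p f + mps_ln1p g)"
  let ?i = "mps_subst (\<lambda>r. (-1) ^ r) ?h"
  have h: "mps_nth ?h {#} = 0" by (simp add: f g)
  have "(1 + ?h) * mps_theta ?d = (1 + ?h) * mps_theta (mps_ln1p ?h)
      - (1 + g) * ((1 + f) * mps_theta (mps_ln1p f)) - (1 + f) * ((1 + g) * mps_theta (mps_ln1p g))"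
    unfolding mps_theta_diff mps_theta_add by (simp add: algebra_simps)
  also have "\<dots> = 0"
    unfolding mps_theta_ln1p[OF f] mps_theta_ln1p[OF g] mps_theta_ln1p[OF h]
    by (simp add: mps_theta_add mps_theta_mult algebra_simps)
  finally have "?i * ((1 + ?h) * mps_theta ?d) = 0" by simp
  then have "mps_theta ?d = 0"
    using mps_geometric[OF h] by (simp add: mult.assoc[symmetric] mult.commute)
  moreover have "mps_theta 0 = (0 :: ('v, 'a) mps)" by (rule mps_eqI) simp
  moreover have "mps_nth ?d {#} = 0" by simp
  ultimately have "?d = 0"
    by (intro mps_theta_unique[of ?d 0 0]) (simp_all only: mult_zero_left mps_nth_simps)
  then show ?thesis by simp
qed


section \<open>The coefficients B form a multiplicative series\<close>

definition exp_gen_ln :: "('v, 'g::group_add rat_centre) mps \<Rightarrow> ('v, 'g rat_centre uea) mps" where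
  "exp_gen_ln f = mps_exp (mps_map uea_gen (mps_ln1p f))"

definition B_series :: "('g::{group_add, finite} conj_class, 'g rat_centre uea) mps" where
  "B_series = exp_gen_ln (\<Sum>c\<in>UNIV. mps_const (class_elem c) * mps_var c)"

lemma mps_nth_B_series [simp]: "mps_nth B_series = B_coeff"
  by (simp add: B_series_def exp_gen_ln_def B_coeff_def)

lemma uea_gen_add: "uea_gen (x + y) = uea_gen x + uea_gen y"
  by (simp add: uea_gen_def plus_uea.abs_eq uea.abs_eq_iff uea_eq_def uea_ideal.gen_add)

lemma uea_gen_zero [simp]: "uea_gen 0 = 0"
  using uea_gen_add[of 0 0] by simp

text \<open>
  The logarithm turns the product of \<open>1 + f\<close> and \<open>1 + g\<close> into a sum, which the linear map \<open>uea_gen\<close>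
  respects and the exponential turns into a product.
\<close>

lemma exp_gen_ln_star:
  fixes f g :: "('v, 'b::group_add rat_centre) mps"
  assumes "mps_nth f {#} = 0" "mps_nth g {#} = 0"
  shows "exp_gen_ln (f + g + f * g) = exp_gen_ln f * exp_gen_ln g"
proof -
  have "mps_map uea_gen (x + y) = mps_map uea_gen x + mps_map uea_gen y" for x y :: "('v, 'b rat_centre) mps"
    by (rule mps_eqI) (simp add: uea_gen_add)
  then show ?thesis
    using assms by (simp add: exp_gen_ln_def mps_ln1p_star mps_exp_add)
qed

lemma comp_exp_gen_ln:
  assumes s: "\<And>v. mps_nth (s v) {#} = 0" and f: "mps_nth f {#} = 0"
  shows "mps_comp (exp_gen_ln f) (\<lambda>v. mps_map of_int (s v))
       = exp_gen_ln (mps_comp f (\<lambda>v. mps_map of_int (s v)))"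
proof -
  have "mps_comp (exp_gen_ln f) (\<lambda>v. mps_map of_int (s v))
      = mps_exp (mps_comp (mps_map uea_gen (mps_ln1p f)) (\<lambda>v. mps_map of_int (s v)))"
    unfolding exp_gen_ln_def mps_exp_def by (rule mps_comp_subst) (simp_all add: s)
  also have "mps_comp (mps_map uea_gen (mps_ln1p f)) (\<lambda>v. mps_map of_int (s v))
      = mps_map uea_gen (mps_comp (mps_ln1p f) (\<lambda>v. mps_map of_int (s v)))"
    by (rule mps_map_comp_of_int[symmetric]) (simp_all add: s uea_gen_add)
  also have "mps_comp (mps_ln1p f) (\<lambda>v. mps_map of_int (s v))
      = mps_ln1p (mps_comp f (\<lambda>v. mps_map of_int (s v)))"
    unfolding mps_ln1p_def by (rule mps_comp_subst) (simp_all add: s f)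
  finally show ?thesis by (simp only: exp_gen_ln_def)
qed

text \<open>
  Substituting integral series \<open>s\<close> into \<open>B_series\<close> amounts to replacing \<open>x\<^sub>c\<close> by \<open>s\<^sub>c\<close> inside the logarithm;
  both coordinates and their \<open>star\<close> product are integral.
\<close>

lemma multiplicative_B_series: "multiplicative (B_series :: ('g::{group_add, finite} conj_class, _) mps)"
proof -
  let ?K = "\<lambda>c. mps_const (class_elem c) :: ('g conj_class + 'g conj_class, 'g rat_centre) mps"
  have comp: "mps_comp B_series (\<lambda>c. mps_map of_int (s c)) = exp_gen_ln (\<Sum>c\<in>UNIV. ?K c * mps_map of_int (s c))"
    if "\<And>c. mps_nth (s c) {#} = 0" for s
    unfolding B_series_def
    by (subst comp_exp_gen_ln) (simp_all add: that mps_nth_sum mps_comp_sum mps_comp_mult mps_comp_var)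
  have K: "?K c * ?K d = (\<Sum>e\<in>UNIV. of_nat (class_mult c d e) * ?K e)" for c d
    unfolding mps_const_simps(4)[symmetric] class_elem_mult
    by (simp add: mps_const_simps mps_const_of_nat)
  let ?x = "\<lambda>c. mps_var (Inl c)" and ?y = "\<lambda>c. mps_var (Inr c)"
  show ?thesis
    using comp[of ?x] comp[of ?y] comp[of "star ?x ?y"]
      exp_gen_ln_star[of "\<Sum>c\<in>UNIV. ?K c * ?x c" "\<Sum>c\<in>UNIV. ?K c * ?y c"]
    by (simp add: multiplicative_def star_empty mps_map_of_int_var mps_map_of_int_star mps_nth_sum star_prod[OF K])
qed

section \<open>Additive maps on finitely supported functions\<close>

definition pm_eval :: "('c::comm_monoid_add \<Rightarrow> 'r::comm_ring_1) \<Rightarrow> ('m \<Rightarrow> 'r) \<Rightarrow> ('m \<Rightarrow>\<^sub>0 'c) \<Rightarrow> 'r" where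
  "pm_eval \<kappa> e P = (\<Sum>w\<in>Poly_Mapping.keys P. \<kappa> (Poly_Mapping.lookup P w) * e w)"

lemma pm_eval_superset:
  assumes "\<kappa> 0 = 0" "finite S" "Poly_Mapping.keys P \<subseteq> S"
  shows "pm_eval \<kappa> e P = (\<Sum>w\<in>S. \<kappa> (Poly_Mapping.lookup P w) * e w)"
  unfolding pm_eval_def
  by (rule sum.mono_neutral_left) (use assms in \<open>auto simp: in_keys_iff\<close>)

lemma pm_eval_add:
  assumes "\<kappa> 0 = 0" "\<And>a b. \<kappa> (a + b) = \<kappa> a + \<kappa> b"
  shows "pm_eval \<kappa> e (P + Q) = pm_eval \<kappa> e P + pm_eval \<kappa> e Q"
proof -
  let ?S = "Poly_Mapping.keys P \<union> Poly_Mapping.keys Q"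
  have "pm_eval \<kappa> e R = (\<Sum>w\<in>?S. \<kappa> (Poly_Mapping.lookup R w) * e w)" if "R \<in> {P, Q, P + Q}" for R
    using that keys_add[of P Q] by (intro pm_eval_superset assms) auto
  then show ?thesis
    by (simp add: lookup_add assms distrib_right sum.distrib)
qed

lemma pm_eval_single:
  assumes "\<kappa> 0 = 0"
  shows "pm_eval \<kappa> e (Poly_Mapping.single w a) = \<kappa> a * e w"
  by (subst pm_eval_superset[of _ "{w}"]) (use assms in \<open>auto simp: lookup_single\<close>)

lemma pm_eval_zero [simp]: "pm_eval \<kappa> e 0 = 0"
  by (simp add: pm_eval_def)

section \<open>Algebra homomorphisms out of the enveloping algebra\<close>

definition free_eval :: "(rat \<Rightarrow> 'r::comm_ring_1) \<Rightarrow> ('a \<Rightarrow> 'r) \<Rightarrow> 'a free_rat_algebra \<Rightarrow> 'r" where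
  "free_eval \<kappa> l = pm_eval \<kappa> (\<lambda>w. prod_list (map l (letters w)))"


text \<open>
  The universal property: a linear map \<open>l\<close> to a commutative ring, with rational scalars acting through
  \<open>\<kappa>\<close>, extends to an algebra homomorphism. It is constructed on the free algebra, where it kills the
  relations.
\<close>

locale uea_evaluation =
  fixes \<kappa> :: "rat \<Rightarrow> 'r::comm_ring_1" and l :: "'a::rat_vector \<Rightarrow> 'r"
  assumes \<kappa>_add: "\<kappa> (a + b) = \<kappa> a + \<kappa> b" and \<kappa>_mult: "\<kappa> (a * b) = \<kappa> a * \<kappa> b" and \<kappa>_one: "\<kappa> 1 = 1"
    and l_add: "l (x + y) = l x + l y" and l_scale: "l (q *\<^sub>Q x) = \<kappa> q * l x"
begin

lemma \<kappa>_zero: "\<kappa> 0 = 0"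
  using \<kappa>_add[of 0 0] by simp

lemma free_eval_add: "free_eval \<kappa> l (P + Q) = free_eval \<kappa> l P + free_eval \<kappa> l Q"
  unfolding free_eval_def by (rule pm_eval_add) (auto simp: \<kappa>_zero \<kappa>_add)

lemma free_eval_single: "free_eval \<kappa> l (Poly_Mapping.single w a) = \<kappa> a * prod_list (map l (letters w))"
  unfolding free_eval_def by (rule pm_eval_single) (rule \<kappa>_zero)

lemma free_eval_diff: "free_eval \<kappa> l (P - Q) = free_eval \<kappa> l P - free_eval \<kappa> l Q"
  using free_eval_add[of "P - Q" Q] by simp

lemma free_eval_mult: "free_eval \<kappa> l (P * Q) = free_eval \<kappa> l P * free_eval \<kappa> l Q"
proof (induction P rule: poly_mapping_add_induct)
  case zero
  show ?case by (simp add: free_eval_def)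
next
  case (single v a)
  show ?case
  proof (induction Q rule: poly_mapping_add_induct)
    case zero
    show ?case by (simp add: free_eval_def)
  next
    case (single w b)
    show ?case by (simp add: mult_single free_eval_single \<kappa>_mult plus_free_word_def)
  qed (simp add: distrib_left free_eval_add)
qed (simp add: distrib_right free_eval_add)

lemma free_eval_ideal: "P \<in> uea_ideal \<Longrightarrow> free_eval \<kappa> l P = 0"
  by (induction rule: uea_ideal.induct)
     (simp_all add: free_gen_def free_eval_single free_eval_add free_eval_diff free_eval_mult
       l_add l_scale \<kappa>_one zero_free_word_def)

definition ev :: "'a uea \<Rightarrow> 'r" where
  "ev x = free_eval \<kappa> l (rep_uea x)"

lemma ev_abs: "ev (abs_uea P) = free_eval \<kappa> l P"
proof -
  have "uea_eq (rep_uea (abs_uea P)) P"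
    by (meson Quotient_rel_abs Quotient_uea Quotient_rep_abs Quotient_abs_rep uea.abs_eq_iff)
  then show ?thesis
    using free_eval_ideal free_eval_diff unfolding uea_eq_def ev_def by fastforce
qed

lemma ev_add: "ev (x + y) = ev x + ev y"
  by (induction x rule: uea.abs_induct, induction y rule: uea.abs_induct)
     (simp add: plus_uea.abs_eq ev_abs free_eval_add)

lemma ev_zero [simp]: "ev 0 = 0"
  using ev_add[of 0 0] by simp

lemma ev_mult: "ev (x * y) = ev x * ev y"
  by (induction x rule: uea.abs_induct, induction y rule: uea.abs_induct)
     (simp add: times_uea.abs_eq ev_abs free_eval_mult)

lemma ev_gen: "ev (uea_gen x) = l x"
  by (simp add: uea_gen_def ev_abs free_gen_def free_eval_single \<kappa>_one)

lemma ev_scale: "ev (q *\<^sub>Q x) = \<kappa> q * ev x"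
  by (simp add: scaleQ_uea_def ev_mult ev_abs free_eval_single zero_free_word_def)

lemma ev_one: "ev 1 = 1"
  by (simp add: one_uea.abs_eq ev_abs \<kappa>_one free_eval_single zero_free_word_def flip: single_one)

lemma ev_sum: "ev (sum h S) = (\<Sum>i\<in>S. ev (h i))"
proof -
  have "ev 0 = 0" using ev_add[of 0 0] by simp
  then show ?thesis by (induction S rule: infinite_finite_induct) (auto simp: ev_add)
qed

lemma ev_of_int: "ev (of_int n) = of_int n"
proof -
  have nat: "ev (of_nat n) = of_nat n" for n
    using ev_sum[of "\<lambda>_. 1" "{}"] by (induction n) (auto simp: ev_add ev_one)
  have "ev (- x) = - ev x" for x
    using ev_add[of x "- x"] nat[of 0] by (simp add: eq_neg_iff_add_eq_0 add.commute)
  then show ?thesis by (cases n rule: int_cases2) (simp_all add: nat)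
qed

lemma mps_map_ev_mult: "mps_map ev (f * g) = mps_map ev f * mps_map ev g"
  by (rule mps_map_mult) (auto simp: ev_add ev_mult)

lemma mps_map_ev_power: "mps_map ev (f ^ n) = mps_map ev f ^ n"
proof (induction n)
  case 0
  have "ev 0 = 0" using ev_add[of 0 0] by simp
  then show ?case by (auto intro!: mps_eqI simp: ev_one)
qed (simp add: mps_map_ev_mult)

lemma ev_exp: "ev (mps_nth (mps_exp f) N) = (\<Sum>r\<le>size N. \<kappa> (1 / fact r) * mps_nth (mps_map ev f ^ r) N)"
  by (simp add: mps_exp_def mps_subst_def ev_sum mult_scaleQ_left ev_scale flip: mps_map_ev_power)

end


section \<open>Linear independence of the coefficients B\<close>

definition class_coord :: "'g::{group_add, finite} conj_class \<Rightarrow> 'g rat_centre \<Rightarrow> rat" where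
  "class_coord c z = Poly_Mapping.lookup (centre_elem z) (rep_conj_class c)"

lemma class_coord_add: "class_coord c (x + y) = class_coord c x + class_coord c y"
  by (simp add: class_coord_def plus_rat_centre.rep_eq lookup_add)

lemma class_coord_scale: "class_coord c (q *\<^sub>Q x) = q * class_coord c x"
  by (simp add: class_coord_def scaleQ_rat_centre.rep_eq lookup_single_zero_mult)

lemma class_coord_class_elem: "class_coord c (class_elem d) = (if c = d then 1 else 0)"
  by (simp add: class_coord_def class_elem.rep_eq lookup_class_sum)

text \<open>
  The linear functional with indeterminate values \<open>y\<^sub>c\<close> on the class sums. The homomorphism that it
  induces sends \<open>\<Sum>N. B_coeff N x\<^sup>N\<close> to \<open>exp (\<Sum>c. y\<^sub>c L\<^sub>c(x))\<close>, where \<open>L\<^sub>c\<close> is the coordinate at \<open>c\<close> of the logarithm.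
\<close>

definition generic_functional :: "'g::{group_add, finite} rat_centre \<Rightarrow> ('g conj_class, rat) mps" where
  "generic_functional z = (\<Sum>c\<in>UNIV. mps_const (class_coord c z) * mps_var c)"

interpretation generic: uea_evaluation mps_const "generic_functional :: 'g::{group_add, finite} rat_centre \<Rightarrow> _"
  by standard
     (simp_all add: generic_functional_def mps_const_simps class_coord_add class_coord_scale
        distrib_right sum.distrib sum_distrib_left mult.assoc)

lemma mps_nth_generic_functional:
  "mps_nth (generic_functional z) M = (if size M = 1 then class_coord (THE c. M = {#c#}) z else 0)"
proof -
  have "mps_nth (generic_functional z) M = (\<Sum>c\<in>UNIV. if M = {#c#} then class_coord c z else 0)"
    unfolding generic_functional_def mps_nth_sum mps_nth_const_mult by (rule sum.cong) auto
  also have "\<dots> = (if size M = 1 then class_coord (THE c. M = {#c#}) z else 0)"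
  proof (cases "size M = 1")
    case True
    then obtain c where "M = {#c#}" using size_1_singleton_mset by blast
    then show ?thesis by simp
  qed (auto intro!: sum.neutral)
  finally show ?thesis .
qed

definition generic_log :: "('g::{group_add, finite} conj_class, ('g conj_class, rat) mps) mps" where
  "generic_log = mps_map generic_functional (mps_ln1p (\<Sum>c\<in>UNIV. mps_const (class_elem c) * mps_var c))"

lemma generic_log_degree: "size M \<noteq> 1 \<Longrightarrow> mps_nth (mps_nth generic_log N) M = 0"
  by (simp add: generic_log_def mps_nth_generic_functional)

lemma generic_log_empty: "mps_nth generic_log {#} = 0"
  by (simp add: generic_log_def generic_functional_def class_coord_def zero_rat_centre.rep_eq mps_const_simps)

lemma generic_log_linear: "mps_nth generic_log {#c#} = mps_var c"
proof -
  have "mps_nth (mps_ln1p (\<Sum>c\<in>UNIV. mps_const (class_elem c) * mps_var c)) {#c#} = class_elem c"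
    by (simp add: mps_ln1p_def mps_subst_def mps_nth_sum scaleQ_one if_distrib[of "(*) _"] sum.delta cong: if_cong)
  then have "mps_nth generic_log {#c#} = generic_functional (class_elem c)"
    by (simp add: generic_log_def)
  also have "\<dots> = (\<Sum>d\<in>UNIV. if d = c then mps_var d else 0)"
    unfolding generic_functional_def class_coord_class_elem
    by (rule sum.cong) (auto simp: mps_const_simps)
  finally show ?thesis by simp
qed

lemma generic_log_power_degree: "size M \<noteq> r \<Longrightarrow> mps_nth (mps_nth (generic_log ^ r) N) M = 0"
proof (induction r arbitrary: M N)
  case (Suc r)
  have zero: "mps_nth (mps_nth generic_log A) B * mps_nth (mps_nth (generic_log ^ r) (N - A)) (M - B) = 0"
    if "B \<subseteq># M" for A B
  proof (cases "size B = 1")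
    case True
    then have "size (M - B) \<noteq> r" using Suc.prems size_mset_mono[OF that] by (simp add: size_Diff_submset[OF that])
    then show ?thesis using Suc.IH by simp
  qed (simp add: generic_log_degree)
  show ?case
    unfolding power_Suc mps_nth_mult[of _ _ N] mps_nth_sum mps_nth_mult[of _ _ M]
    by (intro sum.neutral ballI zero) simp
qed simp

text \<open>
  The \<open>r\<close>-th power of \<open>\<Sum>c. y\<^sub>c L\<^sub>c(x)\<close> is homogeneous of degree \<open>r\<close> in \<open>y\<close>, and its part of degree \<open>r\<close> in \<open>x\<close>
  comes from the linear part of the logarithm: it is \<open>(\<Sum>c. y\<^sub>c x\<^sub>c)\<^sup>r\<close>. Its coefficient at \<open>y\<^sup>M x\<^sup>N\<close> is a multinomial
  coefficient for \<open>M = N\<close>, of which the induction keeps that it is positive.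
\<close>

lemma generic_log_power_lowest:
  assumes "size N = r" "size M = r"
  shows "(M \<noteq> N \<longrightarrow> mps_nth (mps_nth (generic_log ^ r) N) M = 0) \<and>
         (M = N \<longrightarrow> mps_nth (mps_nth (generic_log ^ r) N) M > 0)"
  using assms
proof (induction r arbitrary: M N)
  case (Suc r)
  let ?v = "\<lambda>N M. mps_nth (mps_nth (generic_log ^ r) N) M"
  have "mps_nth (generic_log ^ Suc r) N = (\<Sum>A | A \<subseteq># N. mps_nth generic_log A * mps_nth (generic_log ^ r) (N - A))"
    by (simp add: mps_nth_mult)
  also have "\<dots> = (\<Sum>A\<in>(\<lambda>c. {#c#}) ` set_mset N. mps_nth generic_log A * mps_nth (generic_log ^ r) (N - A))"
  proof (rule sum.mono_neutral_right)
    show "\<forall>A\<in>{A. A \<subseteq># N} - (\<lambda>c. {#c#}) ` set_mset N. mps_nth generic_log A * mps_nth (generic_log ^ r) (N - A) = 0"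
    proof
      fix A assume "A \<in> {A. A \<subseteq># N} - (\<lambda>c. {#c#}) ` set_mset N"
      then have A: "A \<subseteq># N" "\<And>c. A \<noteq> {#c#}" by (auto simp: insert_subset_eq_iff)
      show "mps_nth generic_log A * mps_nth (generic_log ^ r) (N - A) = 0"
      proof (cases "A = {#}")
        case False
        with A have "size A \<noteq> 0" "size A \<noteq> 1" using size_1_singleton_mset by auto
        then have "size A \<ge> 2" by linarith
        then have "size (N - A) < r"
          using size_mset_mono[OF A(1)] Suc.prems by (simp add: size_Diff_submset[OF A(1)])
        then show ?thesis by (simp add: mps_nth_power_eq_0[OF generic_log_empty])
      qed (simp add: generic_log_empty)
    qed
  qed (auto simp: finite_submultisets)
  also have "\<dots> = (\<Sum>c\<in>set_mset N. mps_var c * mps_nth (generic_log ^ r) (N - {#c#}))"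
    by (subst sum.reindex) (auto simp: inj_on_def generic_log_linear)
  finally have eq1: "mps_nth (generic_log ^ Suc r) N
      = (\<Sum>c\<in>set_mset N. mps_var c * mps_nth (generic_log ^ r) (N - {#c#}))" .
  have eq: "mps_nth (mps_nth (generic_log ^ Suc r) N) M
      = (\<Sum>c\<in>set_mset N. if c \<in># M then ?v (N - {#c#}) (M - {#c#}) else 0)"
  proof -
    have "mps_nth (mps_var c * f) M = (if c \<in># M then mps_nth f (M - {#c#}) else 0)" for c and f :: "('a conj_class, rat) mps"
    proof -
      have "mps_nth (mps_var c * f) M = (\<Sum>A | A \<subseteq># M. if A = {#c#} then mps_nth f (M - A) else 0)"
        unfolding mps_nth_mult by (rule sum.cong) auto
      then show ?thesis by (simp add: sum.delta finite_submultisets)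
    qed
    then show ?thesis
      by (simp only: eq1 mps_nth_sum)
  qed
  have size: "size (K - {#c#}) = r" if "c \<in># K" "size K = Suc r" for c and K :: "'a conj_class multiset"
    using that by (simp add: size_Diff_singleton)
  show ?case
  proof (intro conjI impI)
    assume "M \<noteq> N"
    then have "N - {#c#} \<noteq> M - {#c#}" if "c \<in># N" "c \<in># M" for c
      using that by (metis insert_DiffM)
    then show "mps_nth (mps_nth (generic_log ^ Suc r) N) M = 0"
      unfolding eq using Suc size by (intro sum.neutral) (metis (full_types))
  next
    assume "M = N"
    moreover have "set_mset N \<noteq> {}" using Suc.prems by auto
    ultimately show "mps_nth (mps_nth (generic_log ^ Suc r) N) M > 0"
      unfolding eq using Suc size by (intro sum_pos) auto
  qed
qed auto

lemma generic_ev_B: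
  "mps_nth (generic.ev (B_coeff N)) M = (\<Sum>r\<le>size N. (1 / fact r) * mps_nth (mps_nth (generic_log ^ r) N) M)"
proof -
  have 1: "mps_map generic.ev (mps_map uea_gen f) = mps_map generic_functional f" for f :: "('b, 'a rat_centre) mps"
    by (rule mps_eqI) (simp add: generic.ev_gen)
  show ?thesis
    by (simp add: 1 B_coeff_def generic.ev_exp mps_nth_sum generic_log_def)
qed

lemma generic_ev_B_top:
  assumes "size N \<le> size M"
  shows "M \<noteq> N \<Longrightarrow> mps_nth (generic.ev (B_coeff N)) M = 0"
    and "M = N \<Longrightarrow> mps_nth (generic.ev (B_coeff N)) M > 0"
proof -
  have "mps_nth (generic.ev (B_coeff N)) M = (\<Sum>r\<in>{size N}. (1 / fact r) * mps_nth (mps_nth (generic_log ^ r) N) M)"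
    unfolding generic_ev_B
    by (rule sum.mono_neutral_right) (use assms in \<open>auto simp: generic_log_power_degree\<close>)
  then have *: "mps_nth (generic.ev (B_coeff N)) M = (1 / fact (size N)) * mps_nth (mps_nth (generic_log ^ size N) N) M"
    by simp
  show "mps_nth (generic.ev (B_coeff N)) M = 0" if "M \<noteq> N"
    using generic_log_power_lowest[of N "size N" M] generic_log_power_degree[of M "size N" N] that
    unfolding * by (cases "size M = size N") auto
  show "mps_nth (generic.ev (B_coeff N)) M > 0" if "M = N"
    using generic_log_power_lowest[of N "size N" M] that unfolding * by simp
qed

definition B_comb :: "('g::{group_add, finite} conj_class multiset \<Rightarrow> 'r::comm_ring_1) \<Rightarrow> ('g conj_class multiset \<Rightarrow>\<^sub>0 int) \<Rightarrow> 'r" where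
  "B_comb = pm_eval of_int"

lemma B_comb_add: "B_comb e (P + Q) = B_comb e P + B_comb e Q"
  unfolding B_comb_def by (rule pm_eval_add) auto

lemma B_comb_single: "B_comb e (Poly_Mapping.single N a) = of_int a * e N"
  unfolding B_comb_def by (rule pm_eval_single) auto

lemma B_comb_diff: "B_comb e (P - Q) = B_comb e P - B_comb e Q"
  using B_comb_add[of e "P - Q" Q] by simp

lemma B_comb_zero: "B_comb e 0 = 0"
  by (simp add: B_comb_def)

text \<open>
  In a linear relation, the coefficient at \<open>y\<^sup>M\<close> for a monomial \<open>M\<close> of maximal degree only involves
  \<open>B_coeff M\<close>.
\<close>

lemma B_linear_independent:
  assumes "B_comb B_coeff P = 0"
  shows "P = 0"
proof (rule ccontr)
  assume "P \<noteq> 0"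
  then have ne: "size ` Poly_Mapping.keys P \<noteq> {}" by simp
  obtain M where M: "M \<in> Poly_Mapping.keys P" "\<And>N. N \<in> Poly_Mapping.keys P \<Longrightarrow> size N \<le> size M"
    using Max_in[OF _ ne] Max_ge[of "size ` Poly_Mapping.keys P"] by (smt (verit) finite_imageI finite_keys imageE imageI)
  have of_int: "of_int n = (mps_const (of_int n) :: ('a conj_class, rat) mps)" for n
    by (cases n rule: int_cases2) (simp_all add: mps_const_of_nat[symmetric], rule mps_eqI, simp)
  have "0 = mps_nth (generic.ev (B_comb B_coeff P)) M"
    by (simp add: assms)
  also have "\<dots> = (\<Sum>N\<in>Poly_Mapping.keys P. of_int (Poly_Mapping.lookup P N) * mps_nth (generic.ev (B_coeff N)) M)"
    by (simp add: B_comb_def pm_eval_def generic.ev_sum generic.ev_mult generic.ev_of_int mps_nth_sum of_int)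
  also have "\<dots> = (\<Sum>N\<in>{M}. of_int (Poly_Mapping.lookup P N) * mps_nth (generic.ev (B_coeff N)) M)"
    by (rule sum.mono_neutral_right) (use M in \<open>auto simp: generic_ev_B_top\<close>)
  finally show False
    using M(1) generic_ev_B_top(2)[of M M] by (simp add: in_keys_iff)
qed

lemma R_Gamma_eq: "(R_Gamma :: 'g::{group_add, finite} rat_centre uea set) = range (B_comb B_coeff)"
proof (intro equalityI subsetI)
  fix x :: "'g rat_centre uea" assume "x \<in> R_Gamma"
  then obtain S a where S: "finite S" "x = (\<Sum>N\<in>S. of_int (a N) * B_coeff N)" by (auto simp: R_Gamma_def)
  from S(1) have "(\<Sum>N\<in>S. of_int (a N) * B_coeff N) = B_comb B_coeff (\<Sum>N\<in>S. Poly_Mapping.single N (a N))"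
    by (induction S rule: finite_induct) (auto simp: B_comb_zero B_comb_add B_comb_single)
  with S show "x \<in> range (B_comb B_coeff)" by simp
next
  fix x :: "'g rat_centre uea" assume "x \<in> range (B_comb B_coeff)"
  then show "x \<in> R_Gamma"
    unfolding R_Gamma_def B_comb_def pm_eval_def using finite_keys by blast
qed

lemma B_in_R_Gamma: "B_coeff N \<in> R_Gamma"
proof -
  have "B_coeff N = B_comb B_coeff (Poly_Mapping.single N 1)" by (simp add: B_comb_single)
  then show ?thesis by (simp add: R_Gamma_eq)
qed

lemma R_Gamma_add: "x \<in> R_Gamma \<Longrightarrow> y \<in> R_Gamma \<Longrightarrow> x + y \<in> R_Gamma"
  by (auto simp: R_Gamma_eq simp flip: B_comb_add)

lemma R_Gamma_zero: "0 \<in> R_Gamma"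
  unfolding R_Gamma_eq by (metis B_comb_zero rangeI)

lemma additive_on_zero: "additive_on R_Gamma \<phi> \<Longrightarrow> \<phi> 0 = 0"
  using R_Gamma_zero unfolding additive_on_def by (metis add.right_neutral add_cancel_left_right)

lemma additive_on_B_comb:
  fixes \<phi> :: "'g::{group_add, finite} rat_centre uea \<Rightarrow> 'r::comm_ring_1"
  assumes "additive_on R_Gamma \<phi>"
  shows "\<phi> (B_comb B_coeff P) = B_comb (\<lambda>N. \<phi> (B_coeff N)) P"
proof (induction P rule: poly_mapping_add_induct)
  case zero
  show ?case using additive_on_zero[OF assms] by (simp add: B_comb_zero)
next
  case (single N a)
  have R: "of_int k * B_coeff N \<in> R_Gamma" for k
    by (metis B_comb_single R_Gamma_eq rangeI)
  have nat: "\<phi> (of_nat k * B_coeff N) = of_nat k * \<phi> (B_coeff N)" for k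
  proof (induction k)
    case (Suc k)
    have "\<phi> (of_nat k * B_coeff N + B_coeff N) = \<phi> (of_nat k * B_coeff N) + \<phi> (B_coeff N)"
      using assms R[of "int k"] B_in_R_Gamma[of N] unfolding additive_on_def by simp
    with Suc show ?case by (simp add: distrib_right add.commute)
  qed (simp add: additive_on_zero[OF assms])
  have "\<phi> (of_int (- int k) * B_coeff N) = - (of_nat k * \<phi> (B_coeff N))" for k
  proof -
    have "\<phi> (of_int (- int k) * B_coeff N + of_int (int k) * B_coeff N)
        = \<phi> (of_int (- int k) * B_coeff N) + \<phi> (of_int (int k) * B_coeff N)"
      using assms R[of "int k"] R[of "- int k"] unfolding additive_on_def by blast
    then show ?thesis using nat[of k] additive_on_zero[OF assms] by (simp add: eq_neg_iff_add_eq_0)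
  qed
  with nat show ?case
    by (cases a rule: int_cases2) (simp_all add: B_comb_single)
next
  case (add f g)
  have "\<phi> (B_comb B_coeff f + B_comb B_coeff g) = \<phi> (B_comb B_coeff f) + \<phi> (B_comb B_coeff g)"
    using assms unfolding additive_on_def R_Gamma_eq by blast
  with add show ?case by (simp add: B_comb_add)
qed

lemma additive_on_R_Gamma_exists:
  "\<exists>\<phi> :: 'g::{group_add, finite} rat_centre uea \<Rightarrow> 'r::comm_ring_1. additive_on R_Gamma \<phi> \<and> (\<forall>N. \<phi> (B_coeff N) = e N)"
proof -
  let ?B = "B_comb B_coeff :: _ \<Rightarrow> 'g rat_centre uea"
  have inj: "inj ?B"
  proof (rule injI)
    fix P Q assume "?B P = ?B Q"
    then have "?B (P - Q) = 0" by (simp add: B_comb_diff)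
    then show "P = Q" using B_linear_independent by fastforce
  qed
  define \<phi> where "\<phi> = B_comb e \<circ> inv ?B"
  have \<phi>: "\<phi> (?B P) = B_comb e P" for P
    by (simp add: \<phi>_def inj)
  have "additive_on R_Gamma \<phi>"
    unfolding additive_on_def R_Gamma_eq by (auto simp: \<phi> simp flip: B_comb_add)
  moreover have "\<phi> (B_coeff N) = e N" for N
    using \<phi>[of "Poly_Mapping.single N 1"] by (simp add: B_comb_single)
  ultimately show ?thesis by blast
qed

lemma B_coeff_mult:
  "B_coeff M * B_coeff N = (\<Sum>K | size K \<le> size M + size N. B_coeff K * of_int (star_coeff M N K))"
  by (rule multiplicative_B_series[unfolded multiplicative_iff_coeffs mps_nth_B_series, rule_format])

lemma B_coeff_empty: "B_coeff {#} = 1"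
  by (simp add: B_coeff_def)

text \<open>
  The integers \<open>star_coeff\<close> that expand the products \<open>B_coeff M * B_coeff N\<close> also express multiplicativity of
  a series over any ring. So ring homomorphisms correspond to characters of the formal group.
\<close>

lemma ring_hom_on_iff_multiplicative:
  fixes \<phi> :: "'g::{group_add, finite} rat_centre uea \<Rightarrow> 'r::comm_ring_1"
  assumes \<phi>: "additive_on R_Gamma \<phi>"
  shows "ring_hom_on R_Gamma \<phi> \<longleftrightarrow> multiplicative (Abs_mps (\<lambda>N. \<phi> (B_coeff N))) \<and> \<phi> (B_coeff {#}) = 1"
proof -
  let ?B = "B_comb B_coeff :: _ \<Rightarrow> 'g rat_centre uea" and ?single = "\<lambda>N a. Poly_Mapping.single N a :: _ \<Rightarrow>\<^sub>0 int"
  have sum: "B_comb e (sum h S) = (\<Sum>i\<in>S. B_comb e (h i))"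
    for e :: "'g conj_class multiset \<Rightarrow> 's::comm_ring_1" and h :: "'g conj_class multiset \<Rightarrow> _" and S
    by (induction S rule: infinite_finite_induct) (auto simp: B_comb_zero B_comb_add)
  define P where "P a b M N = (\<Sum>K | size K \<le> size M + size N. ?single K (a * b * star_coeff M N K))"
    for a b and M N :: "'g conj_class multiset"
  have prod: "?B (?single M a) * ?B (?single N b) = ?B (P a b M N)" for a b M N
  proof -
    have "?B (?single M a) * ?B (?single N b) = of_int a * of_int b * (B_coeff M * B_coeff N)"
      by (simp only: B_comb_single ac_simps)
    also have "\<dots> = ?B (P a b M N)"
      unfolding P_def sum B_comb_single B_coeff_mult sum_distrib_left
      by (intro sum.cong refl) (simp only: of_int_mult ac_simps)
    finally show ?thesis .
  qed
  have \<phi>_P: "\<phi> (?B (P a b M N)) = of_int a * of_int b *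
      (\<Sum>K | size K \<le> size M + size N. \<phi> (B_coeff K) * of_int (star_coeff M N K))" for a b M N
    unfolding additive_on_B_comb[OF \<phi>] unfolding P_def sum B_comb_single sum_distrib_left
    by (intro sum.cong refl) (simp only: of_int_mult ac_simps)
  have \<phi>_prod: "\<phi> (B_coeff M * B_coeff N)
      = (\<Sum>K | size K \<le> size M + size N. \<phi> (B_coeff K) * of_int (star_coeff M N K))" for M N
    using prod[of M 1 N 1] \<phi>_P[of 1 1 M N] by (simp add: B_comb_single)
  have R: "?B P \<in> R_Gamma" for P by (simp add: R_Gamma_eq)
  have \<phi>_add: "\<phi> (x + y) = \<phi> x + \<phi> y" if "x \<in> R_Gamma" "y \<in> R_Gamma" for x y
    using \<phi> that by (simp add: additive_on_def)
  have B_comb_mult: "\<phi> (?B P * ?B Q) = \<phi> (?B P) * \<phi> (?B Q) \<and> ?B P * ?B Q \<in> R_Gamma"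
    if mult: "\<And>M N. \<phi> (B_coeff M * B_coeff N) = \<phi> (B_coeff M) * \<phi> (B_coeff N)" for P Q
  proof (induction P rule: poly_mapping_add_induct)
    case zero
    show ?case by (simp add: B_comb_zero additive_on_zero[OF \<phi>] R_Gamma_zero)
  next
    case (single M a)
    show ?case
    proof (induction Q rule: poly_mapping_add_induct)
      case zero
      show ?case by (simp add: B_comb_zero additive_on_zero[OF \<phi>] R_Gamma_zero)
    next
      case (single N b)
      show ?case
        unfolding prod
        unfolding \<phi>_P \<phi>_prod[symmetric] mult
        unfolding additive_on_B_comb[OF \<phi>] by (simp add: R B_comb_single)
    qed (simp add: B_comb_add distrib_left R_Gamma_add \<phi>_add R)
  qed (simp add: B_comb_add distrib_right R_Gamma_add \<phi>_add R)
  have "(\<forall>x\<in>R_Gamma. \<forall>y\<in>R_Gamma. \<phi> (x * y) = \<phi> x * \<phi> y)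
      \<longleftrightarrow> (\<forall>M N. \<phi> (B_coeff M * B_coeff N) = \<phi> (B_coeff M) * \<phi> (B_coeff N))" (is "?l \<longleftrightarrow> ?r")
  proof
    assume ?l
    then show ?r using B_in_R_Gamma by blast
  next
    assume ?r
    then show ?l unfolding R_Gamma_eq using B_comb_mult by blast
  qed
  then show ?thesis
    using \<phi> by (auto simp: ring_hom_on_def multiplicative_iff_coeffs \<phi>_prod B_coeff_empty)
qed

section \<open>The centre of a group algebra\<close>

text \<open>
  As a type of its own, the centre is a commutative ring, over which power series can be formed.
\<close>

typedef (overloaded) ('g, 'a) group_centre = "{z :: 'g::group_add \<Rightarrow>\<^sub>0 'a::comm_ring_1. \<forall>w. z * w = w * z}"
  morphisms centre_val Abs_group_centre
  by (rule exI[of _ 0]) simp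

setup_lifting type_definition_group_centre

instantiation group_centre :: (group_add, comm_ring_1) comm_ring_1
begin

lift_definition zero_group_centre :: "('a, 'b) group_centre" is 0 by simp
lift_definition one_group_centre :: "('a, 'b) group_centre" is 1 by simp
lift_definition plus_group_centre :: "('a, 'b) group_centre \<Rightarrow> ('a, 'b) group_centre \<Rightarrow> ('a, 'b) group_centre" is "(+)"
  by (simp only: mem_Collect_eq distrib_left distrib_right)
lift_definition uminus_group_centre :: "('a, 'b) group_centre \<Rightarrow> ('a, 'b) group_centre" is uminus
  by (simp only: mem_Collect_eq mult_minus_left mult_minus_right)
lift_definition minus_group_centre :: "('a, 'b) group_centre \<Rightarrow> ('a, 'b) group_centre \<Rightarrow> ('a, 'b) group_centre" is "(-)"
  by (simp only: mem_Collect_eq left_diff_distrib right_diff_distrib)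
lift_definition times_group_centre :: "('a, 'b) group_centre \<Rightarrow> ('a, 'b) group_centre \<Rightarrow> ('a, 'b) group_centre" is "(*)"
  by (metis mult.assoc)

instance
proof
  fix x y z :: "('a, 'b) group_centre"
  show "x + y + z = x + (y + z)" by transfer (rule add.assoc)
  show "x + y = y + x" by transfer (rule add.commute)
  show "0 + x = x" by transfer (rule add_0_left)
  show "- x + x = 0" by transfer (rule left_minus)
  show "x - y = x + - y" by transfer (rule diff_conv_add_uminus)
  show "x * y * z = x * (y * z)" by transfer (rule mult.assoc)
  show "x * y = y * x" by transfer blast
  show "1 * x = x" by transfer (rule mult_1_left)
  show "(x + y) * z = x * z + y * z" by transfer (rule distrib_right)
  show "(0 :: ('a, 'b) group_centre) \<noteq> 1" by transfer simp
qed

end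

lemmas centre_val_simps =
  zero_group_centre.rep_eq one_group_centre.rep_eq plus_group_centre.rep_eq uminus_group_centre.rep_eq
  minus_group_centre.rep_eq times_group_centre.rep_eq

lemma centre_val_commute: "centre_val z * w = w * centre_val z"
  using centre_val[of z] by simp

lemma centre_val_sum: "centre_val (sum h S) = (\<Sum>i\<in>S. centre_val (h i))"
  by (induction S rule: infinite_finite_induct) (auto simp: centre_val_simps)

lemma centre_val_of_nat: "centre_val (of_nat n) = of_nat n"
  by (induction n) (auto simp: centre_val_simps)

lift_definition centre_scalar :: "'a::comm_ring_1 \<Rightarrow> ('g::group_add, 'a) group_centre" is "Poly_Mapping.single 0"
  by (simp add: single_zero_commute)

lemma centre_scalar_simps [simp]:
  "centre_scalar 0 = 0" "centre_scalar 1 = 1"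
  "centre_scalar (a + b) = centre_scalar a + centre_scalar b"
  "centre_scalar (a * b) = centre_scalar a * centre_scalar b"
  "centre_scalar (- a) = - centre_scalar a"
  "centre_scalar (a - b) = centre_scalar a - centre_scalar b"
  by (transfer; simp add: single_add mult_single single_uminus single_diff)+

lemma centre_scalar_power: "centre_scalar (a ^ n) = centre_scalar a ^ n"
  by (induction n) auto

lift_definition centre_class :: "'g::{group_add, finite} conj_class \<Rightarrow> ('g, 'a::comm_ring_1) group_centre" is class_sum
  by (simp add: class_sum_central)

definition centre_coord :: "'g::{group_add, finite} conj_class \<Rightarrow> ('g, 'a::comm_ring_1) group_centre \<Rightarrow> 'a" where
  "centre_coord c z = Poly_Mapping.lookup (centre_val z) (rep_conj_class c)"

lemma centre_eqI: "centre_val x = centre_val y \<Longrightarrow> x = y"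
  by (simp add: centre_val_inject)

lemma centre_expand: "z = (\<Sum>c\<in>UNIV. centre_scalar (centre_coord c z) * centre_class c)"
  by (rule centre_eqI)
     (simp add: centre_val_sum centre_val_simps centre_scalar.rep_eq centre_class.rep_eq centre_coord_def
       central_eq_sum_class_sums[symmetric] centre_val_commute)

lemma centre_class_mult:
  "centre_class c * centre_class d = (\<Sum>e\<in>UNIV. of_nat (class_mult c d e) * centre_class e)"
  by (rule centre_eqI)
     (simp add: centre_val_sum centre_val_simps centre_val_of_nat centre_class.rep_eq class_sum_mult)

lemma centre_coord_add: "centre_coord c (x + y) = centre_coord c x + centre_coord c y"
  by (simp add: centre_coord_def centre_val_simps lookup_add)

lemma centre_coord_scalar: "centre_coord c (centre_scalar a * x) = a * centre_coord c x"
  by (simp add: centre_coord_def centre_val_simps centre_scalar.rep_eq lookup_single_zero_mult)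

lemma centre_coord_class: "centre_coord c (centre_class d) = (if c = d then 1 else 0)"
  by (simp add: centre_coord_def centre_class.rep_eq lookup_class_sum)


section \<open>Finite dimensionality\<close>

abbreviation ga_scale :: "'a::field \<Rightarrow> ('g::group_add \<Rightarrow>\<^sub>0 'a) \<Rightarrow> ('g \<Rightarrow>\<^sub>0 'a)" where
  "ga_scale a x \<equiv> Poly_Mapping.single 0 a * x"

abbreviation ga_basis :: "('g::group_add \<Rightarrow>\<^sub>0 'a::field) set" where
  "ga_basis \<equiv> range (\<lambda>g. Poly_Mapping.single g 1)"

interpretation gav: vector_space "ga_scale :: 'a::field \<Rightarrow> ('g::group_add \<Rightarrow>\<^sub>0 'a) \<Rightarrow> _"
  by standard (simp_all add: distrib_left distrib_right single_add mult_single flip: mult.assoc)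

interpretation ga: finite_dimensional_vector_space
  "ga_scale :: 'a::field \<Rightarrow> ('g::{group_add, finite} \<Rightarrow>\<^sub>0 'a) \<Rightarrow> _" ga_basis
proof
  show "finite (ga_basis :: ('g \<Rightarrow>\<^sub>0 'a) set)" by simp
  show "gav.independent (ga_basis :: ('g \<Rightarrow>\<^sub>0 'a) set)"
  proof (rule gav.independent_if_scalars_zero)
    fix f :: "('g \<Rightarrow>\<^sub>0 'a) \<Rightarrow> 'a" and x :: "'g \<Rightarrow>\<^sub>0 'a"
    assume 0: "(\<Sum>x\<in>ga_basis. ga_scale (f x) x) = 0" and x: "x \<in> ga_basis"
    obtain g where g: "x = Poly_Mapping.single g 1" using x by blast
    have inj: "inj (\<lambda>g :: 'g. Poly_Mapping.single g (1 :: 'a))" 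
      by (rule injI) (metis keys_single singleton_inject zero_neq_one)
    have "0 = Poly_Mapping.lookup (\<Sum>x\<in>ga_basis. ga_scale (f x) x) g" using 0 by simp
    also have "\<dots> = (\<Sum>h\<in>UNIV. if h = g then f (Poly_Mapping.single h 1) else 0)"
      unfolding lookup_sum sum.reindex[OF inj] by (rule sum.cong) (auto simp: mult_single lookup_single when_def)
    finally show "f x = 0" by (simp add: g)
  qed simp
  show "gav.span (ga_basis :: ('g \<Rightarrow>\<^sub>0 'a) set) = UNIV"
  proof -
    have "P \<in> gav.span ga_basis" for P :: "'g \<Rightarrow>\<^sub>0 'a"
    proof (induction P rule: poly_mapping_add_induct)
      case (single g a)
      have "Poly_Mapping.single g a = ga_scale a (Poly_Mapping.single g 1)" by (simp add: mult_single)
      then show ?case by (simp only:) (intro gav.span_scale gav.span_base rangeI)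
    qed (auto intro: gav.span_zero gav.span_add)
    then show ?thesis by auto
  qed
qed

lemma ga_linear_dependence:
  fixes v :: "nat \<Rightarrow> ('g::{group_add, finite} \<Rightarrow>\<^sub>0 'a::field)"
  shows "\<exists>n c. (\<exists>i\<le>n. c i \<noteq> 0) \<and> (\<Sum>i\<le>n. ga_scale (c i) (v i)) = 0"
proof -
  define n where "n = card (ga_basis :: ('g \<Rightarrow>\<^sub>0 'a) set)"
  show ?thesis
  proof (cases "inj_on v {..n}")
    case True
    then have "card (v ` {..n}) = Suc n" by (simp add: card_image)
    moreover have "gav.dim (v ` {..n}) \<le> n" using ga.dim_subset_UNIV[of "v ` {..n}"] by (simp add: n_def ga.dimension_def)
    ultimately have "gav.dependent (v ` {..n})" by (intro ga.dependent_biggerset_general) simp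
    then obtain t u where t: "t \<subseteq> v ` {..n}" "(\<Sum>w\<in>t. ga_scale (u w) w) = 0" "\<exists>w\<in>t. u w \<noteq> 0"
      by (auto simp: gav.dependent_explicit)
    define c where "c i = (if v i \<in> t then u (v i) else 0)" for i
    have "(\<Sum>i\<le>n. ga_scale (c i) (v i)) = (\<Sum>w\<in>v ` {..n}. ga_scale (if w \<in> t then u w else 0) w)"
      by (subst sum.reindex[OF True]) (simp add: c_def)
    also have "\<dots> = (\<Sum>w\<in>t. ga_scale (if w \<in> t then u w else 0) w)"
      by (rule sum.mono_neutral_right) (use t(1) in auto)
    finally have "(\<Sum>i\<le>n. ga_scale (c i) (v i)) = 0" using t(2) by simp
    moreover have "\<exists>i\<le>n. c i \<noteq> 0" using t(1,3) by (auto simp: c_def)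
    ultimately show ?thesis by blast
  next
    case False
    then obtain i j where ij: "i \<le> n" "j \<le> n" "i \<noteq> j" "v i = v j" by (auto simp: inj_on_def)
    define c :: "nat \<Rightarrow> 'a" where "c k = (if k = i then 1 else 0) - (if k = j then 1 else 0)" for k
    have "ga_scale (c k) (v k) = (if k = i then v i else 0) - (if k = j then v j else 0)" for k
      using ij(4) by (auto simp: c_def single_diff left_diff_distrib)
    then have "(\<Sum>k\<le>n. ga_scale (c k) (v k)) = 0"
      using ij by (simp add: sum_subtractf)
    moreover have "c i \<noteq> 0" using ij by (simp add: c_def)
    ultimately show ?thesis using ij by blast
  qed
qed


section \<open>Polynomials in a central element\<close>

definition centre_poly :: "'a::comm_ring_1 poly \<Rightarrow> ('g::group_add, 'a) group_centre \<Rightarrow> ('g, 'a) group_centre" where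
  "centre_poly q z = poly (map_poly centre_scalar q) z"

lemma centre_poly_simps:
  fixes z :: "('b::group_add, 'a::comm_ring_1) group_centre"
  shows "centre_poly (p + q) z = centre_poly p z + centre_poly q z"
  "centre_poly (p - q) z = centre_poly p z - centre_poly q z"
  "centre_poly (smult a q) z = centre_scalar a * centre_poly q z"
  "centre_poly (pCons a q) z = centre_scalar a + z * centre_poly q z"
  "centre_poly 0 z = 0"
  "centre_poly (monom a n) z = centre_scalar a * z ^ n"
proof -
  have "map_poly centre_scalar (p + q) = map_poly centre_scalar p + (map_poly centre_scalar q :: ('b, 'a) group_centre poly)"
    "map_poly centre_scalar (p - q) = map_poly centre_scalar p - (map_poly centre_scalar q :: ('b, 'a) group_centre poly)"
    by (simp_all add: poly_eq_iff coeff_map_poly)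
  then show "centre_poly (p + q) z = centre_poly p z + centre_poly q z"
    "centre_poly (p - q) z = centre_poly p z - centre_poly q z"
    by (simp_all add: centre_poly_def)
qed (simp_all add: centre_poly_def map_poly_smult map_poly_pCons map_poly_monom poly_monom)

lemma centre_poly_sum: "centre_poly (sum h S) z = (\<Sum>i\<in>S. centre_poly (h i) z)"
  by (induction S rule: infinite_finite_induct) (auto simp: centre_poly_simps)

lemma centre_poly_linear_mult:
  "centre_poly ([:- l, 1:] * q) z = (z - centre_scalar l) * centre_poly q z"
  by (simp add: centre_poly_simps algebra_simps)

text \<open>
  Multiplication by \<open>z\<close> on the ideal of \<open>e\<close> has an eigenvector: take a polynomial \<open>q\<close> of least degree with
  \<open>q(z) e = 0\<close> and split off a root.
\<close>

lemma centre_eigenvalue: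
  fixes z e :: "('g::{group_add, finite}, 'a::alg_closed_field) group_centre"
  assumes "e \<noteq> 0" "e * e = e"
  shows "\<exists>l w. w \<noteq> 0 \<and> e * w = w \<and> (z - centre_scalar l) * w = 0"
proof -
  let ?Q = "\<lambda>q. q \<noteq> 0 \<and> centre_poly q z * e = 0"
  obtain n c where c: "\<exists>i\<le>n. c i \<noteq> 0" "(\<Sum>i\<le>n. ga_scale (c i) (centre_val (z ^ i * e))) = 0"
    using ga_linear_dependence[of "\<lambda>i. centre_val (z ^ i * e)"] by blast
  define q0 where "q0 = (\<Sum>i\<le>n. monom (c i) i)"
  have "coeff q0 i = c i" if "i \<le> n" for i
    using that by (simp add: q0_def coeff_sum)
  then have "q0 \<noteq> 0" using c(1) by force
  moreover have "centre_poly q0 z * e = 0"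
    by (rule centre_eqI)
       (use c(2) in \<open>simp add: q0_def centre_poly_sum centre_poly_simps sum_distrib_right centre_val_sum
         centre_val_simps centre_scalar.rep_eq mult.assoc\<close>)
  ultimately obtain q where q: "?Q q" "\<And>p. ?Q p \<Longrightarrow> degree q \<le> degree p"
    using ex_has_least_nat[of ?Q q0 degree] by blast
  have "degree q > 0"
  proof (rule ccontr)
    assume "\<not> degree q > 0"
    then obtain a where a: "q = [:a:]" by (metis degree_eq_zeroE not_gr_zero)
    with q(1) have "a \<noteq> 0" "centre_scalar a * e = 0" by (auto simp: centre_poly_simps)
    moreover have "e = centre_scalar (inverse a) * (centre_scalar a * e)"
      using \<open>a \<noteq> 0\<close> by (simp flip: mult.assoc centre_scalar_simps(4))
    ultimately show False using assms(1) by simp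
  qed
  then obtain l where "poly q l = 0" using alg_closed_imp_poly_has_root by blast
  then obtain r where r: "q = [:- l, 1:] * r" by (auto simp: poly_eq_0_iff_dvd)
  have "r \<noteq> 0" using q(1) r by auto
  then have "degree r < degree q" unfolding r by (subst degree_mult_eq) auto
  then have "centre_poly r z * e \<noteq> 0" using q(2)[of r] \<open>r \<noteq> 0\<close> by fastforce
  moreover have "e * (centre_poly r z * e) = centre_poly r z * e"
    by (subst mult.left_commute) (simp add: assms(2))
  moreover have "(z - centre_scalar l) * (centre_poly r z * e) = 0"
    using q(1) unfolding r centre_poly_linear_mult by (simp add: mult.assoc)
  ultimately show ?thesis by blast
qed

text \<open>
  Fitting's lemma: the ideals generated by the powers of \<open>a\<close> become stationary. The element \<open>a\<^sup>n s\<close> is then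
  idempotent; if it is \<open>0\<close>, then \<open>a\<close> is nilpotent, and if it is \<open>1\<close>, then \<open>a\<close> is invertible.
\<close>

lemma centre_fitting:
  fixes a :: "('g::{group_add, finite}, 'a::field) group_centre"
  shows "\<exists>n s. n > 0 \<and> a ^ n = a ^ n * a ^ n * s"
proof -
  define V where "V n = centre_val ` range (\<lambda>s. a ^ n * s)" for n
  have sub: "gav.subspace (V n)" for n
  proof (rule gav.subspaceI)
    show "0 \<in> V n" unfolding V_def
      by (metis (no_types, lifting) image_eqI mult_zero_right rangeI zero_group_centre.rep_eq)
    show "x + y \<in> V n" if xy: "x \<in> V n" "y \<in> V n" for x y
    proof -
      obtain s t where "x = centre_val (a ^ n * s)" "y = centre_val (a ^ n * t)" using xy by (auto simp: V_def)
      then have "x + y = centre_val (a ^ n * (s + t))" by (simp add: distrib_left plus_group_centre.rep_eq)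
      then show ?thesis by (auto simp: V_def)
    qed
    show "ga_scale c x \<in> V n" if x: "x \<in> V n" for c x
    proof -
      obtain s where "x = centre_val (a ^ n * s)" using x by (auto simp: V_def)
      then have "ga_scale c x = centre_val (a ^ n * (centre_scalar c * s))"
        by (simp only: mult.left_commute[of "a ^ n"]) (simp only: centre_val_simps centre_scalar.rep_eq)
      then show ?thesis by (auto simp: V_def)
    qed
  qed
  have dec: "V (Suc n) \<subseteq> V n" for n
  proof
    fix x assume "x \<in> V (Suc n)"
    then obtain s where "x = centre_val (a ^ n * (a * s))" by (auto simp: V_def ac_simps)
    then show "x \<in> V n" by (auto simp: V_def)
  qed
  obtain n where n: "n > 0" "gav.dim (V n) \<le> gav.dim (V (Suc n))"
  proof -
    have "\<exists>n. n > 0 \<and> (\<forall>m. m > 0 \<longrightarrow> gav.dim (V n) \<le> gav.dim (V m))"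
      using ex_has_least_nat[of "\<lambda>n. n > 0" 1 "\<lambda>n. gav.dim (V n)"] by auto
    then show thesis using that by blast
  qed
  have "V (Suc n) = V n"
    by (rule ga.subspace_dim_equal[OF sub sub dec n(2)])
  moreover have "centre_val (a ^ n * 1) \<in> V n" unfolding V_def by blast
  ultimately have "centre_val (a ^ n * 1) \<in> V (Suc n)" by (simp only:)
  then obtain s where "centre_val (a ^ n * 1) = centre_val (a ^ Suc n * s)" unfolding V_def by blast
  then have s: "a ^ n = a ^ n * (a * s)" by (simp add: centre_val_inject ac_simps)
  have "a ^ n = a ^ n * (a * s) ^ k" for k
  proof (induction k)
    case (Suc k)
    have "a ^ n * (a * s) ^ Suc k = (a ^ n * (a * s)) * (a * s) ^ k" by (simp add: ac_simps)
    with Suc s show ?case by simp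
  qed simp
  from this[of n] have "a ^ n = a ^ n * a ^ n * s ^ n" by (simp add: power_mult_distrib mult.assoc)
  with n(1) show ?thesis by blast
qed


section \<open>Primitive central idempotents\<close>

definition primitive_idem :: "('g::group_add, 'a::comm_ring_1) group_centre \<Rightarrow> bool" where
  "primitive_idem e \<longleftrightarrow> e \<noteq> 0 \<and> e * e = e \<and> (\<forall>f. f * f = f \<longrightarrow> f * e = f \<longrightarrow> f = 0 \<or> f = e)"

definition orthogonal_idems :: "('g::group_add, 'a::comm_ring_1) group_centre set \<Rightarrow> bool" where
  "orthogonal_idems X \<longleftrightarrow> finite X \<and> (\<forall>e\<in>X. e \<noteq> 0 \<and> e * e = e) \<and> (\<forall>e\<in>X. \<forall>f\<in>X. e \<noteq> f \<longrightarrow> e * f = 0)"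

lemma orthogonal_idems_card:
  fixes X :: "('g::{group_add, finite}, 'a::field) group_centre set"
  assumes X: "orthogonal_idems X"
  shows "card X \<le> card (ga_basis :: ('g \<Rightarrow>\<^sub>0 'a) set)"
proof -
  have inj: "inj_on centre_val X" by (simp add: inj_on_def centre_val_inject)
  have "gav.independent (centre_val ` X)"
  proof (rule gav.independent_if_scalars_zero)
    fix u x assume 0: "(\<Sum>x\<in>centre_val ` X. ga_scale (u x) x) = 0" and x: "x \<in> centre_val ` X"
    obtain e where e: "e \<in> X" "x = centre_val e" using x by blast
    have "centre_val (\<Sum>f\<in>X. centre_scalar (u (centre_val f)) * f) = 0"
      using 0 by (simp add: sum.reindex[OF inj] centre_val_sum centre_val_simps centre_scalar.rep_eq)
    then have "(\<Sum>f\<in>X. centre_scalar (u (centre_val f)) * f) = 0"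
      by (intro centre_eqI) (simp add: centre_val_simps)
    then have "0 = (\<Sum>f\<in>X. centre_scalar (u (centre_val f)) * f) * e" by simp
    also have "\<dots> = (\<Sum>f\<in>X. if f = e then centre_scalar (u x) * e else 0)"
      unfolding sum_distrib_right using X e
      by (intro sum.cong) (auto simp: orthogonal_idems_def mult.assoc)
    also have "\<dots> = centre_scalar (u x) * e" using X e by (simp add: orthogonal_idems_def)
    finally have *: "centre_scalar (u x) * e = 0" by simp
    show "u x = 0"
    proof (rule ccontr)
      assume "u x \<noteq> 0"
      then have "e = centre_scalar (inverse (u x)) * (centre_scalar (u x) * e)"
        by (simp flip: mult.assoc centre_scalar_simps(4))
      then show False using * X e by (simp add: orthogonal_idems_def)
    qed
  qed (use X in \<open>simp add: orthogonal_idems_def\<close>)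
  then have "card (centre_val ` X) \<le> gav.dim (UNIV :: ('g \<Rightarrow>\<^sub>0 'a) set)"
    by (intro ga.independent_card_le_dim) auto
  then show ?thesis by (simp add: card_image[OF inj])
qed

text \<open>
  Orthogonal nonzero idempotents are linearly independent, so there is a decomposition of \<open>1\<close> with the
  largest possible number of summands. Its members are primitive, as they could be split otherwise,
  and every primitive idempotent \<open>e\<close> has \<open>e f \<noteq> 0\<close> for some member \<open>f\<close>, whence \<open>e = e f = f\<close>.
\<close>

lemma primitive_decomposition:
  "\<exists>X :: ('g::{group_add, finite}, 'a::field) group_centre set.
     orthogonal_idems X \<and> \<Sum>X = 1 \<and> X = {e. primitive_idem e}"
proof -
  let ?P = "\<lambda>n. \<exists>X :: ('g, 'a) group_centre set. orthogonal_idems X \<and> \<Sum>X = 1 \<and> card X = n"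
  have "?P 1" by (rule exI[of _ "{1}"]) (simp add: orthogonal_idems_def)
  moreover have "n \<le> card (ga_basis :: ('g \<Rightarrow>\<^sub>0 'a) set)" if "?P n" for n
    using that orthogonal_idems_card by blast
  ultimately obtain n where n: "?P n" "\<And>m. ?P m \<Longrightarrow> m \<le> n"
    using ex_has_greatest_nat[of ?P 1 "\<lambda>n. n" "Suc (card (ga_basis :: ('g \<Rightarrow>\<^sub>0 'a) set))"]
    by (auto simp: le_imp_less_Suc)
  then obtain X :: "('g, 'a) group_centre set" where X: "orthogonal_idems X" "\<Sum>X = 1" "card X = n" by blast
  note orth = X(1)[unfolded orthogonal_idems_def]
  have prim: "primitive_idem e" if e: "e \<in> X" for e
  proof (rule ccontr)
    assume "\<not> primitive_idem e"
    then obtain f where f: "f * f = f" "f * e = f" "f \<noteq> 0" "f \<noteq> e"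
      using orth e by (auto simp: primitive_idem_def)
    let ?g = "e - f" and ?Y = "X - {e}"
    have ee: "e * e = e" using orth e by auto
    have g: "?g * ?g = ?g" "?g * e = ?g" "?g \<noteq> 0" "f * ?g = 0"
      using f ee by (simp_all add: algebra_simps)
    have oth: "h * e = 0" "e * h = 0" if "h \<in> ?Y" for h using orth e that by auto
    have fh: "f * h = 0" "?g * h = 0" if "h \<in> ?Y" for h
    proof -
      have "f * h = f * (e * h)" "?g * h = ?g * (e * h)" using f(2) g(2) by (simp_all flip: mult.assoc)
      then show "f * h = 0" "?g * h = 0" using oth[OF that] by simp_all
    qed
    have notin: "f \<notin> ?Y" "?g \<notin> ?Y" using oth(1)[of f] oth(1)[of ?g] f g by auto
    have "f \<noteq> ?g" using f g by auto
    have sum: "\<Sum>(insert f (insert ?g ?Y)) = 1"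
      using orth notin \<open>f \<noteq> ?g\<close> X(2) e by (simp add: sum.remove[of X e])
    have "orthogonal_idems (insert f (insert ?g ?Y))"
      unfolding orthogonal_idems_def using orth f g fh by (auto simp: mult.commute)
    moreover have "card (insert f (insert ?g ?Y)) = Suc n"
    proof -
      have "card X = Suc (card ?Y)" using orth e by (intro card.remove) auto
      then show ?thesis using orth notin \<open>f \<noteq> ?g\<close> X(3) by simp
    qed
    ultimately have "?P (Suc n)" using sum by blast
    from n(2)[OF this] show False by simp
  qed
  have "e \<in> X" if e: "primitive_idem e" for e
  proof -
    have "e = (\<Sum>f\<in>X. e * f)" using X(2) by (simp flip: sum_distrib_left)
    moreover have "e \<noteq> 0" using e by (simp add: primitive_idem_def)
    ultimately obtain f where f: "f \<in> X" "e * f \<noteq> 0" by (metis sum.not_neutral_contains_not_neutral)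
    have "e * e = e" "f * f = f" using e prim[OF f(1)] by (auto simp: primitive_idem_def)
    then have "e * f * (e * f) = e * f" "e * f * e = e * f" "e * f * f = e * f"
      by (metis mult.assoc mult.commute)+
    then have "e * f = e" "e * f = f"
      using e prim[OF f(1)] f(2) unfolding primitive_idem_def by blast+
    then show ?thesis using f by simp
  qed
  with prim X show ?thesis by (intro exI[of _ X]) auto
qed

lemma finite_primitive_idems: "finite {e :: ('g::{group_add, finite}, 'a::field) group_centre. primitive_idem e}"
  using primitive_decomposition[where 'g = 'g and 'a = 'a] by (auto simp: orthogonal_idems_def)

lemma primitive_idems_orthogonal:
  fixes e f :: "('g::{group_add, finite}, 'a::field) group_centre"
  assumes "primitive_idem e" "primitive_idem f"
  shows "e * f = (if e = f then e else 0)"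
  using primitive_decomposition[where 'g = 'g and 'a = 'a] assms
  by (auto simp: orthogonal_idems_def)

lemma sum_primitive_idems:
  "\<Sum>{e :: ('g::{group_add, finite}, 'a::field) group_centre. primitive_idem e} = 1"
  using primitive_decomposition[where 'g = 'g and 'a = 'a] by auto

section \<open>Blocks\<close>

definition block_ideal :: "('g::group_add, 'a::comm_ring_1) group_centre \<Rightarrow> ('g \<Rightarrow>\<^sub>0 'a) set" where
  "block_ideal e = range (\<lambda>r. centre_val e * r)"

lemma idem_val: "e * e = e \<Longrightarrow> centre_val e * (centre_val e * r) = centre_val e * r"
  by (metis mult.assoc times_group_centre.rep_eq)

lemma in_block_ideal_iff:
  assumes "e * e = e"
  shows "x \<in> block_ideal e \<longleftrightarrow> centre_val e * x = x"
proof
  assume "x \<in> block_ideal e"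
  then show "centre_val e * x = x" using idem_val[OF assms] by (auto simp: block_ideal_def)
next
  assume "centre_val e * x = x"
  then show "x \<in> block_ideal e" unfolding block_ideal_def by (metis rangeI)
qed

lemma two_sided_ideal_block_ideal: "two_sided_ideal (block_ideal e)"
  unfolding two_sided_ideal_def block_ideal_def
proof (intro conjI ballI allI)
  show "0 \<in> range (\<lambda>r. centre_val e * r)" by (rule range_eqI[of _ _ 0]) simp
  fix x assume "x \<in> range (\<lambda>r. centre_val e * r)"
  then obtain s where x: "x = centre_val e * s" by blast
  show "x + y \<in> range (\<lambda>r. centre_val e * r)" if "y \<in> range (\<lambda>r. centre_val e * r)" for y
    using that by (auto simp: x simp flip: distrib_left)
  fix r
  have "r * x = centre_val e * (r * s)"
    using centre_val_commute[of e r] by (simp add: x flip: mult.assoc)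
  then show "r * x \<in> range (\<lambda>r. centre_val e * r)" by blast
  show "x * r \<in> range (\<lambda>r. centre_val e * r)" by (simp add: x mult.assoc)
qed

text \<open>
  Let \<open>a\<close> and \<open>b\<close> be the components of \<open>e\<close> in \<open>A\<close> and \<open>B\<close>. For every \<open>r\<close>, \<open>r a - a r = b r - r b\<close> lies in both
  ideals and vanishes, so \<open>a\<close> is central; and \<open>A B = 0\<close> makes \<open>a\<close> and \<open>b\<close> the identities of \<open>A\<close> and \<open>B\<close>.
\<close>

lemma idem_decompose:
  fixes e :: "('g::group_add, 'a::comm_ring_1) group_centre"
  assumes e: "e * e = e" and sum: "direct_sum_of A B (block_ideal e)"
  shows "\<exists>f. f * f = f \<and> f * e = f \<and> A = block_ideal f \<and> B = block_ideal (e - f)"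
proof -
  have idA: "two_sided_ideal A" and idB: "two_sided_ideal B"
    and AB: "block_ideal e = {a + b | a b. a \<in> A \<and> b \<in> B}" and int: "A \<inter> B = {0}"
    using sum by (auto simp: direct_sum_of_def)
  have "centre_val e \<in> block_ideal e" using e by (simp add: in_block_ideal_iff flip: times_group_centre.rep_eq)
  then obtain a b where ab: "centre_val e = a + b" "a \<in> A" "b \<in> B" unfolding AB by blast
  have neg: "- x \<in> A" if "x \<in> A" for x
  proof -
    have "-1 * x \<in> A" using idA that unfolding two_sided_ideal_def by blast
    then show ?thesis by simp
  qed
  have negB: "- x \<in> B" if "x \<in> B" for x
  proof -
    have "-1 * x \<in> B" using idB that unfolding two_sided_ideal_def by blast
    then show ?thesis by simp
  qed
  have 0: "x = 0" if "x \<in> A" "x \<in> B" for x using int that by blast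
  have subA: "A \<subseteq> block_ideal e"
  proof
    fix x assume "x \<in> A"
    then have "x + 0 \<in> block_ideal e" using idB unfolding AB two_sided_ideal_def by blast
    then show "x \<in> block_ideal e" by simp
  qed
  have subB: "B \<subseteq> block_ideal e"
  proof
    fix x assume "x \<in> B"
    then have "0 + x \<in> block_ideal e" using idA unfolding AB two_sided_ideal_def by blast
    then show "x \<in> block_ideal e" by simp
  qed
  have prod: "x * y = 0" "y * x = 0" if "x \<in> A" "y \<in> B" for x y
    using idA idB that 0 unfolding two_sided_ideal_def by blast+
  have aA: "a * x = x" if "x \<in> A" for x
    using that subA e prod[OF that ab(3)] by (auto simp: in_block_ideal_iff ab distrib_right)
  have bB: "b * x = x" if "x \<in> B" for x
    using that subB e prod[OF ab(2) that] by (auto simp: in_block_ideal_iff ab distrib_right)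
  have a_central: "r * a = a * r" for r
  proof -
    have "r * a + r * b = a * r + b * r"
      using centre_val_commute[of e r] by (simp add: ab distrib_left distrib_right)
    then have eq: "r * a - a * r = b * r - r * b" by (simp add: algebra_simps)
    have "r * a \<in> A" "- (a * r) \<in> A" "b * r \<in> B" "- (r * b) \<in> B"
      using idA idB ab(2,3) by (auto simp: two_sided_ideal_def intro!: neg negB)
    then have "r * a + - (a * r) \<in> A" "b * r + - (r * b) \<in> B"
      using idA idB unfolding two_sided_ideal_def by blast+
    then show ?thesis using 0[of "r * a - a * r"] eq by simp
  qed
  define f where "f = Abs_group_centre a"
  have f: "a = centre_val f"
    unfolding f_def by (rule Abs_group_centre_inverse[symmetric]) (simp add: a_central)
  have b: "b = centre_val (e - f)" using ab f by (simp add: centre_val_simps)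
  have ff: "f * f = f" using aA[OF ab(2)] by (intro centre_eqI) (simp add: f centre_val_simps)
  have fe: "f * e = f"
  proof (rule centre_eqI)
    have "a * b = 0" using prod ab by blast
    then show "centre_val (f * e) = centre_val f"
      using aA[OF ab(2)] by (simp add: centre_val_simps ab(1) distrib_left flip: f)
  qed
  have gg: "(e - f) * (e - f) = e - f" using ff fe e by (simp add: algebra_simps)
  have "A = block_ideal f"
  proof (intro equalityI subsetI)
    fix x assume "x \<in> block_ideal f"
    then show "x \<in> A" using idA ab(2) by (auto simp: block_ideal_def two_sided_ideal_def f)
  qed (simp add: in_block_ideal_iff[OF ff] aA flip: f)
  moreover have "B = block_ideal (e - f)"
  proof (intro equalityI subsetI)
    fix x assume "x \<in> block_ideal (e - f)"
    then show "x \<in> B" using idB ab(3) by (auto simp: block_ideal_def two_sided_ideal_def b)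
  qed (simp add: in_block_ideal_iff[OF gg] bB flip: b)
  ultimately show ?thesis using ff fe by blast
qed

lemma direct_sum_idem:
  fixes e f :: "('g::group_add, 'a::comm_ring_1) group_centre"
  assumes e: "e * e = e" and f: "f * f = f" "f * e = f"
  shows "direct_sum_of (block_ideal f) (block_ideal (e - f)) (block_ideal e)"
proof -
  have g: "(e - f) * (e - f) = e - f" using f e by (simp add: algebra_simps)
  have "block_ideal e = {a + b | a b. a \<in> block_ideal f \<and> b \<in> block_ideal (e - f)}"
  proof (intro equalityI subsetI)
    fix x assume "x \<in> block_ideal e"
    then obtain r where "x = centre_val f * r + centre_val (e - f) * r"
      by (auto simp: block_ideal_def centre_val_simps left_diff_distrib)
    then show "x \<in> {a + b | a b. a \<in> block_ideal f \<and> b \<in> block_ideal (e - f)}"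
      by (auto simp: block_ideal_def)
  next
    fix x assume "x \<in> {a + b | a b. a \<in> block_ideal f \<and> b \<in> block_ideal (e - f)}"
    then obtain r s where x: "x = centre_val f * r + centre_val (e - f) * s" by (auto simp: block_ideal_def)
    have "e * f = f" "e * (e - f) = e - f" using e f by (simp_all add: algebra_simps)
    then have "centre_val e * x = x"
      unfolding x distrib_left by (simp flip: mult.assoc times_group_centre.rep_eq)
    then show "x \<in> block_ideal e" using e by (simp add: in_block_ideal_iff)
  qed
  moreover have "block_ideal f \<inter> block_ideal (e - f) = {0}"
  proof -
    have "x = 0" if "x \<in> block_ideal f" "x \<in> block_ideal (e - f)" for x
    proof -
      have "x = centre_val (f * (e - f)) * x"
        using that f g by (simp add: in_block_ideal_iff centre_val_simps mult.assoc)
      moreover have "f * (e - f) = 0" using f by (simp add: algebra_simps)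
      ultimately show ?thesis by (simp add: centre_val_simps)
    qed
    moreover have "0 \<in> block_ideal f" "0 \<in> block_ideal (e - f)"
      using two_sided_ideal_block_ideal unfolding two_sided_ideal_def by blast+
    ultimately show ?thesis by blast
  qed
  ultimately show ?thesis by (simp add: direct_sum_of_def two_sided_ideal_block_ideal)
qed

lemma block_ideal_inject:
  assumes "e * e = e" "f * f = f" "block_ideal e = block_ideal f"
  shows "e = f"
proof -
  have "centre_val e \<in> block_ideal e" "centre_val f \<in> block_ideal f"
    using assms(1,2) by (simp_all add: in_block_ideal_iff flip: times_group_centre.rep_eq)
  then have "centre_val e \<in> block_ideal f" "centre_val f \<in> block_ideal e"
    by (simp_all add: assms(3))
  then have "f * e = e" "e * f = f"
    using assms(1,2) by (simp_all add: in_block_ideal_iff centre_val_inject flip: times_group_centre.rep_eq)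
  then show ?thesis by (simp add: mult.commute)
qed

lemma block_ideal_eq_zero_iff: "e * e = e \<Longrightarrow> block_ideal e = {0} \<longleftrightarrow> e = 0"
proof
  assume "e * e = e" "block_ideal e = {0}"
  moreover have "centre_val e * 1 \<in> block_ideal e" unfolding block_ideal_def by blast
  ultimately show "e = 0" by (intro centre_eqI) (simp add: centre_val_simps)
qed (auto simp: block_ideal_def centre_val_simps)

lemma block_ideal_one: "block_ideal 1 = UNIV"
  by (auto simp: block_ideal_def centre_val_simps)

text \<open>
  A direct summand is generated by the component of \<open>1\<close> in it, and decompositions of the summand are
  decompositions of that idempotent.
\<close>

theorem blocks_eq: "blocks = block_ideal ` {e :: ('g::group_add, 'a::comm_ring_1) group_centre. primitive_idem e}"
proof (intro equalityI subsetI)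
  fix C :: "('g \<Rightarrow>\<^sub>0 'a) set" assume "C \<in> blocks"
  then obtain D where C: "C \<noteq> {0}" "direct_sum_of C D UNIV" "\<And>A B. direct_sum_of A B C \<Longrightarrow> A = {0} \<or> B = {0}"
    by (auto simp: blocks_def)
  obtain e :: "('g, 'a) group_centre" where e: "e * e = e" "C = block_ideal e"
    using idem_decompose[of 1 C D] C(2) by (auto simp: block_ideal_one)
  have "primitive_idem e"
    unfolding primitive_idem_def
  proof (intro conjI allI impI)
    show "e \<noteq> 0" using C(1) e block_ideal_eq_zero_iff by blast
    fix f assume f: "f * f = f" "f * e = f"
    have g: "(e - f) * (e - f) = e - f" using e f by (simp add: algebra_simps)
    have "block_ideal f = {0} \<or> block_ideal (e - f) = {0}"
      by (rule C(3)) (simp only: e(2) direct_sum_idem[OF e(1) f])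
    then have "f = 0 \<or> e - f = 0" using block_ideal_eq_zero_iff[OF f(1)] block_ideal_eq_zero_iff[OF g] by blast
    then show "f = 0 \<or> f = e" by auto
  qed (rule e)
  with e show "C \<in> block_ideal ` {e. primitive_idem e}" by blast
next
  fix C :: "('g \<Rightarrow>\<^sub>0 'a) set" assume "C \<in> block_ideal ` {e. primitive_idem e}"
  then obtain e where C: "C = block_ideal e" and e: "e \<noteq> 0" "e * e = e" "\<And>f. f * f = f \<Longrightarrow> f * e = f \<Longrightarrow> f = 0 \<or> f = e"
    by (auto simp: primitive_idem_def)
  have "A = {0} \<or> B = {0}" if AB: "direct_sum_of A B C" for A B
  proof -
    obtain f where f: "f * f = f" "f * e = f" "A = block_ideal f" "B = block_ideal (e - f)"
      using idem_decompose[OF e(2) AB[unfolded C]] by blast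
    have 0: "block_ideal (0 :: ('g, 'a) group_centre) = {0}" by (simp add: block_ideal_eq_zero_iff)
    from e(3)[OF f(1,2)] show ?thesis
    proof
      assume "f = 0"
      then show ?thesis using f(3) 0 by (simp only: simp_thms)
    next
      assume "f = e"
      then show ?thesis using f(4) 0 by (simp only: simp_thms diff_self)
    qed
  qed
  moreover have "direct_sum_of C (block_ideal (1 - e)) UNIV"
  proof -
    have "1 * 1 = (1 :: ('g, 'a) group_centre)" "e * 1 = e" by (rule mult_1_left mult_1_right)+
    from direct_sum_idem[OF this(1) e(2) this(2)] show ?thesis by (simp only: C block_ideal_one)
  qed
  moreover have "two_sided_ideal C" unfolding C by (rule two_sided_ideal_block_ideal)
  moreover have "C \<noteq> {0}" unfolding C using e(1) block_ideal_eq_zero_iff[OF e(2)] by blast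
  ultimately show "C \<in> blocks" unfolding blocks_def by blast
qed

lemma inj_on_block_ideal: "inj_on block_ideal {e. primitive_idem e}"
  by (auto simp: inj_on_def primitive_idem_def intro: block_ideal_inject)


section \<open>The scalars of a block\<close>

definition nilp :: "'r::comm_ring_1 \<Rightarrow> bool" where
  "nilp x \<longleftrightarrow> (\<exists>n. x ^ n = 0)"

lemma nilp_mult: "nilp x \<Longrightarrow> nilp (x * y)"
  unfolding nilp_def power_mult_distrib by (metis mult_zero_left)

lemma power_zero_mono: "x ^ n = (0 :: 'r::comm_ring_1) \<Longrightarrow> n \<le> m \<Longrightarrow> x ^ m = 0"
  by (metis le_add_diff_inverse mult_zero_left power_add)

lemma nilp_add:
  assumes "nilp x" "nilp y"
  shows "nilp (x + y)"
proof -
  obtain m n where mn: "x ^ m = 0" "y ^ n = 0" using assms by (auto simp: nilp_def)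
  have "of_nat (m + n choose k) * x ^ k * y ^ (m + n - k) = 0" for k
    by (cases "k \<ge> m") (simp_all add: power_zero_mono[OF mn(1)] power_zero_mono[OF mn(2)])
  then have "(x + y) ^ (m + n) = 0" by (simp add: binomial_ring)
  then show ?thesis by (auto simp: nilp_def)
qed

lemma nilp_diff: "nilp x \<Longrightarrow> nilp y \<Longrightarrow> nilp (x - y)"
  using nilp_add[of x "y * (-1)"] nilp_mult[of y "-1"] by simp

text \<open>
  Let \<open>l\<close> be an eigenvalue of \<open>z\<close> on the ideal of \<open>e\<close>. By Fitting's lemma, \<open>(z - l) e\<close> is invertible or
  nilpotent in that ideal, as the only idempotents there are \<open>0\<close> and \<open>e\<close>; it is not invertible, since it
  annihilates an eigenvector.
\<close>

lemma block_scalar_exists: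
  fixes e z :: "('g::{group_add, finite}, 'a::alg_closed_field) group_centre"
  assumes "primitive_idem e"
  shows "\<exists>l. nilp ((z - centre_scalar l) * e)"
proof -
  have e: "e \<noteq> 0" "e * e = e" "\<And>f. f * f = f \<Longrightarrow> f * e = f \<Longrightarrow> f = 0 \<or> f = e"
    using assms by (auto simp: primitive_idem_def)
  obtain l w where w: "w \<noteq> 0" "e * w = w" "(z - centre_scalar l) * w = 0"
    using centre_eigenvalue[OF e(1,2)] by blast
  let ?a = "(z - centre_scalar l) * e"
  obtain n s where ns: "n > 0" "?a ^ n = ?a ^ n * ?a ^ n * s" using centre_fitting[of ?a] by blast
  let ?f = "?a ^ n * s"
  have aw: "?a * w = 0" using w by (simp add: mult.assoc)
  have "?f * ?f = ?a ^ n * ?a ^ n * s * s" by (simp only: ac_simps)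
  also have "\<dots> = ?f" by (simp only: ns(2)[symmetric])
  finally have "?f * ?f = ?f" .
  moreover have "?f * e = ?f"
  proof -
    obtain m where m: "n = Suc m" using ns(1) by (cases n) auto
    have "?a ^ n * e = ?a ^ m * ((z - centre_scalar l) * (e * e))"
      unfolding m power_Suc2 by (simp only: mult.assoc)
    also have "\<dots> = ?a ^ n" unfolding m power_Suc2 e(2) ..
    finally have ae: "?a ^ n * e = ?a ^ n" .
    have "?f * e = ?a ^ n * e * s" by (simp only: mult.assoc mult.commute[of s e])
    then show ?thesis by (simp only: ae)
  qed
  ultimately consider "?f = 0" | "?f = e" using e(3) by blast
  then show ?thesis
  proof cases
    case 1
    have "?a ^ n = ?a ^ n * ?f" using ns(2) by (simp only: mult.assoc)
    also have "\<dots> = 0" by (simp only: 1 mult_zero_right)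
    finally show ?thesis unfolding nilp_def by blast
  next
    case 2
    have "w = ?f * w" by (simp only: 2 w(2))
    also have "\<dots> = ?a ^ (n - 1) * s * (?a * w)" 
    proof -
      have "a ^ Suc m * s * w = a ^ m * s * (a * w)" for a :: "('g, 'a) group_centre" and m
        by (simp add: ac_simps)
      from this[of ?a "n - 1"] show ?thesis using ns(1) by (simp only: Suc_diff_1)
    qed
    finally show ?thesis using w(1) by (simp only: aw mult_zero_right)
  qed
qed

lemma nilp_scalar_idem:
  fixes e :: "('g::group_add, 'a::field) group_centre"
  assumes "e \<noteq> 0" "e * e = e" "nilp (centre_scalar l * e)"
  shows "l = 0"
proof (rule ccontr)
  assume "l \<noteq> 0"
  obtain n where n: "(centre_scalar l * e) ^ n = 0" using assms(3) by (auto simp: nilp_def)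
  have "e ^ n * e = e" using assms(2) by (induction n) (simp_all add: mult.assoc)
  moreover have "centre_scalar (l ^ n) * e ^ n = 0"
    using n by (simp add: power_mult_distrib centre_scalar_power)
  ultimately have "centre_scalar (l ^ n) * e = 0"
    by (metis mult.assoc mult_zero_left)
  then have "centre_scalar (inverse (l ^ n) * l ^ n) * e = 0"
    by (simp only: centre_scalar_simps mult.assoc mult_zero_right)
  then show False using assms(1) \<open>l \<noteq> 0\<close> by simp
qed

text \<open>
  This is the central character, described inside the group algebra and without reference to modules.
  Being a ring homomorphism follows from the uniqueness of the scalar.
\<close>

definition block_char :: "('g::{group_add, finite}, 'a::field) group_centre \<Rightarrow> ('g, 'a) group_centre \<Rightarrow> 'a" where
  "block_char e z = (THE l. nilp ((z - centre_scalar l) * e))"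

context
  fixes e :: "('g::{group_add, finite}, 'a::alg_closed_field) group_centre"
  assumes prim: "primitive_idem e"
begin

lemma block_char_unique:
  assumes "nilp ((z - centre_scalar l) * e)"
  shows "block_char e z = l"
  unfolding block_char_def
proof (rule the_equality)
  fix m assume "nilp ((z - centre_scalar m) * e)"
  then have "nilp ((z - centre_scalar m) * e - (z - centre_scalar l) * e)" using assms by (rule nilp_diff)
  moreover have "(z - centre_scalar m) * e - (z - centre_scalar l) * e = centre_scalar (l - m) * e"
    by (simp add: algebra_simps)
  ultimately have "l - m = 0" using prim by (intro nilp_scalar_idem[of e]) (auto simp: primitive_idem_def)
  then show "m = l" by simp
qed (rule assms)

lemma nilp_block_char: "nilp ((z - centre_scalar (block_char e z)) * e)"
  using block_scalar_exists[OF prim, of z] block_char_unique by auto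

lemma block_char_add: "block_char e (y + z) = block_char e y + block_char e z"
proof (rule block_char_unique)
  have "(y + z - centre_scalar (block_char e y + block_char e z)) * e
      = (y - centre_scalar (block_char e y)) * e + (z - centre_scalar (block_char e z)) * e"
    by (simp add: algebra_simps)
  then show "nilp ((y + z - centre_scalar (block_char e y + block_char e z)) * e)"
    by (simp add: nilp_add nilp_block_char)
qed

lemma block_char_mult: "block_char e (y * z) = block_char e y * block_char e z"
proof (rule block_char_unique)
  have "(y * z - centre_scalar (block_char e y * block_char e z)) * e
      = (y - centre_scalar (block_char e y)) * e * z
      + (z - centre_scalar (block_char e z)) * e * centre_scalar (block_char e y)"
    by (simp add: algebra_simps)
  then show "nilp ((y * z - centre_scalar (block_char e y * block_char e z)) * e)"
    by (simp add: nilp_add nilp_block_char nilp_mult)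
qed

lemma block_char_scalar: "block_char e (centre_scalar a) = a"
  by (rule block_char_unique) (auto simp: nilp_def intro: exI[of _ 1])

lemma block_char_zero: "block_char e 0 = 0"
  using block_char_scalar[of 0] by simp

lemma block_char_sum: "block_char e (sum h S) = (\<Sum>i\<in>S. block_char e (h i))"
  by (induction S rule: infinite_finite_induct) (auto simp: block_char_zero block_char_add)

lemma block_char_of_nat: "block_char e (of_nat n) = of_nat n"
  using block_char_scalar[of 1] by (induction n) (auto simp: block_char_zero block_char_add)

lemma block_char_class_mult:
  "block_char e (centre_class c) * block_char e (centre_class d)
     = (\<Sum>k\<in>UNIV. of_nat (class_mult c d k) * block_char e (centre_class k))"
proof -
  have "block_char e (centre_class c) * block_char e (centre_class d) = block_char e (centre_class c * centre_class d)"
    by (rule block_char_mult[symmetric])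
  also have "\<dots> = (\<Sum>k\<in>UNIV. of_nat (class_mult c d k) * block_char e (centre_class k))"
    unfolding centre_class_mult block_char_sum block_char_mult block_char_of_nat ..
  finally show ?thesis .
qed

end

lemma left_module_diff:
  assumes "left_module V act" "v \<in> V" "w \<in> V"
  shows "act r (v - w) = act r v - act r w"
proof -
  have "v - w \<in> V" using assms by (simp add: left_module_def)
  then have "act r (v - w + w) = act r (v - w) + act r w" using assms unfolding left_module_def by blast
  then show ?thesis by simp
qed

lemma left_module_zero:
  assumes "left_module V act"
  shows "act r 0 = 0" "v \<in> V \<Longrightarrow> act 0 v = 0"
proof -
  have "0 \<in> V" using assms by (simp add: left_module_def)
  from left_module_diff[OF assms this this, of r] show "act r 0 = 0" by simp
  assume "v \<in> V"
  then have "act (0 + 0) v = act 0 v + act 0 v" using assms unfolding left_module_def by blast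
  then show "act 0 v = 0" by simp
qed

lemma left_module_eq_kernel:
  assumes V: "left_module V act" and comm: "\<And>r. r * x = x * r"
  shows "left_module {v \<in> V. act x v = 0} act"
proof -
  have "act x (act r v) = 0" if "v \<in> V" "act x v = 0" for r v
  proof -
    have "act x (act r v) = act (x * r) v" using V that unfolding left_module_def by simp
    also have "\<dots> = act r (act x v)" using V that unfolding left_module_def by (simp flip: comm)
    also have "\<dots> = 0" by (simp add: that left_module_zero[OF V])
    finally show ?thesis .
  qed
  then show ?thesis
    using V left_module_diff[OF V] left_module_zero[OF V] unfolding left_module_def by auto
qed

text \<open>
  The kernel of a central element is a submodule, so the element acts injectively or as zero on a
  simple module.
\<close>

lemma simple_module_central:
  assumes "simple_module V act" "\<And>r. r * x = x * r" "v \<in> V" "v \<noteq> 0" "act x v = 0" "w \<in> V"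
  shows "act x w = 0"
proof -
  have V: "left_module V act" and "{v \<in> V. act x v = 0} = {0} \<or> {v \<in> V. act x v = 0} = V"
    using assms left_module_eq_kernel[of V act x] by (auto simp: simple_module_def)
  with assms show ?thesis by blast
qed

text \<open>
  If \<open>V\<close> belongs to the block of \<open>e\<close>, then \<open>e\<close> acts as the identity, and the nilpotent central element
  \<open>(z - block_char e z) e\<close>, which cannot act injectively, acts as zero.
\<close>

lemma block_char_acts:
  fixes e z :: "('g::{group_add, finite}, 'a::alg_closed_field) group_centre" and V :: "'v::ab_group_add set"
  assumes e: "primitive_idem e" and V: "simple_module V act" and C: "belongs_to V act (block_ideal e)" and v: "v \<in> V"
  shows "act (centre_val z) v = act (Poly_Mapping.single 0 (block_char e z)) v"
proof -
  have mod: "left_module V act" using V by (simp add: simple_module_def)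
  have ee: "e * e = e" using e by (simp add: primitive_idem_def)
  have act: "act (r * s) v = act r (act s v)" "act (r + s) v = act r v + act s v" "act 1 v = v" "act r v \<in> V"
    if "v \<in> V" for r s v using mod that by (auto simp: left_module_def)
  have cen: "act (centre_val y) w = 0" if "u \<in> V" "u \<noteq> 0" "act (centre_val y) u = 0" "w \<in> V" for y u w
    by (rule simple_module_central[of V act "centre_val y" u w]) (fact V that centre_val_commute[symmetric])+
  obtain x u where xu: "x \<in> block_ideal e" "u \<in> V" "act x u \<noteq> 0" using C by (auto simp: belongs_to_def)
  have "act (centre_val (1 - e)) (act x u) = act (centre_val (1 - e) * x) u" using xu act by simp
  also have "centre_val (1 - e) * x = 0" using xu(1) ee by (simp add: in_block_ideal_iff centre_val_simps left_diff_distrib)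
  finally have "act (centre_val (1 - e)) (act x u) = 0" using xu left_module_zero[OF mod] by simp
  then have "act (centre_val (1 - e)) w = 0" if "w \<in> V" for w
    using cen[of "act x u" "1 - e" w] xu act(4)[of u x] that by simp
  then have e_id: "act (centre_val e) w = w" if "w \<in> V" for w
    using act(2)[of w "centre_val (1 - e)" "centre_val e"] act(3)[of w] that by (simp add: centre_val_simps)
  let ?n = "(z - centre_scalar (block_char e z)) * e"
  obtain k where k: "?n ^ k = 0" using nilp_block_char[OF e] by (auto simp: nilp_def)
  have "act (centre_val ?n) v = 0"
  proof (cases "v = 0")
    case False
    have "\<exists>w\<in>V. w \<noteq> 0 \<and> act (centre_val ?n) w = 0" if "act (centre_val (?n ^ k)) v = 0" for k
      using that
    proof (induction k)
      case 0
      then show ?case using act(3)[OF v] False by (simp add: centre_val_simps)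
    next
      case (Suc k)
      show ?case
      proof (cases "act (centre_val (?n ^ k)) v = 0")
        case False
        have "act (centre_val ?n) (act (centre_val (?n ^ k)) v) = 0"
          using Suc.prems act(1)[OF v] by (simp add: centre_val_simps)
        then show ?thesis using False act(4)[OF v] by blast
      qed (rule Suc.IH)
    qed
    moreover have "act (centre_val (?n ^ k)) v = 0"
      using left_module_zero[OF mod] v by (simp only: k zero_group_centre.rep_eq)
    ultimately obtain w where "w \<in> V" "w \<noteq> 0" "act (centre_val ?n) w = 0" by blast
    then show ?thesis using v by (rule cen)
  qed (simp add: left_module_zero[OF mod])
  then have "act (centre_val (z - centre_scalar (block_char e z))) v = 0"
    using act(1)[OF v] e_id[OF v] by (simp add: times_group_centre.rep_eq)
  then show ?thesis
    using act(2)[OF v, of "centre_val (z - centre_scalar (block_char e z))" "centre_val (centre_scalar (block_char e z))"]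
    by (simp add: centre_val_simps centre_scalar.rep_eq)
qed

text \<open>
  A nonzero left ideal of least dimension inside the block is simple. Because of it, the scalar in
  \<open>central_char\<close> is unique.
\<close>

lemma block_has_simple_module:
  fixes e :: "('g::{group_add, finite}, 'a::field) group_centre"
  assumes "primitive_idem e"
  shows "\<exists>V. simple_module V (*) \<and> belongs_to V (*) (block_ideal e)"
proof -
  let ?P = "\<lambda>W. left_module W (*) \<and> W \<noteq> {0} \<and> W \<subseteq> block_ideal e"
  have ee: "e * e = e" "e \<noteq> 0" using assms by (auto simp: primitive_idem_def)
  have lm: "left_module W (*) \<longleftrightarrow> 0 \<in> W \<and> (\<forall>v\<in>W. \<forall>w\<in>W. v - w \<in> W) \<and> (\<forall>r. \<forall>v\<in>W. r * v \<in> W)"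
    for W :: "('g \<Rightarrow>\<^sub>0 'a) set"
    by (auto simp: left_module_def distrib_left distrib_right mult.assoc)
  have sub: "gav.subspace W" if "left_module W (*)" for W :: "('g \<Rightarrow>\<^sub>0 'a) set"
  proof (rule gav.subspaceI)
    show "x + y \<in> W" if "x \<in> W" "y \<in> W" for x y
      using \<open>left_module W (*)\<close> that unfolding lm by (metis diff_0 diff_minus_eq_add)
  qed (use that in \<open>auto simp: lm\<close>)
  have "left_module (block_ideal e) (*)"
  proof -
    have id: "two_sided_ideal (block_ideal e)" by (rule two_sided_ideal_block_ideal)
    have "v - w \<in> block_ideal e" if "v \<in> block_ideal e" "w \<in> block_ideal e" for v w
      using that by (auto simp: in_block_ideal_iff[OF ee(1)] right_diff_distrib)
    with id show ?thesis by (auto simp: lm two_sided_ideal_def)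
  qed
  then have "?P (block_ideal e)" using block_ideal_eq_zero_iff ee by blast
  then obtain V where V: "?P V" "\<And>W. ?P W \<Longrightarrow> gav.dim V \<le> gav.dim W"
    using ex_has_least_nat[of ?P "block_ideal e" gav.dim] by blast
  have "W = {0} \<or> W = V" if "W \<subseteq> V" "left_module W (*)" for W
    using ga.subspace_dim_equal[OF sub sub, of W V] V that by blast
  with V(1) have "simple_module V (*)" by (auto simp: simple_module_def)
  moreover have "belongs_to V (*) (block_ideal e)"
  proof -
    have "0 \<in> V" using V(1) by (auto simp: lm)
    with V(1) obtain v where v: "v \<in> V" "v \<noteq> 0" by blast
    have "centre_val e \<in> block_ideal e" using ee by (simp add: in_block_ideal_iff flip: times_group_centre.rep_eq)
    moreover have "centre_val e * v = v" using v V(1) ee by (auto simp: in_block_ideal_iff)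
    ultimately show ?thesis using v unfolding belongs_to_def by metis
  qed
  ultimately show ?thesis by blast
qed

theorem central_char_eq:
  fixes e :: "('g::{group_add, finite}, 'a::alg_closed_field) group_centre"
  assumes e: "primitive_idem e"
  shows "central_char (block_ideal e) c = block_char e (centre_class c)"
  unfolding central_char_def
proof (rule the_equality)
  show "\<forall>(V :: ('g \<Rightarrow>\<^sub>0 'a) set) act. simple_module V act \<and> belongs_to V act (block_ideal e) \<longrightarrow>
      (\<forall>v\<in>V. act (class_sum c) v = act (Poly_Mapping.single 0 (block_char e (centre_class c))) v)"
  proof (intro allI impI ballI)
    fix V :: "('g \<Rightarrow>\<^sub>0 'a) set" and act :: "('g \<Rightarrow>\<^sub>0 'a) \<Rightarrow> ('g \<Rightarrow>\<^sub>0 'a) \<Rightarrow> ('g \<Rightarrow>\<^sub>0 'a)" and v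
    assume "simple_module V act \<and> belongs_to V act (block_ideal e)" "v \<in> V"
    then show "act (class_sum c) v = act (Poly_Mapping.single 0 (block_char e (centre_class c))) v"
      using block_char_acts[OF e, of V act v "centre_class c"] by (simp add: centre_class.rep_eq)
  qed
next
  fix l assume l: "\<forall>(V :: ('g \<Rightarrow>\<^sub>0 'a) set) act. simple_module V act \<and> belongs_to V act (block_ideal e) \<longrightarrow>
      (\<forall>v\<in>V. act (class_sum c) v = act (Poly_Mapping.single 0 l) v)"
  obtain V where V: "simple_module V (*)" "belongs_to V (*) (block_ideal e)"
    using block_has_simple_module[OF e] by blast
  have "0 \<in> V" "V \<noteq> {0}" using V(1) by (auto simp: simple_module_def left_module_def)
  then obtain v where v: "v \<in> V" "v \<noteq> 0" by blast
  have "class_sum c * v = ga_scale l v" using l V v by blast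
  moreover have "class_sum c * v = ga_scale (block_char e (centre_class c)) v"
    using block_char_acts[OF e V v(1), of "centre_class c"] by (simp add: centre_class.rep_eq)
  ultimately have "ga_scale l v = ga_scale (block_char e (centre_class c)) v" by (simp only:)
  then have "l = block_char e (centre_class c) \<or> v = 0" by (simp only: gav.scale_cancel_right)
  then show "l = block_char e (centre_class c)" using v(2) by simp
qed

section \<open>Binomial coefficients of p-adic integers\<close>

lemma fact_choose_eq_prod: "fact r * int (a choose r) = (\<Prod>i<r. int a - int i)"
proof -
  have "fact r * (of_nat a gchoose r) = (\<Prod>i = 0..<r. of_nat a - of_nat i :: rat)"
    by (rule gbinomial_mult_fact)
  then have "of_int (fact r * int (a choose r)) = (of_int (\<Prod>i<r. int a - int i) :: rat)"
    by (simp add: binomial_gbinomial atLeast0LessThan)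
  then show ?thesis by (simp only: of_int_eq_iff)
qed

lemma padic_coherent:
  assumes t: "t \<in> padic_ints p" and "n \<le> m"
  shows "t m mod int p ^ n = t n"
  using assms(2)
proof (induction m rule: dec_induct)
  case base
  show ?case using t by (simp add: padic_ints_def)
next
  case (step m)
  have "t (Suc m) mod int p ^ n = t (Suc m) mod int p ^ m mod int p ^ n"
    using step by (simp add: mod_mod_cancel le_imp_power_dvd)
  also have "t (Suc m) mod int p ^ m = t m" using t by (simp add: padic_ints_def)
  finally show ?case using step by simp
qed

context
  fixes p :: nat
  assumes p: "prime p"
begin

definition fact_val :: "nat \<Rightarrow> nat" where
  "fact_val r = multiplicity p (fact r :: nat)"

text \<open>
  Dividing a congruence by \<open>r!\<close> loses exactly the power of \<open>p\<close> that divides \<open>r!\<close>.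
\<close>

lemma fact_cancel:
  assumes "int p ^ (n + fact_val r) dvd fact r * x"
  shows "int p ^ n dvd x"
proof -
  have "(fact r :: nat) \<noteq> 0" "\<not> is_unit p" using p by auto
  then obtain u where u: "fact r = p ^ fact_val r * u" "\<not> p dvd u"
    unfolding fact_val_def by (rule multiplicity_decompose')
  have "coprime (int p ^ n) (int u)"
    using p u(2) by (simp add: prime_imp_coprime)
  have "fact r = int p ^ fact_val r * int u"
    by (metis of_nat_fact of_nat_mult of_nat_power u(1))
  then have "int p ^ fact_val r * int p ^ n dvd int p ^ fact_val r * (int u * x)"
    using assms by (simp add: power_add mult.assoc mult.commute)
  then have "int p ^ n dvd int u * x"
    using p by (subst (asm) dvd_mult_cancel_left) (auto simp: prime_gt_0_nat)
  then show ?thesis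
    using \<open>coprime (int p ^ n) (int u)\<close> by (simp add: coprime_dvd_mult_right_iff)
qed

lemma prod_shift_cong:
  assumes "(x :: int) mod m = y mod m"
  shows "(\<Prod>i<r. x - int i) mod m = (\<Prod>i<r. y - int i) mod m"
proof (induction r)
  case (Suc r)
  have "(x - int r) mod m = (y - int r) mod m" using assms by (rule mod_diff_cong) simp
  with Suc show ?case unfolding prod.lessThan_Suc by (rule mod_mult_cong)
qed simp

context
  fixes t
  assumes t: "t \<in> padic_ints p"
begin

lemma t_nonneg: "0 \<le> t n"
  using t by (simp add: padic_ints_def)

lemma choose_cong:
  assumes "m \<ge> n + fact_val r" "m' \<ge> n + fact_val r"
  shows "int (nat (t m) choose r) mod int p ^ n = int (nat (t m') choose r) mod int p ^ n"
proof -
  have "(\<Prod>i<r. t m - int i) mod int p ^ (n + fact_val r) = (\<Prod>i<r. t m' - int i) mod int p ^ (n + fact_val r)"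
    by (rule prod_shift_cong) (simp add: padic_coherent[OF t] assms)
  then have "int p ^ (n + fact_val r) dvd fact r * (int (nat (t m) choose r) - int (nat (t m') choose r))"
    by (simp add: right_diff_distrib fact_choose_eq_prod t_nonneg mod_eq_dvd_iff)
  then show ?thesis unfolding mod_eq_dvd_iff by (rule fact_cancel)
qed

text \<open>
  Binomial coefficients are continuous in the p-adic sense: modulo \<open>p\<^sup>n\<close>, the binomial coefficient of \<open>t\<close> is
  that of any natural number sufficiently close to \<open>t\<close>.
\<close>

lemma padic_binomial_eq:
  "padic_binomial p t r = (\<lambda>n. int (nat (t (n + fact_val r)) choose r) mod int p ^ n)" (is "_ = ?b")
  unfolding padic_binomial_def
proof (rule the_equality)
  have pos: "int p > 0" using p by (simp add: prime_gt_0_nat)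
  have "?b (Suc n) mod int p ^ n = ?b n" for n
    using choose_cong[of n r "Suc n + fact_val r" "n + fact_val r"] by (simp add: mod_mod_cancel)
  then have "?b \<in> padic_ints p" using pos by (simp add: padic_ints_def)
  moreover have "(fact r * ?b n) mod int p ^ n = (\<Prod>i<r. t n - int i) mod int p ^ n" for n
  proof -
    have "(fact r * ?b n) mod int p ^ n = (\<Prod>i<r. t (n + fact_val r) - int i) mod int p ^ n"
      by (simp add: mod_mult_right_eq fact_choose_eq_prod t_nonneg)
    also have "\<dots> = (\<Prod>i<r. t n - int i) mod int p ^ n"
      by (rule prod_shift_cong) (simp add: padic_coherent[OF t])
    finally show ?thesis .
  qed
  ultimately show "?b \<in> padic_ints p \<and> (\<forall>n. (fact r * ?b n) mod int p ^ n = (\<Prod>i<r. t n - int i) mod int p ^ n)"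
    by blast
next
  fix b assume b: "b \<in> padic_ints p \<and> (\<forall>n. (fact r * b n) mod int p ^ n = (\<Prod>i<r. t n - int i) mod int p ^ n)"
  show "b = ?b"
  proof
    fix n
    let ?m = "n + fact_val r"
    have "(fact r * b ?m) mod int p ^ ?m = (fact r * int (nat (t ?m) choose r)) mod int p ^ ?m"
      using b by (simp add: fact_choose_eq_prod t_nonneg)
    then have "int p ^ ?m dvd fact r * (b ?m - int (nat (t ?m) choose r))"
      by (simp add: mod_eq_dvd_iff right_diff_distrib)
    then have "b ?m mod int p ^ n = int (nat (t ?m) choose r) mod int p ^ n"
      unfolding mod_eq_dvd_iff by (rule fact_cancel)
    then show "b n = ?b n" using padic_coherent[of b p n ?m] b by simp
  qed
qed

lemma padic_reduce_binomial:
  assumes "CHAR('f::comm_ring_1) = p" "N \<ge> Suc (fact_val r)"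
  shows "padic_reduce (padic_binomial p t r) = (of_nat (nat (t N) choose r) :: 'f)"
proof -
  have red: "(of_int (x mod int p) :: 'f) = of_int x" for x
  proof -
    have "(of_int x :: 'f) = of_int (int p * (x div int p) + x mod int p)" by simp
    also have "\<dots> = of_int (x mod int p)" unfolding of_int_add of_int_mult using assms(1) by auto
    finally show ?thesis by simp
  qed
  have "padic_reduce (padic_binomial p t r) = (of_int (int (nat (t (1 + fact_val r)) choose r) mod int p) :: 'f)"
    by (simp add: padic_reduce_def padic_binomial_eq)
  also have "\<dots> = of_int (int (nat (t N) choose r) mod int p)"
    using choose_cong[of 1 r "1 + fact_val r" N] assms(2) by simp
  finally show ?thesis by (simp add: red)
qed

end

end

lemma padic_reduce_binomial_zero:
  assumes "prime p" "t \<in> padic_ints p" "CHAR('f::comm_ring_1) = p"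
  shows "padic_reduce (padic_binomial p t 0) = (1 :: 'f)"
proof -
  have "Suc (fact_val p 0) \<le> Suc (fact_val p 0)" by (rule order_refl)
  from padic_reduce_binomial[OF assms this] show ?thesis by (simp only: binomial_n_0 of_nat_1)
qed

lemma padic_reduce_binomial_one:
  assumes "prime p" "t \<in> padic_ints p" "CHAR('f::comm_ring_1) = p"
  shows "padic_reduce (padic_binomial p t 1) = (padic_reduce t :: 'f)"
proof -
  have "fact_val p 1 = 0" unfolding fact_val_def[OF assms(1)] fact_1 by simp
  moreover have "t 1 mod int p ^ 1 = t 1" by (rule padic_coherent[OF assms(2) order_refl])
  ultimately have "padic_binomial p t 1 1 = t 1"
    using t_nonneg[OF assms(1,2), of 1]
    by (simp only: padic_binomial_eq[OF assms(1,2)] add_0_right choose_one int_nat_eq if_True)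
  then show ?thesis by (simp add: padic_reduce_def)
qed

lemma mps_subst_choose:
  fixes f :: "('v, 'a::comm_ring_1) mps"
  assumes f: "mps_nth f {#} = 0"
  shows "mps_subst (\<lambda>r. of_nat (T choose r)) f = (1 + f) ^ T"
proof (rule mps_agree_all_imp_eq)
  fix n
  have "mps_agree n (mps_subst (\<lambda>r. of_nat (T choose r)) f) (\<Sum>r\<le>n + T. mps_const (of_nat (T choose r)) * f ^ r)"
    by (intro mps_agree_subst_le f) simp
  also have "(\<Sum>r\<le>n + T. mps_const (of_nat (T choose r)) * f ^ r) = (\<Sum>r\<le>T. of_nat (T choose r) * f ^ r)"
    unfolding mps_const_of_nat by (rule sum.mono_neutral_right) (auto simp: binomial_eq_0)
  also have "\<dots> = (1 + f) ^ T" unfolding add.commute[of 1 f] binomial_ring by simp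
  finally show "mps_agree n (mps_subst (\<lambda>r. of_nat (T choose r)) f) ((1 + f) ^ T)" .
qed

text \<open>
  Up to a given degree, a p-adic power is an ordinary power with an exponent that does not depend on
  the series. So p-adic powers inherit the rules for ordinary ones.
\<close>

lemma mps_padic_power_agree:
  assumes "prime p" "t \<in> padic_ints p" "CHAR('f::comm_ring_1) = p"
  shows "\<exists>T. \<forall>f :: ('v, 'f) mps. mps_nth f {#} = 0 \<longrightarrow> mps_agree n (mps_padic_power p t f) ((1 + f) ^ T)"
proof -
  define N where "N = Suc (Max (fact_val p ` {..n}))"
  have N: "N \<ge> Suc (fact_val p r)" if "r \<le> n" for r
    unfolding N_def using that by (auto intro!: Max_ge)
  have "mps_agree n (mps_padic_power p t f) ((1 + f) ^ nat (t N))" if "mps_nth f {#} = 0" for f :: "('v, 'f) mps"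
    unfolding mps_subst_choose[OF that, symmetric] mps_padic_power_def
    by (rule mps_agree_subst_cong) (auto simp: padic_reduce_binomial[OF assms N])
  then show ?thesis by blast
qed

lemma mps_padic_power_mult:
  fixes f g :: "('v, 'f::comm_ring_1) mps"
  assumes "prime p" "t \<in> padic_ints p" "CHAR('f) = p" and f: "mps_nth f {#} = 0" and g: "mps_nth g {#} = 0"
  shows "mps_padic_power p t f * mps_padic_power p t g = mps_padic_power p t (f + g + f * g)"
proof (rule mps_agree_all_imp_eq)
  fix n
  obtain T where T: "\<And>f :: ('v, 'f) mps. mps_nth f {#} = 0 \<Longrightarrow> mps_agree n (mps_padic_power p t f) ((1 + f) ^ T)"
    using mps_padic_power_agree[OF assms(1-3)] by blast
  have "mps_agree n (mps_padic_power p t f * mps_padic_power p t g) ((1 + f) ^ T * (1 + g) ^ T)"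
    by (intro mps_agree_mult T f g)
  also have "(1 + f) ^ T * (1 + g) ^ T = (1 + (f + g + f * g)) ^ T"
    by (simp add: algebra_simps flip: power_mult_distrib)
  also have "mps_agree n \<dots> (mps_padic_power p t (f + g + f * g))"
    by (rule mps_agree_sym[OF T]) (simp add: f g)
  finally show "mps_agree n (mps_padic_power p t f * mps_padic_power p t g) (mps_padic_power p t (f + g + f * g))" .
qed


section \<open>Characters of the multiplicative formal group\<close>

text \<open>
  The power series \<open>G(x) = \<Sum>r. a r x\<^sup>r\<close> with \<open>G(0) = 1\<close> and \<open>G(x) G(y) = G(x + y + x y)\<close>, in terms of coefficients.
  The integers are the coefficients of \<open>x\<^sup>i y\<^sup>j\<close> in \<open>(x + y + x y)\<^sup>s\<close>.
\<close>

definition grouplike :: "(nat \<Rightarrow> 'a::comm_ring_1) \<Rightarrow> bool" where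
  "grouplike a \<longleftrightarrow> a 0 = 1 \<and>
     (\<forall>i j. a i * a j = (\<Sum>s\<le>i + j. a s * of_nat ((s choose j) * (j choose (i + j - s)))))"

lemma mps_nth_var_powers:
  assumes "x \<noteq> y"
  shows "mps_nth (mps_var x ^ k * mps_var y ^ l) (replicate_mset i x + replicate_mset j y)
       = (if k = i \<and> l = j then 1 else (0 :: 'a::comm_ring_1))"
proof -
  have pow: "mps_var v ^ k = mps_monom mps_var (replicate_mset k v)" for v :: 'b and k
    by (induction k) simp_all
  have "replicate_mset i x + replicate_mset j y = replicate_mset k x + replicate_mset l y \<longleftrightarrow> k = i \<and> l = j"
    using assms by (auto simp: multiset_eq_iff split: if_splits)
  then show ?thesis
    unfolding pow mps_monom_simps(3)[symmetric] mps_monom_var by auto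
qed

lemma mps_nth_star_power:
  assumes "x \<noteq> y" "s \<le> i + j"
  shows "mps_nth ((mps_var x + mps_var y + mps_var x * mps_var y) ^ s) (replicate_mset i x + replicate_mset j y)
       = (of_nat ((s choose j) * (j choose (i + j - s))) :: 'a::comm_ring_1)"
proof -
  let ?X = "mps_var x :: ('b, 'a) mps" and ?Y = "mps_var y :: ('b, 'a) mps" and ?N = "replicate_mset i x + replicate_mset j y"
  have "(?X + ?Y + ?X * ?Y) ^ s = (?Y * (?X + 1) + ?X) ^ s" by (simp add: algebra_simps)
  also have "\<dots> = (\<Sum>k\<le>s. of_nat (s choose k) * (?Y * (?X + 1)) ^ k * ?X ^ (s - k))"
    by (rule binomial_ring)
  also have "\<dots> = (\<Sum>k\<le>s. \<Sum>l\<le>k. mps_const (of_nat ((s choose k) * (k choose l))) * (?X ^ (l + (s - k)) * ?Y ^ k))"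
  proof (rule sum.cong[OF refl])
    fix k
    have "(?X + 1) ^ k = (\<Sum>l\<le>k. of_nat (k choose l) * ?X ^ l)" by (simp add: binomial_ring[of ?X 1])
    then show "of_nat (s choose k) * (?Y * (?X + 1)) ^ k * ?X ^ (s - k)
        = (\<Sum>l\<le>k. mps_const (of_nat ((s choose k) * (k choose l))) * (?X ^ (l + (s - k)) * ?Y ^ k))"
      unfolding power_mult_distrib mps_const_of_nat
      by (simp add: sum_distrib_left sum_distrib_right power_add ac_simps)
  qed
  finally have "mps_nth ((?X + ?Y + ?X * ?Y) ^ s) ?N
      = (\<Sum>k\<le>s. \<Sum>l\<le>k. of_nat ((s choose k) * (k choose l)) * (if l + (s - k) = i \<and> k = j then 1 else 0))"
    by (simp add: mps_nth_sum mps_nth_var_powers[OF assms(1)])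
  also have "\<dots> = (\<Sum>k\<le>s. if k = j then of_nat ((s choose j) * (j choose (i + j - s))) else 0)"
  proof (rule sum.cong[OF refl])
    fix k assume k: "k \<in> {..s}"
    show "(\<Sum>l\<le>k. of_nat ((s choose k) * (k choose l)) * (if l + (s - k) = i \<and> k = j then 1 else 0))
        = (if k = j then of_nat ((s choose j) * (j choose (i + j - s))) else (0 :: 'a))"
    proof (cases "k = j")
      case True
      then have "l + (s - k) = i \<longleftrightarrow> l = i + j - s" for l using k assms(2) by auto
      then have "(\<Sum>l\<le>k. of_nat ((s choose k) * (k choose l)) * (if l + (s - k) = i \<and> k = j then 1 else 0))
          = (\<Sum>l\<le>j. if l = i + j - s then of_nat ((s choose j) * (j choose l)) else (0 :: 'a))"
        using True by (intro sum.cong) auto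
      also have "\<dots> = of_nat ((s choose j) * (j choose (i + j - s)))"
        by (simp add: binomial_eq_0)
      finally show ?thesis using True by simp
    qed simp
  qed
  also have "\<dots> = of_nat ((s choose j) * (j choose (i + j - s)))"
    by (simp add: binomial_eq_0)
  finally show ?thesis .
qed

lemma grouplikeI:
  fixes a :: "nat \<Rightarrow> 'a::comm_ring_1"
  assumes "a 0 = 1"
    and mult: "mps_subst a (mps_var False) * mps_subst a (mps_var True)
      = mps_subst a (mps_var False + mps_var True + mps_var False * mps_var True :: (bool, 'a) mps)"
  shows "grouplike a"
  unfolding grouplike_def
proof (intro conjI allI)
  fix i j
  let ?X = "mps_var False :: (bool, 'a) mps" and ?Y = "mps_var True :: (bool, 'a) mps"
    and ?N = "replicate_mset i False + replicate_mset j True"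
  have "mps_agree (i + j) (mps_subst a ?X * mps_subst a ?Y)
      ((\<Sum>r\<le>i + j. mps_const (a r) * ?X ^ r) * (\<Sum>q\<le>i + j. mps_const (a q) * ?Y ^ q))"
    by (intro mps_agree_mult mps_agree_subst) simp_all
  also have "\<dots> = (\<Sum>r\<le>i + j. \<Sum>q\<le>i + j. mps_const (a r * a q) * (?X ^ r * ?Y ^ q))"
    by (simp add: sum_product mps_const_simps ac_simps)
  finally have "mps_nth (mps_subst a ?X * mps_subst a ?Y) ?N
      = (\<Sum>r\<le>i + j. \<Sum>q\<le>i + j. a r * a q * (if r = i \<and> q = j then 1 else 0))"
    by (simp add: mps_agree_def mps_nth_sum mps_nth_var_powers)
  also have "\<dots> = (\<Sum>r\<le>i + j. if r = i then a i * a j else 0)"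
  proof (rule sum.cong[OF refl])
    fix r
    have "(\<Sum>q\<le>i + j. a r * a q * (if r = i \<and> q = j then 1 else 0))
        = (\<Sum>q\<le>i + j. if q = j then (if r = i then a i * a j else 0) else 0)"
      by (intro sum.cong) auto
    then show "(\<Sum>q\<le>i + j. a r * a q * (if r = i \<and> q = j then 1 else 0)) = (if r = i then a i * a j else 0)"
      by simp
  qed
  also have "\<dots> = a i * a j" by simp
  finally have "a i * a j = mps_nth (mps_subst a (?X + ?Y + ?X * ?Y)) ?N" by (simp add: mult)
  also have "\<dots> = (\<Sum>s\<le>i + j. a s * mps_nth ((?X + ?Y + ?X * ?Y) ^ s) ?N)"
    by (rule mps_nth_subst) simp_all
  also have "\<dots> = (\<Sum>s\<le>i + j. a s * of_nat ((s choose j) * (j choose (i + j - s))))"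
    by (intro sum.cong refl arg_cong2[where f = "(*)"] mps_nth_star_power) auto
  finally show "a i * a j = \<dots>" .
qed (rule assms)

text \<open>
  One step of Lucas's theorem, from \<open>(1 + X)\<^bsup>pm+r\<^esup> = (1 + X\<^sup>p)\<^sup>m (1 + X)\<^sup>r\<close> in characteristic \<open>p\<close>.
\<close>

lemma of_nat_choose_lucas:
  assumes p: "prime p" "CHAR('a::comm_ring_1) = p" and "r < p" "q < p"
  shows "(of_nat ((p * m + r) choose (p * n + q)) :: 'a) = of_nat ((m choose n) * (r choose q))"
proof -
  let ?x = "[:1, 1:] :: 'a poly"
  have x: "?x = monom 1 1 + 1" by (simp add: monom_altdef one_pCons)
  have pow: "?x ^ k = (\<Sum>l\<le>k. monom (of_nat (k choose l)) l)" for k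
    unfolding x binomial_ring by (simp add: monom_power of_nat_monom mult_monom)
  have "?x ^ p = monom 1 p + 1"
  proof -
    have "(monom 1 1 + 1 :: 'a poly) ^ p = monom 1 1 ^ p + 1 ^ p"
      by (rule freshmans_dream) (simp_all add: p)
    then show ?thesis unfolding x by (simp only: monom_power power_one mult_1_left)
  qed
  then have "?x ^ (p * m) = (monom 1 p + 1) ^ m" by (simp add: power_mult)
  also have "\<dots> = (\<Sum>k\<le>m. monom (of_nat (m choose k)) (p * k))"
    unfolding binomial_ring by (simp add: monom_power of_nat_monom mult_monom)
  finally have "?x ^ (p * m + r) = (\<Sum>k\<le>m. \<Sum>l\<le>r. monom (of_nat ((m choose k) * (r choose l))) (p * k + l))"
    unfolding power_add by (subst (2) pow) (simp add: sum_product mult_monom)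
  then have "coeff (?x ^ (p * m + r)) (p * n + q)
      = (\<Sum>k\<le>m. \<Sum>l\<le>r. if p * k + l = p * n + q then of_nat ((m choose k) * (r choose l)) else 0)"
    by (simp add: coeff_sum cong: if_cong)
  also have "\<dots> = (\<Sum>k\<le>m. \<Sum>l\<le>r. if l = q then (if k = n then of_nat ((m choose n) * (r choose q)) else 0) else 0)"
  proof (intro sum.cong refl)
    fix k l assume "l \<in> {..r}"
    then have "l < p" using assms(3) by simp
    have "p * k + l = p * n + q \<longleftrightarrow> k = n \<and> l = q"
    proof
      assume *: "p * k + l = p * n + q"
      have "(p * k + l) div p = k" "(p * n + q) div p = n" using \<open>l < p\<close> assms(4) by simp_all
      with * show "k = n \<and> l = q" by simp
    qed simp
    then show "(if p * k + l = p * n + q then of_nat ((m choose k) * (r choose l)) else 0)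
        = (if l = q then (if k = n then of_nat ((m choose n) * (r choose q)) else 0) else (0 :: 'a))"
      by auto
  qed
  also have "\<dots> = of_nat ((m choose n) * (r choose q))"
    by (cases "q \<le> r") (simp_all add: not_le binomial_eq_0)
  finally have "coeff (?x ^ (p * m + r)) (p * n + q) = of_nat ((m choose n) * (r choose q))" .
  moreover have "coeff (?x ^ (p * m + r)) (p * n + q) = of_nat ((p * m + r) choose (p * n + q))"
    unfolding pow by (simp add: coeff_sum not_le binomial_eq_0)
  ultimately show ?thesis by simp
qed

text \<open>
  The equation at \<open>x\<^sup>n y\<close>; it says \<open>(1 + x) G'(x) = a\<^sub>1 G(x)\<close>.
\<close>

lemma grouplike_rec:
  assumes "grouplike a"
  shows "of_nat (Suc n) * a (Suc n) = (a 1 - of_nat n) * a n"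
proof -
  have "a n * a 1 = (\<Sum>s\<le>n + 1. a s * of_nat ((s choose 1) * (1 choose (n + 1 - s))))"
    using assms unfolding grouplike_def by blast
  also have "\<dots> = (\<Sum>s\<in>{n, Suc n}. a s * of_nat ((s choose 1) * (1 choose (n + 1 - s))))"
  proof (rule sum.mono_neutral_right)
    show "\<forall>s\<in>{..n + 1} - {n, Suc n}. a s * of_nat ((s choose 1) * (1 choose (n + 1 - s))) = 0"
    proof
      fix s assume "s \<in> {..n + 1} - {n, Suc n}"
      then have "1 choose (n + 1 - s) = 0" by (intro binomial_eq_0) auto
      then show "a s * of_nat ((s choose 1) * (1 choose (n + 1 - s))) = 0" by (simp only: mult_zero_right of_nat_0)
    qed
  qed auto
  also have "\<dots> = a n * of_nat n + a (Suc n) * of_nat (Suc n)" by simp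
  finally show ?thesis by (simp add: algebra_simps)
qed

text \<open>
  The recursion up to \<open>n = p\<close> yields \<open>0 = p! a\<^sub>p = \<Prod>n<p. (a\<^sub>1 - n)\<close>.
\<close>

lemma grouplike_digit:
  fixes a :: "nat \<Rightarrow> 'a::field"
  assumes p: "prime p" "CHAR('a) = p" and a: "grouplike a"
  shows "\<exists>d<p. a 1 = of_nat d"
proof (rule ccontr)
  assume no: "\<not> ?thesis"
  have ne: "a n \<noteq> 0" if "n < p" for n
    using that
  proof (induction n)
    case 0
    show ?case using a by (simp add: grouplike_def)
  next
    case (Suc n)
    then have "of_nat (Suc n) * a (Suc n) \<noteq> 0"
      unfolding grouplike_rec[OF a] using no by auto
    then show ?case by auto
  qed
  obtain n where n: "p = Suc n" using p(1) by (cases p) auto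
  have "(of_nat (Suc n) :: 'a) = 0" using p(2) n by (metis of_nat_CHAR)
  then have "(a 1 - of_nat n) * a n = 0" using grouplike_rec[OF a, of n] by (simp del: of_nat_Suc)
  then show False using ne[of n] no n by auto
qed

text \<open>
  The recursion within a run \<open>pm, \<dots>, pm + p - 1\<close>, where the denominators \<open>1, \<dots>, p - 1\<close> are invertible: this
  is \<open>G(x) = (1 + x)\<^sup>d H(x\<^sup>p)\<close> with \<open>H(x) = \<Sum>m. a (p m) x\<^sup>m\<close>.
\<close>

lemma grouplike_split:
  fixes a :: "nat \<Rightarrow> 'a::field"
  assumes p: "prime p" "CHAR('a) = p" and a: "grouplike a" and d: "a 1 = of_nat d" and "r < p"
  shows "a (p * m + r) = a (p * m) * of_nat (d choose r)"
  using assms(5)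
proof (induction r)
  case (Suc r)
  have p0: "(of_nat p :: 'a) = 0" using p(2) by (metis of_nat_CHAR)
  have "\<not> p dvd Suc r" using Suc.prems by (auto dest: dvd_imp_le)
  then have ne: "(of_nat (Suc r) :: 'a) \<noteq> 0" using p(2) by (simp only: of_nat_eq_0_iff_char_dvd not_False_eq_True)
  have "(of_nat d - of_nat r) * (of_nat (d choose r) :: 'a) = of_nat (Suc r) * of_nat (d choose Suc r)"
  proof (cases "r \<le> d")
    case True
    have "(d - r) * (d choose r) = Suc r * (d choose Suc r)"
      by (metis binomial_absorb_comp binomial_absorption mult.commute)
    then show ?thesis using True by (metis of_nat_diff of_nat_mult)
  qed (simp add: binomial_eq_0)
  moreover have "of_nat (Suc r) * a (p * m + Suc r) = (of_nat d - of_nat r) * a (p * m + r)"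
    using grouplike_rec[OF a, of "p * m + r", unfolded d] by (simp add: p0)
  ultimately have "of_nat (Suc r) * a (p * m + Suc r) = of_nat (Suc r) * (a (p * m) * of_nat (d choose Suc r))"
    using Suc by (simp add: ac_simps)
  then show ?case using ne by (simp only: mult_cancel_left simp_thms)
qed simp

text \<open>
  The series \<open>H\<close> satisfies the same functional equation. For \<open>i\<close> and \<open>j\<close> divisible by \<open>p\<close>, the constants in
  \<open>grouplike\<close> vanish modulo \<open>p\<close> unless \<open>p\<close> divides \<open>s\<close>, and then Lucas's theorem divides all indices by \<open>p\<close>.
\<close>

lemma grouplike_dilate:
  fixes a :: "nat \<Rightarrow> 'a::field"
  assumes p: "prime p" "CHAR('a) = p" and a: "grouplike a"
  shows "grouplike (\<lambda>m. a (p * m))"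
  unfolding grouplike_def
proof (intro conjI allI)
  show "a (p * 0) = 1" using a by (simp add: grouplike_def)
  fix i j
  have p0: "p > 0" using p(1) by (rule prime_gt_0_nat)
  let ?f = "\<lambda>s. a s * of_nat ((s choose (p * j)) * ((p * j) choose (p * i + p * j - s)))"
  have luc: "(of_nat ((p * x) choose (p * y)) :: 'a) = of_nat (x choose y)" for x y
    using of_nat_choose_lucas[OF p p0 p0, of x y] by simp
  have zero: "(of_nat ((p * x) choose k) :: 'a) = 0" if "\<not> p dvd k" for x k
  proof -
    have "k mod p > 0" "k mod p < p" using that p0 by (auto simp: dvd_eq_mod_eq_0)
    then show ?thesis
      using of_nat_choose_lucas[OF p p0, of "k mod p" x "k div p"] by (simp add: binomial_eq_0)
  qed
  have "a (p * i) * a (p * j) = (\<Sum>s\<le>p * i + p * j. ?f s)"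
    using a unfolding grouplike_def by blast
  also have "\<dots> = (\<Sum>s\<in>(*) p ` {..i + j}. ?f s)"
  proof (rule sum.mono_neutral_right)
    show "(*) p ` {..i + j} \<subseteq> {..p * i + p * j}"
      by (auto simp flip: distrib_left)
    show "\<forall>s\<in>{..p * i + p * j} - (*) p ` {..i + j}. ?f s = 0"
    proof
      fix s assume s: "s \<in> {..p * i + p * j} - (*) p ` {..i + j}"
      have "\<not> p dvd p * i + p * j - s"
      proof
        assume "p dvd p * i + p * j - s"
        then have "p dvd s" using s by (metis DiffE atMost_iff dvd_diffD1 dvd_triv_left dvd_add)
        then obtain k where "s = p * k" by blast
        with s p0 show False by (auto simp flip: distrib_left)
      qed
      then show "?f s = 0" unfolding of_nat_mult by (simp add: zero)
    qed
  qed simp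
  also have "\<dots> = (\<Sum>s\<le>i + j. ?f (p * s))"
    using p0 by (subst sum.reindex) (auto simp: inj_on_def)
  also have "\<dots> = (\<Sum>s\<le>i + j. a (p * s) * of_nat ((s choose j) * (j choose (i + j - s))))"
  proof (rule sum.cong[OF refl])
    fix s
    have "p * i + p * j - p * s = p * (i + j - s)" by (simp add: algebra_simps)
    then show "?f (p * s) = a (p * s) * of_nat ((s choose j) * (j choose (i + j - s)))"
      by (simp add: luc)
  qed
  finally show "a (p * i) * a (p * j) = \<dots>" .
qed

text \<open>
  Iterating \<open>G(x) = (1 + x)\<^sup>d H(x\<^sup>p)\<close> produces the base \<open>p\<close> digits of the exponent.
\<close>

theorem grouplike_padic:
  fixes a :: "nat \<Rightarrow> 'a::field"
  assumes p: "prime p" "CHAR('a) = p" and a: "grouplike a"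
  shows "\<exists>t \<in> padic_ints p. \<forall>r. a r = padic_reduce (padic_binomial p t r)"
proof -
  \<comment> \<open>\<open>A k\<close> is the sequence after splitting off \<open>k\<close> digits; \<open>S j k\<close> is the number with digits \<open>d j, \<dots>, d (j + k - 1)\<close>.\<close>
  define A where "A k m = a (p ^ k * m)" for k m
  have A_Suc: "A (Suc k) = (\<lambda>m. A k (p * m))" for k by (simp add: A_def fun_eq_iff ac_simps)
  have A: "grouplike (A k)" for k
  proof (induction k)
    case 0
    have "A 0 = a" by (simp add: A_def fun_eq_iff)
    with a show ?case by simp
  qed (simp add: A_Suc grouplike_dilate[OF p])
  have "\<forall>k. \<exists>d. d < p \<and> A k 1 = of_nat d" using grouplike_digit[OF p A] by blast
  then obtain d where d: "\<And>k. d k < p" "\<And>k. A k 1 = of_nat (d k)" by metis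
  define S where "S j k = (\<Sum>i<k. d (j + i) * p ^ i)" for j k
  have S_less: "S j k < p ^ k" for j k
  proof (induction k)
    case (Suc k)
    have "S j (Suc k) = S j k + d (j + k) * p ^ k" by (simp add: S_def)
    also have "\<dots> < p ^ k + d (j + k) * p ^ k" using Suc by simp
    also have "\<dots> = Suc (d (j + k)) * p ^ k" by simp
    also have "\<dots> \<le> p * p ^ k" using d(1)[of "j + k"] by (intro mult_right_mono) auto
    finally show ?case by simp
  qed (simp add: S_def)
  have S_Suc: "S j (Suc k) = p * S (Suc j) k + d j" for j k
    unfolding S_def by (subst sum.lessThan_Suc_shift) (simp add: sum_distrib_left ac_simps)
  have A_choose: "A j n = of_nat (S j k choose n)" if "n < p ^ k" for j k n
    using that
  proof (induction k arbitrary: j n)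
    case 0
    then show ?case using A[of j] by (simp add: grouplike_def)
  next
    case (Suc k)
    have p0: "p > 0" using p(1) by (rule prime_gt_0_nat)
    have n: "n = p * (n div p) + n mod p" by simp
    have "n div p < p ^ k" using Suc.prems p0 by (simp add: div_less_iff_less_mult mult.commute)
    then have IH: "A (Suc j) (n div p) = of_nat (S (Suc j) k choose (n div p))" by (rule Suc.IH)
    have "A j n = A j (p * (n div p)) * of_nat (d j choose (n mod p))"
      using grouplike_split[OF p A d(2), of "n mod p" j "n div p"] p0 by simp
    also have "A j (p * (n div p)) = of_nat (S (Suc j) k choose (n div p))" using IH by (simp add: A_Suc)
    also have "of_nat (S (Suc j) k choose (n div p)) * of_nat (d j choose (n mod p))
        = (of_nat ((p * S (Suc j) k + d j) choose (p * (n div p) + n mod p)) :: 'a)"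
      using of_nat_choose_lucas[OF p d(1)[of j], of "n mod p" "S (Suc j) k" "n div p"] p0 by simp
    finally show ?case by (simp add: S_Suc)
  qed
  define t where "t k = int (S 0 k)" for k
  have t: "t \<in> padic_ints p"
  proof -
    have "t (Suc k) mod int p ^ k = t k" for k
    proof -
      have "S 0 (Suc k) mod p ^ k = S 0 k" using S_less[of 0 k] by (simp add: S_def)
      then show ?thesis unfolding t_def by (metis of_nat_mod of_nat_power)
    qed
    moreover have "t k < int p ^ k" for k using S_less[of 0 k] by (simp add: t_def flip: of_nat_power)
    ultimately show ?thesis by (simp add: padic_ints_def t_def)
  qed
  have "a r = padic_reduce (padic_binomial p t r)" for r
  proof -
    define N where "N = r + Suc (fact_val p r)"
    have "r < 2 ^ r" by simp
    also have "(2 :: nat) ^ r \<le> p ^ r" using prime_ge_2_nat[OF p(1)] by (rule power_mono) simp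
    also have "\<dots> \<le> p ^ N" using prime_gt_0_nat[OF p(1)] by (intro power_increasing) (auto simp: N_def)
    finally have "A 0 r = of_nat (S 0 N choose r)" by (rule A_choose)
    then show ?thesis
      using padic_reduce_binomial[OF p(1) t p(2), of r N] by (simp add: A_def t_def N_def)
  qed
  with t show ?thesis by blast
qed

section \<open>Evaluations are multiplicative\<close>

lemma central_char_class_mult:
  assumes "C \<in> (blocks :: ('g::{group_add, finite} \<Rightarrow>\<^sub>0 'f::alg_closed_field) set set)"
  shows "central_char C c * central_char C d = (\<Sum>k\<in>UNIV. of_nat (class_mult c d k) * central_char C k)"
  using assms by (auto simp: blocks_eq central_char_eq block_char_class_mult)

lemma mps_padic_power_empty:
  assumes "prime p" "t \<in> padic_ints p" "CHAR('f::comm_ring_1) = p"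
  shows "mps_nth (mps_padic_power p t f) {#} = (1 :: 'f)"
  by (simp add: mps_padic_power_def padic_reduce_binomial_zero[OF assms])

text \<open>
  A central character is a ring homomorphism on the class algebra, so \<open>1 + \<Sum>c. \<omega>\<^sub>c x\<^sub>c\<close> turns the formal
  group law into a product, which p-adic powers respect.
\<close>

lemma multiplicative_eval_series:
  fixes t :: "('g::{group_add, finite} \<Rightarrow>\<^sub>0 'f::alg_closed_field) set \<Rightarrow> nat \<Rightarrow> int"
  assumes p: "prime p" "CHAR('f) = p" and t: "t \<in> blocks \<rightarrow> padic_ints p"
  shows "multiplicative (eval_series p t)"
proof -
  let ?K = "\<lambda>C c. mps_const (central_char C c) :: ('g conj_class + 'g conj_class, 'f) mps"
  have K: "?K C c * ?K C d = (\<Sum>e\<in>UNIV. of_nat (class_mult c d e) * ?K C e)" if "C \<in> blocks" for C c d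
    unfolding mps_const_simps(4)[symmetric] central_char_class_mult[OF that]
    by (simp add: mps_const_simps mps_const_of_nat)
  have comp: "mps_comp (eval_series p t) s = (\<Prod>C\<in>blocks. mps_padic_power p (t C) (\<Sum>c\<in>UNIV. ?K C c * s c))"
    if s: "\<And>c. mps_nth (s c) {#} = 0" for s
    unfolding eval_series_def mps_comp_prod[OF s] mps_padic_power_def
    by (subst mps_comp_subst[OF s]) (simp_all add: mps_nth_sum mps_comp_sum mps_comp_mult[OF s] mps_comp_var s)
  let ?x = "\<lambda>c. mps_var (Inl c)" and ?y = "\<lambda>c. mps_var (Inr c)"
  have x: "mps_nth (?x c) {#} = (0 :: 'f)" and y: "mps_nth (?y c) {#} = (0 :: 'f)" for c :: "'g conj_class" by simp_all
  have "(\<Prod>C\<in>blocks. mps_padic_power p (t C) (\<Sum>c\<in>UNIV. ?K C c * ?x c)) *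
        (\<Prod>C\<in>blocks. mps_padic_power p (t C) (\<Sum>c\<in>UNIV. ?K C c * ?y c))
      = (\<Prod>C\<in>blocks. mps_padic_power p (t C) (\<Sum>c\<in>UNIV. ?K C c * star ?x ?y c))"
    unfolding prod.distrib[symmetric]
  proof (rule prod.cong[OF refl])
    fix C :: "('g \<Rightarrow>\<^sub>0 'f) set" assume C: "C \<in> blocks"
    then have tC: "t C \<in> padic_ints p" using t by blast
    show "mps_padic_power p (t C) (\<Sum>c\<in>UNIV. ?K C c * ?x c) * mps_padic_power p (t C) (\<Sum>c\<in>UNIV. ?K C c * ?y c)
        = mps_padic_power p (t C) (\<Sum>c\<in>UNIV. ?K C c * star ?x ?y c)"
      unfolding star_prod[OF K[OF C], symmetric]
      by (rule mps_padic_power_mult[OF p(1) tC p(2)]) (simp_all add: mps_nth_sum)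
  qed
  then show ?thesis
    unfolding multiplicative_def comp[OF x] comp[OF y] comp[OF star_empty[OF x y]] .
qed

lemma eval_series_empty:
  fixes t :: "('g::{group_add, finite} \<Rightarrow>\<^sub>0 'f::alg_closed_field) set \<Rightarrow> nat \<Rightarrow> int"
  assumes p: "prime p" "CHAR('f) = p" and t: "t \<in> blocks \<rightarrow> padic_ints p"
  shows "mps_nth (eval_series p t) {#} = 1"
  unfolding eval_series_def mps_nth_prod_empty
  by (rule prod.neutral) (use t mps_padic_power_empty[OF p(1) _ p(2)] in auto)

lemma mps_nth_mult_single:
  "mps_nth (f * g) {#c#} = mps_nth f {#} * mps_nth g {#c#} + mps_nth f {#c#} * mps_nth (g :: ('v, 'a::comm_ring_1) mps) {#}"
proof -
  have "{A. A \<subseteq># {#c#}} = {{#}, {#c#}}"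
    by (auto simp: subset_mset.le_less dest: mset_subset_size)
  then show ?thesis by (simp add: mps_nth_mult)
qed

lemma mps_nth_prod_single:
  assumes "finite S" "\<And>i. i \<in> S \<Longrightarrow> mps_nth (f i) {#} = (1 :: 'a::comm_ring_1)"
  shows "mps_nth (prod f S) {#c#} = (\<Sum>i\<in>S. mps_nth (f i) {#c#})"
  using assms by (induction S rule: finite_induct) (auto simp: mps_nth_mult_single mps_nth_prod_empty)

lemma mps_nth_subst_single: "mps_nth (mps_subst a f) {#c#} = a 1 * mps_nth f {#c#}"
  by (simp add: mps_subst_def)

lemma finite_blocks: "finite (blocks :: ('g::{group_add, finite} \<Rightarrow>\<^sub>0 'f::field) set set)"
  unfolding blocks_eq by (rule finite_imageI[OF finite_primitive_idems])

lemma mps_nth_generic_single: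
  "mps_nth (\<Sum>c\<in>UNIV. mps_const (k c) * mps_var c) {#d::'v::finite#} = (k d :: 'a::comm_ring_1)"
proof -
  have "mps_nth (\<Sum>c\<in>UNIV. mps_const (k c) * mps_var c) {#d#} = (\<Sum>c\<in>UNIV. if c = d then k c else 0)"
    unfolding mps_nth_sum mps_nth_const_mult by (rule sum.cong) auto
  then show ?thesis by simp
qed

lemma eval_series_single:
  fixes t :: "('g::{group_add, finite} \<Rightarrow>\<^sub>0 'f::alg_closed_field) set \<Rightarrow> nat \<Rightarrow> int"
  assumes p: "prime p" "CHAR('f) = p" and t: "t \<in> blocks \<rightarrow> padic_ints p"
  shows "mps_nth (eval_series p t) {#c#} = (\<Sum>C\<in>blocks. central_char C c * padic_reduce (t C))"
proof -
  have tC: "t C \<in> padic_ints p" if "C \<in> blocks" for C using that t by blast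
  have "mps_nth (eval_series p t) {#c#} = (\<Sum>C\<in>blocks. mps_nth (mps_padic_power p (t C)
      (\<Sum>c\<in>UNIV. mps_const (central_char C c) * mps_var c)) {#c#})"
    unfolding eval_series_def
    by (rule mps_nth_prod_single[OF finite_blocks]) (rule mps_padic_power_empty[OF p(1) tC p(2)])
  also have "\<dots> = (\<Sum>C\<in>blocks. central_char C c * padic_reduce (t C))"
    unfolding mps_padic_power_def mps_nth_subst_single mps_nth_generic_single
    by (rule sum.cong) (simp_all only: padic_reduce_binomial_one[OF p(1) tC p(2)] mult.commute)
  finally show ?thesis .
qed

lemma B_coeff_single: "B_coeff {#c#} = uea_gen (class_elem c)"
  unfolding B_coeff_def mps_exp_def mps_ln1p_def
  by (simp add: mps_nth_subst_single mps_nth_generic_single scaleQ_one del: One_nat_def)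


section \<open>The Frobenius map on power series\<close>

lemma CHAR_mps: "CHAR(('v, 'a::comm_ring_1) mps) = CHAR('a)"
proof (rule CHAR_eqI)
  show "of_nat CHAR('a) = (0 :: ('v, 'a) mps)"
    by (simp flip: mps_const_of_nat add: mps_const_simps)
  show "CHAR('a) dvd n" if "of_nat n = (0 :: ('v, 'a) mps)" for n
    using that by (metis mps_nth_of_nat_empty mps_nth_simps(1) of_nat_eq_0_iff_char_dvd)
qed

lemma of_nat_centre: "of_nat n = centre_scalar (of_nat n)"
  by (induction n) simp_all

lemma CHAR_group_centre: "CHAR(('g::group_add, 'a::comm_ring_1) group_centre) = CHAR('a)"
proof (rule CHAR_eqI)
  show "of_nat CHAR('a) = (0 :: ('g, 'a) group_centre)" by (simp add: of_nat_centre)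
  show "CHAR('a) dvd n" if "of_nat n = (0 :: ('g, 'a) group_centre)" for n
  proof -
    have "Poly_Mapping.single (0::'g) (of_nat n :: 'a) = 0"
      using that by (metis centre_scalar.rep_eq of_nat_centre zero_group_centre.rep_eq)
    then have "(of_nat n :: 'a) = 0" by (metis lookup_single_eq lookup_zero)
    then show ?thesis by (simp add: of_nat_eq_0_iff_char_dvd)
  qed
qed

text \<open>
  The \<open>p\<close>-th power of a series raises coefficients to the \<open>p\<close>-th power and dilates exponents by \<open>p\<close>.
  Over a field it is therefore injective.
\<close>

lemma mps_nth_frobenius:
  fixes f :: "('v::finite, 'a::comm_ring_1) mps"
  assumes p: "prime p" "CHAR('a) = p"
  shows "mps_nth (f ^ p) (repeat_mset p N) = mps_nth f N ^ p"
proof -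
  have p0: "p > 0" using p(1) by (rule prime_gt_0_nat)
  let ?n = "p * size N"
  have "mps_agree ?n f (\<Sum>M | size M \<le> ?n. mps_const (mps_nth f M) * mps_monom mps_var M)"
    using mps_agree_comp[of mps_var ?n f] by (simp add: mps_comp_var_id)
  then have "mps_agree ?n (f ^ p) ((\<Sum>M | size M \<le> ?n. mps_const (mps_nth f M) * mps_monom mps_var M) ^ p)"
    by (rule mps_agree_power)
  also have "(\<Sum>M | size M \<le> ?n. mps_const (mps_nth f M) * mps_monom mps_var M) ^ p
      = (\<Sum>M | size M \<le> ?n. mps_const (mps_nth f M ^ p) * mps_monom mps_var (repeat_mset p M))"
  proof -
    have pow: "mps_monom mps_var M ^ k = (mps_monom mps_var (repeat_mset k M) :: ('v, 'a) mps)" for k M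
      by (induction k) simp_all
    show ?thesis
      by (subst freshmans_dream_sum) (simp_all add: CHAR_mps p power_mult_distrib mps_const_simps pow)
  qed
  finally have "mps_nth (f ^ p) (repeat_mset p N)
      = (\<Sum>M | size M \<le> ?n. mps_nth f M ^ p * (if repeat_mset p N = repeat_mset p M then 1 else 0))"
    by (simp add: mps_agree_def mps_nth_sum mps_monom_var)
  also have "\<dots> = (\<Sum>M | size M \<le> ?n. if M = N then mps_nth f N ^ p else 0)"
  proof (rule sum.cong[OF refl])
    fix M :: "'v multiset"
    have "repeat_mset p N = repeat_mset p M \<longleftrightarrow> M = N" using p0 by (auto simp: multiset_eq_iff)
    then show "mps_nth f M ^ p * (if repeat_mset p N = repeat_mset p M then 1 else 0)
        = (if M = N then mps_nth f N ^ p else 0)" by auto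
  qed
  also have "\<dots> = mps_nth f N ^ p"
    using p0 by (simp add: finite_multisets_size_le)
  finally show ?thesis .
qed

lemma mps_power_prime_power_inject:
  fixes f g :: "('v::finite, 'a::field) mps"
  assumes p: "prime p" "CHAR('a) = p" and eq: "f ^ (p ^ k) = g ^ (p ^ k)"
  shows "f = g"
proof -
  have reduced: "h = 0" if "h ^ p = 0" for h :: "('v, 'a) mps"
  proof (rule mps_eqI)
    fix N
    have "mps_nth h N ^ p = 0" using mps_nth_frobenius[OF p, of h N] that by simp
    then show "mps_nth h N = mps_nth 0 N" by simp
  qed
  have reduced': "h = 0" if "h ^ (p ^ k) = 0" for h :: "('v, 'a) mps" and k
    using that by (induction k) (auto simp: power_mult dest: reduced simp: mult.commute[of p])
  have "(f - g + g) ^ (p ^ k) = (f - g) ^ (p ^ k) + g ^ (p ^ k)"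
    by (rule freshmans_dream') (simp_all add: CHAR_mps p)
  then have "(f - g) ^ (p ^ k) = 0" using eq by simp
  from reduced'[OF this] show ?thesis by simp
qed


section \<open>Every multiplicative series is an evaluation\<close>

definition emb :: "('v, 'a::comm_ring_1) mps \<Rightarrow> ('v, ('g::group_add, 'a) group_centre) mps" where
  "emb = mps_map centre_scalar"

lemma emb_add: "emb (f + g) = emb f + emb g"
  unfolding emb_def by (rule mps_eqI) simp

lemma emb_mult: "emb (f * g) = emb f * emb g"
  unfolding emb_def by (rule mps_map_mult) simp_all

lemma emb_one: "emb 1 = 1"
  unfolding emb_def by (rule mps_eqI) simp

lemma mps_nth_emb [simp]: "mps_nth (emb f) N = centre_scalar (mps_nth f N)"
  by (simp add: emb_def)

lemma mps_nth_mult_const: "mps_nth (f * mps_const a) N = mps_nth f N * (a :: 'a::comm_ring_1)"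
  by (metis mult.commute mps_nth_const_mult)

text \<open>
  The coordinates with respect to the basis of class sums.
\<close>

definition coord_series :: "('v, ('g::{group_add, finite}, 'a::comm_ring_1) group_centre) mps \<Rightarrow> 'g conj_class \<Rightarrow> ('v, 'a) mps" where
  "coord_series f c = mps_map (centre_coord c) f"

lemma centre_coord_zero [simp]: "centre_coord c 0 = 0"
  by (simp add: centre_coord_def zero_group_centre.rep_eq)

lemma coord_series_empty: "mps_nth f {#} = 0 \<Longrightarrow> mps_nth (coord_series f c) {#} = 0"
  by (simp add: coord_series_def)

lemma coord_series_expand: "f = (\<Sum>c\<in>UNIV. mps_const (centre_class c) * emb (coord_series f c))"
proof (rule mps_eqI)
  fix N
  show "mps_nth f N = mps_nth (\<Sum>c\<in>UNIV. mps_const (centre_class c) * emb (coord_series f c)) N"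
    using centre_expand[of "mps_nth f N"]
    by (simp add: mps_nth_sum coord_series_def mult.commute[of "centre_class _"])
qed

lemma coord_series_unique:
  fixes s :: "'g::{group_add, finite} conj_class \<Rightarrow> ('v, 'a::comm_ring_1) mps"
  shows "coord_series (\<Sum>c\<in>UNIV. mps_const (centre_class c) * emb (s c)) d = s d"
proof (rule mps_eqI)
  fix N
  have sum: "centre_coord d (sum h S) = (\<Sum>i\<in>S. centre_coord d (h i))" for h :: "'g conj_class \<Rightarrow> ('g, 'a) group_centre" and S
    by (induction S rule: infinite_finite_induct) (auto simp: centre_coord_add)
  have "mps_nth (coord_series (\<Sum>c\<in>UNIV. mps_const (centre_class c) * emb (s c)) d) N
      = (\<Sum>c\<in>UNIV. centre_coord d (centre_scalar (mps_nth (s c) N) * centre_class c))"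
    by (simp add: coord_series_def mps_nth_sum sum mult.commute[of "centre_class _"])
  also have "\<dots> = (\<Sum>c\<in>UNIV. if c = d then mps_nth (s c) N else 0)"
    unfolding centre_coord_scalar centre_coord_class by (rule sum.cong) auto
  finally show "mps_nth (coord_series (\<Sum>c\<in>UNIV. mps_const (centre_class c) * emb (s c)) d) N = mps_nth (s d) N"
    by simp
qed

lemma coord_series_star:
  fixes f g :: "('v, ('g::{group_add, finite}, 'a::comm_ring_1) group_centre) mps"
  shows "coord_series (f + g + f * g) = star (coord_series f) (coord_series g)"
proof -
  let ?K = "\<lambda>c. mps_const (centre_class c) :: ('v, ('g, 'a) group_centre) mps"
  have K: "?K c * ?K d = (\<Sum>e\<in>UNIV. of_nat (class_mult c d e) * ?K e)" for c d
    unfolding mps_const_simps(4)[symmetric] centre_class_mult by (simp add: mps_const_simps mps_const_of_nat)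
  have "f + g + f * g = (\<Sum>c\<in>UNIV. ?K c * star (\<lambda>c. emb (coord_series f c)) (\<lambda>c. emb (coord_series g c)) c)"
    using star_prod[OF K, of "\<lambda>c. emb (coord_series f c)" "\<lambda>c. emb (coord_series g c)"]
    by (simp only: coord_series_expand[symmetric])
  also have "\<dots> = (\<Sum>c\<in>UNIV. ?K c * emb (star (coord_series f) (coord_series g) c))"
    by (simp only: star_hom[OF emb_add emb_mult emb_one])
  finally show ?thesis by (simp add: coord_series_unique fun_eq_iff)
qed

text \<open>
  The character \<open>b\<close> as a function on the series \<open>u\<close> over the centre with constant term 1. Written this way it
  is a homomorphism of multiplicative groups, and the ring structure of the centre can be exploited.
\<close>

definition unit_char :: "('g::{group_add, finite} conj_class, 'a::comm_ring_1) mps \<Rightarrow>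
    ('w, ('g, 'a) group_centre) mps \<Rightarrow> ('w, 'a) mps" where
  "unit_char b u = mps_comp b (coord_series (u - 1))"

lemma mps_comp_scaled:
  "mps_comp b (\<lambda>c. mps_const (k c) * y) = mps_subst (\<lambda>r. \<Sum>M | size M = r. mps_nth b M * mps_monom k M) y"
proof (rule mps_eqI)
  fix N
  have mon: "mps_monom (\<lambda>c. mps_const (k c) * y) M = mps_const (mps_monom k M) * y ^ size M" for M
    by (induction M) (simp_all add: mps_const_simps ac_simps)
  have "mps_nth (mps_comp b (\<lambda>c. mps_const (k c) * y)) N
      = (\<Sum>M | size M \<le> size N. mps_nth b M * mps_monom k M * mps_nth (y ^ size M) N)"
    by (simp add: mps_comp_def mon mult.assoc)
  also have "\<dots> = (\<Sum>r\<le>size N. \<Sum>M | size M = r. mps_nth b M * mps_monom k M * mps_nth (y ^ r) N)"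
  proof -
    have "(\<Sum>M | size M \<le> size N. mps_nth b M * mps_monom k M * mps_nth (y ^ size M) N)
        = (\<Sum>r\<le>size N. \<Sum>M | M \<in> {M. size M \<le> size N} \<and> size M = r. mps_nth b M * mps_monom k M * mps_nth (y ^ size M) N)"
      by (rule sum.group[symmetric]) (auto simp: finite_multisets_size_le)
    also have "\<dots> = (\<Sum>r\<le>size N. \<Sum>M | size M = r. mps_nth b M * mps_monom k M * mps_nth (y ^ r) N)"
      by (intro sum.cong) auto
    finally show ?thesis .
  qed
  finally show "mps_nth (mps_comp b (\<lambda>c. mps_const (k c) * y)) N
      = mps_nth (mps_subst (\<lambda>r. \<Sum>M | size M = r. mps_nth b M * mps_monom k M) y) N"
    by (simp add: mps_subst_def sum_distrib_right)
qed

context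
  fixes b :: "('g::{group_add, finite} conj_class, 'a::comm_ring_1) mps"
  assumes mult: "multiplicative b" and one: "mps_nth b {#} = 1"
begin

lemma unit_char_mult:
  assumes "mps_nth u {#} = 1" "mps_nth v {#} = 1"
  shows "unit_char b (u * v) = unit_char b u * unit_char b v"
proof -
  have "u * v - 1 = (u - 1) + (v - 1) + (u - 1) * (v - 1)" by (simp add: algebra_simps)
  then have "unit_char b (u * v) = mps_comp b (star (coord_series (u - 1)) (coord_series (v - 1)))"
    unfolding unit_char_def by (simp only: coord_series_star)
  also have "\<dots> = mps_comp b (coord_series (u - 1)) * mps_comp b (coord_series (v - 1))"
    by (rule multiplicative_comp[OF mult, symmetric]) (simp_all add: coord_series_empty assms)
  finally show ?thesis by (simp only: unit_char_def)
qed

lemma unit_char_one: "unit_char b 1 = 1"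
proof (rule mps_eqI)
  fix N :: "'w multiset"
  have 0: "coord_series 0 c = (0 :: ('w, 'a) mps)" for c :: "'g conj_class"
    by (rule mps_eqI) (simp add: coord_series_def)
  have "mps_nth b M * mps_nth (mps_monom (\<lambda>c. 0 :: ('w, 'a) mps) M) N = 0" if "M \<noteq> {#}" for M :: "'g conj_class multiset"
    using that by (cases M) simp_all
  then have "mps_nth (unit_char b 1) N = (\<Sum>M\<in>{{#}}. mps_nth b M * mps_nth (mps_monom (\<lambda>c. 0 :: ('w, 'a) mps) M) N)"
    unfolding unit_char_def mps_comp_def mps_nth_Abs diff_self 0
    by (intro sum.mono_neutral_right) (auto simp: finite_multisets_size_le)
  then show "mps_nth (unit_char b 1) N = mps_nth 1 N" by (simp add: one)
qed

lemma unit_char_power: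
  assumes "mps_nth u {#} = 1"
  shows "unit_char b (u ^ n) = unit_char b u ^ n"
  using assms by (induction n) (simp_all add: unit_char_one unit_char_mult)

lemma unit_char_prod:
  assumes "\<And>i. i \<in> S \<Longrightarrow> mps_nth (u i) {#} = 1"
  shows "unit_char b (prod u S) = (\<Prod>i\<in>S. unit_char b (u i))"
  using assms
  by (induction S rule: infinite_finite_induct)
     (simp_all add: unit_char_one unit_char_mult mps_nth_prod_empty)

text \<open>
  The coefficients of the character at the units \<open>1 + y e\<close> as a series in \<open>y\<close>. For idempotent \<open>e\<close> these units
  form a copy of the multiplicative formal group.
\<close>

definition idem_seq :: "('g, 'a) group_centre \<Rightarrow> nat \<Rightarrow> 'a" where
  "idem_seq e r = (\<Sum>M | size M = r. mps_nth b M * mps_monom (\<lambda>c. centre_coord c e) M)"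

lemma unit_char_idem: "unit_char b (1 + emb y * mps_const e) = mps_subst (idem_seq e) y"
proof -
  have "coord_series (emb y * mps_const e) = (\<lambda>c. mps_const (centre_coord c e) * y)"
    unfolding fun_eq_iff
    by (intro allI mps_eqI) (simp add: coord_series_def mps_nth_mult_const centre_coord_scalar mult.commute[of "centre_coord _ e"])
  then show ?thesis
    unfolding unit_char_def idem_seq_def by (simp add: mps_comp_scaled)
qed

lemma grouplike_idem_seq:
  assumes "e * e = e"
  shows "grouplike (idem_seq e)"
proof (rule grouplikeI)
  show "idem_seq e 0 = 1" by (simp add: idem_seq_def one)
  let ?x = "mps_var False :: (bool, 'a) mps" and ?y = "mps_var True :: (bool, 'a) mps" and ?e = "mps_const e"
  have "?e * ?e = (?e :: (bool, _) mps)" using assms by (simp flip: mps_const_simps)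
  then have ee: "?e * (?e * z) = ?e * z" for z :: "(bool, ('g, 'a) group_centre) mps"
    by (simp flip: mult.assoc)
  have "(1 + emb ?x * ?e) * (1 + emb ?y * ?e) = 1 + emb (?x + ?y + ?x * ?y) * ?e"
    by (simp add: emb_add emb_mult algebra_simps ee)
  moreover have "unit_char b ((1 + emb ?x * ?e) * (1 + emb ?y * ?e))
      = unit_char b (1 + emb ?x * ?e) * unit_char b (1 + emb ?y * ?e)"
    by (rule unit_char_mult) (simp_all add: mps_nth_mult_const)
  ultimately show "mps_subst (idem_seq e) ?x * mps_subst (idem_seq e) ?y = mps_subst (idem_seq e) (?x + ?y + ?x * ?y)"
    by (simp only: unit_char_idem)
qed

end

lemma prod_one_plus_orthogonal:
  fixes z :: "'i \<Rightarrow> 'r::comm_ring_1"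
  assumes "finite S" "\<And>i j. i \<in> S \<Longrightarrow> j \<in> S \<Longrightarrow> i \<noteq> j \<Longrightarrow> z i * z j = 0"
  shows "(\<Prod>i\<in>S. 1 + z i) = 1 + (\<Sum>i\<in>S. z i)"
  using assms
proof (induction S rule: finite_induct)
  case (insert i S)
  have "z i * (\<Sum>j\<in>S. z j) = 0"
    unfolding sum_distrib_left by (rule sum.neutral) (use insert in auto)
  with insert show ?case by (simp add: algebra_simps)
qed simp

lemma emb_var: "emb (mps_var c) = mps_var c"
  by (rule mps_eqI) simp

lemma emb_const: "emb (mps_const a) = mps_const (centre_scalar a)"
  by (rule mps_eqI) simp

lemma emb_sum: "emb (sum h S) = (\<Sum>i\<in>S. emb (h i))"
proof (induction S rule: infinite_finite_induct)
  case (infinite S)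
  then show ?case by (auto intro!: mps_eqI)
qed (auto simp: emb_add intro!: mps_eqI)

definition generic_element :: "('g::{group_add, finite} conj_class, ('g, 'a::comm_ring_1) group_centre) mps" where
  "generic_element = (\<Sum>c\<in>UNIV. mps_const (centre_class c) * mps_var c)"

definition char_series :: "('g::{group_add, finite}, 'a::field) group_centre \<Rightarrow> ('g conj_class, 'a) mps" where
  "char_series e = (\<Sum>c\<in>UNIV. mps_const (block_char e (centre_class c)) * mps_var c)"

text \<open>
  In the component of \<open>e\<close>, the generic element is the scalar \<open>char_series e\<close> up to a nilpotent element. A high
  power of \<open>p\<close> kills the nilpotent elements and is additive.
\<close>

lemma generic_unit_power:
  assumes p: "prime p" "CHAR('f::alg_closed_field) = p"
  shows "\<exists>m. (1 + generic_element :: ('g::{group_add, finite} conj_class, ('g, 'f) group_centre) mps) ^ (p ^ m)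
    = (\<Prod>e | primitive_idem e. 1 + emb (char_series e) * mps_const e) ^ (p ^ m)"
proof -
  let ?E = "{e :: ('g, 'f) group_centre. primitive_idem e}"
  let ?cc = "centre_class :: 'g conj_class \<Rightarrow> ('g, 'f) group_centre"
  let ?w = "\<lambda>e c. block_char e (?cc c)"
  let ?n = "\<lambda>e c. (?cc c - centre_scalar (?w e c)) * e"
  have E: "e * e = e" if "e \<in> ?E" for e using that by (simp add: primitive_idem_def)
  obtain m where m: "\<And>e c. e \<in> ?E \<Longrightarrow> ?n e c ^ m = 0"
  proof -
    have "\<forall>x\<in>?E \<times> UNIV. \<exists>k. ?n (fst x) (snd x) ^ k = 0"
      using nilp_block_char by (auto simp: nilp_def)
    then obtain k where k: "\<And>x. x \<in> ?E \<times> UNIV \<Longrightarrow> ?n (fst x) (snd x) ^ k x = 0" by metis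
    have fin: "finite (?E \<times> (UNIV :: 'g conj_class set))" by (simp add: finite_primitive_idems)
    have "?n e c ^ Max (k ` (?E \<times> UNIV)) = 0" if "e \<in> ?E" for e c
    proof (rule power_zero_mono)
      show "?n e c ^ k (e, c) = 0" using k[of "(e, c)"] that by simp
      show "k (e, c) \<le> Max (k ` (?E \<times> UNIV))" using fin that by (intro Max_ge) auto
    qed
    with that show thesis by blast
  qed
  define q where "q = p ^ m"
  \<comment> \<open>any power of \<open>p\<close> that is at least \<open>m\<close> will do\<close>
  have "m < 2 ^ m" by simp
  also have "(2 :: nat) ^ m \<le> q" unfolding q_def using prime_ge_2_nat[OF p(1)] by (rule power_mono) simp
  finally have nq: "?n e c ^ q = 0" if "e \<in> ?E" for e c
    using power_zero_mono[OF m[OF that], of q] by simp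
  have q0: "q > 0" unfolding q_def using p(1) by (simp add: prime_gt_0_nat)
  have frob: "(x + y) ^ q = x ^ q + y ^ q" "(sum h S) ^ q = (\<Sum>i\<in>S. h i ^ q)"
    for x y :: "('g conj_class, ('g, 'f) group_centre) mps"
      and h :: "'g conj_class \<Rightarrow> ('g conj_class, ('g, 'f) group_centre) mps" and S
    by (rule freshmans_dream' freshmans_dream_sum'; simp add: CHAR_mps CHAR_group_centre p q_def)+
  let ?X = "generic_element :: ('g conj_class, ('g, 'f) group_centre) mps"
  \<comment> \<open>splitting the component of the generic element at \<open>e\<close> into its nilpotent and its scalar part\<close>
  have X_e: "?X * mps_const e = (\<Sum>c\<in>UNIV. mps_const (?n e c) * mps_var c) + emb (char_series e) * mps_const e" for e
  proof -
    have "mps_const (?cc c) * mps_var c * mps_const e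
        = mps_const (?n e c) * mps_var c + emb (mps_const (?w e c) * mps_var c) * mps_const e" for c
    proof -
      have "?cc c * e = ?n e c + centre_scalar (?w e c) * e" by (simp add: left_diff_distrib)
      then have "(mps_const (?cc c) * mps_const e :: ('g conj_class, ('g, 'f) group_centre) mps) = mps_const (?n e c) + mps_const (centre_scalar (?w e c)) * mps_const e"
        by (simp only: mps_const_simps(3,4)[symmetric])
      then have "mps_const (?cc c) * mps_const e * mps_var c
          = (mps_const (?n e c) + mps_const (centre_scalar (?w e c)) * mps_const e) * mps_var c"
        by (simp only:)
      then show ?thesis unfolding emb_mult emb_var emb_const by (simp only: distrib_left distrib_right ac_simps)
    qed
    then show ?thesis
      unfolding generic_element_def char_series_def emb_sum sum_distrib_right by (simp only: sum.distrib)
  qed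
  have const_pow: "mps_const e ^ q = mps_const e" if "e \<in> ?E" for e
  proof -
    have "e ^ Suc k = e" for k using E[OF that] by (induction k) simp_all
    then have "e ^ q = e" using q0 by (metis Suc_pred')
    then show ?thesis by (simp flip: mps_const_simps)
  qed
  have X_e_q: "(?X * mps_const e) ^ q = (emb (char_series e) * mps_const e) ^ q" if "e \<in> ?E" for e
  proof -
    have "(\<Sum>c\<in>UNIV. mps_const (?n e c) * mps_var c) ^ q = (0 :: ('g conj_class, ('g, 'f) group_centre) mps)"
    proof -
      have "(mps_const (?n e c) * mps_var c) ^ q = (0 :: ('g conj_class, ('g, 'f) group_centre) mps)" for c
        by (subst power_mult_distrib)
           (simp only: mps_const_simps(5)[symmetric] nq[OF that] mps_const_simps(1) mult_zero_left)
      then show ?thesis by (simp only: frob(2) sum.neutral_const)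
    qed
    then show ?thesis unfolding X_e frob(1) by simp
  qed
  have X_q: "?X ^ q * mps_const e = (emb (char_series e) * mps_const e) ^ q" if "e \<in> ?E" for e
    unfolding X_e_q[OF that, symmetric] by (subst power_mult_distrib) (simp only: const_pow[OF that])
  have "(1 + ?X) ^ q = 1 + ?X ^ q * mps_const (\<Sum>?E)"
    by (simp add: frob sum_primitive_idems mps_const_simps)
  also have "\<dots> = 1 + (\<Sum>e\<in>?E. (emb (char_series e) * mps_const e) ^ q)"
    unfolding mps_const_simps(6) sum_distrib_left by (simp add: X_q)
  also have "\<dots> = (\<Prod>e\<in>?E. 1 + (emb (char_series e) * mps_const e) ^ q)"
  proof (rule prod_one_plus_orthogonal[OF finite_primitive_idems, symmetric])
    fix e f assume ef: "e \<in> ?E" "f \<in> ?E" "e \<noteq> f"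
    then have "e * f = 0" by (simp add: primitive_idems_orthogonal)
    then have "mps_const e * mps_const f = (0 :: ('g conj_class, _) mps)"
      by (simp only: mps_const_simps(1) mps_const_simps(4)[symmetric])
    then have "emb (char_series e) * mps_const e * (emb (char_series f) * mps_const f) = 0"
      by (metis (no_types, lifting) mult.assoc mult.left_commute mult_zero_right)
    then show "(emb (char_series e) * mps_const e) ^ q * (emb (char_series f) * mps_const f) ^ q = 0"
      using q0 by (simp add: zero_power flip: power_mult_distrib)
  qed
  also have "\<dots> = (\<Prod>e\<in>?E. 1 + emb (char_series e) * mps_const e) ^ q"
    unfolding prod_power_distrib[symmetric] by (simp only: frob(1) power_one prod_power_distrib)
  finally show ?thesis unfolding q_def by blast
qed

text \<open>
  Applying the character to this identity and extracting the unique \<open>q\<close>-th root of a power series shows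
  that \<open>b\<close> is the product of its restrictions to the multiplicative formal groups of the blocks.
\<close>

theorem multiplicative_series_is_evaluation:
  fixes b :: "('g::{group_add, finite} conj_class, 'f::alg_closed_field) mps"
  assumes p: "prime p" "CHAR('f) = p" and b: "multiplicative b" "mps_nth b {#} = 1"
  shows "\<exists>t. t \<in> blocks \<rightarrow> padic_ints p \<and> b = eval_series p t"
proof -
  let ?E = "{e :: ('g, 'f) group_centre. primitive_idem e}"
  have E: "e * e = e" if "e \<in> ?E" for e using that by (simp add: primitive_idem_def)
  let ?X = "generic_element :: ('g conj_class, ('g, 'f) group_centre) mps"
  obtain m where key: "(1 + ?X) ^ (p ^ m) = (\<Prod>e\<in>?E. 1 + emb (char_series e) * mps_const e) ^ (p ^ m)"
    using generic_unit_power[OF p] by blast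
  have X0: "mps_nth (1 + ?X) {#} = 1" by (simp add: generic_element_def mps_nth_sum)
  have Y0: "mps_nth (1 + emb (char_series e) * mps_const e) {#} = 1" for e by (simp add: char_series_def mps_nth_sum)
  have "unit_char b (1 + ?X) ^ (p ^ m) = (\<Prod>e\<in>?E. unit_char b (1 + emb (char_series e) * mps_const e)) ^ (p ^ m)"
    unfolding unit_char_power[OF b X0, symmetric] key unit_char_prod[OF b Y0, symmetric]
    by (rule unit_char_power[OF b]) (simp only: mps_nth_prod_empty Y0 prod.neutral_const)
  then have "unit_char b (1 + ?X) = (\<Prod>e\<in>?E. unit_char b (1 + emb (char_series e) * mps_const e))"
    by (rule mps_power_prime_power_inject[OF p])
  moreover have "unit_char b (1 + ?X) = b"
  proof -
    have "coord_series ?X = mps_var"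
      unfolding generic_element_def emb_var[symmetric] coord_series_unique fun_eq_iff by blast
    then show ?thesis by (simp add: unit_char_def mps_comp_var_id)
  qed
  ultimately have b_prod: "b = (\<Prod>e\<in>?E. mps_subst (idem_seq b e) (char_series e))"
    by (simp only: unit_char_idem[OF b])
  have "\<forall>e\<in>?E. \<exists>t\<in>padic_ints p. idem_seq b e = (\<lambda>r. padic_reduce (padic_binomial p t r))"
    using grouplike_padic[OF p grouplike_idem_seq[OF b E]] by (auto simp: fun_eq_iff)
  then obtain t where t: "\<And>e. e \<in> ?E \<Longrightarrow> t e \<in> padic_ints p"
      "\<And>e. e \<in> ?E \<Longrightarrow> idem_seq b e = (\<lambda>r. padic_reduce (padic_binomial p (t e) r))"
    by metis
  define T where "T C = t (inv_into ?E block_ideal C)" for C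
  have T: "T (block_ideal e) = t e" if "e \<in> ?E" for e
    unfolding T_def using inv_into_f_f[OF inj_on_block_ideal that] by simp
  have "T \<in> blocks \<rightarrow> padic_ints p" by (auto simp: blocks_eq T t)
  moreover have "b = eval_series p T"
  proof -
    have "eval_series p T = (\<Prod>e\<in>?E. mps_padic_power p (T (block_ideal e))
        (\<Sum>c\<in>UNIV. mps_const (central_char (block_ideal e) c) * mps_var c))"
      unfolding eval_series_def blocks_eq by (subst prod.reindex[OF inj_on_block_ideal]) simp
    also have "\<dots> = (\<Prod>e\<in>?E. mps_subst (idem_seq b e) (char_series e))"
      by (rule prod.cong) (simp_all add: T t mps_padic_power_def char_series_def central_char_eq)
    finally show ?thesis using b_prod by simp
  qed
  ultimately show ?thesis by blast
qed

theorem theoremA14: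
  fixes p :: nat
  assumes "prime p"
    and "CHAR('f::alg_closed_field) = p"
  shows "(\<forall>t :: ('g::{group_add, finite} \<Rightarrow>\<^sub>0 'f) set \<Rightarrow> nat \<Rightarrow> int. t \<in> blocks \<rightarrow> padic_ints p \<longrightarrow>
            (\<exists>\<phi>. is_evaluation p t \<phi>) \<and>
            (\<forall>\<phi>. is_evaluation p t \<phi> \<longrightarrow>
               (\<forall>c. uea_gen (class_elem c) \<in> R_Gamma \<and>
                 \<phi> (uea_gen (class_elem c)) =
                   (\<Sum>C\<in>blocks. central_char C c * padic_reduce (t C))))) \<and>
         (\<forall>\<phi> :: 'g rat_centre uea \<Rightarrow> 'f. ring_hom_on R_Gamma \<phi> \<longleftrightarrow>
            (\<exists>t :: ('g \<Rightarrow>\<^sub>0 'f) set \<Rightarrow> nat \<Rightarrow> int. t \<in> blocks \<rightarrow> padic_ints p \<and> is_evaluation p t \<phi>))"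
proof (intro conjI allI impI)
  fix t :: "('g \<Rightarrow>\<^sub>0 'f) set \<Rightarrow> nat \<Rightarrow> int" assume t: "t \<in> blocks \<rightarrow> padic_ints p"
  show "\<exists>\<phi>. is_evaluation p t \<phi>"
    unfolding is_evaluation_def by (rule additive_on_R_Gamma_exists)
  fix \<phi> :: "'g rat_centre uea \<Rightarrow> 'f" and c :: "'g conj_class"
  assume \<phi>: "is_evaluation p t \<phi>"
  show "uea_gen (class_elem c) \<in> R_Gamma"
    unfolding B_coeff_single[symmetric] by (rule B_in_R_Gamma)
  show "\<phi> (uea_gen (class_elem c)) = (\<Sum>C\<in>blocks. central_char C c * padic_reduce (t C))"
    using \<phi> eval_series_single[OF assms t] unfolding B_coeff_single[symmetric] is_evaluation_def by simp
next
  fix \<phi> :: "'g rat_centre uea \<Rightarrow> 'f"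
  let ?b = "Abs_mps (\<lambda>N. \<phi> (B_coeff N)) :: ('g conj_class, 'f) mps"
  show "ring_hom_on R_Gamma \<phi> \<longleftrightarrow>
      (\<exists>t :: ('g \<Rightarrow>\<^sub>0 'f) set \<Rightarrow> nat \<Rightarrow> int. t \<in> blocks \<rightarrow> padic_ints p \<and> is_evaluation p t \<phi>)"
  proof
    assume hom: "ring_hom_on R_Gamma \<phi>"
    then have add: "additive_on R_Gamma \<phi>" by (simp add: ring_hom_on_def)
    have "multiplicative ?b" "mps_nth ?b {#} = 1"
      using hom ring_hom_on_iff_multiplicative[OF add] by simp_all
    then obtain t where t: "t \<in> blocks \<rightarrow> padic_ints p" "?b = eval_series p t"
      using multiplicative_series_is_evaluation[OF assms] by blast
    have "is_evaluation p t \<phi>" using add by (simp add: is_evaluation_def flip: t(2))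
    with t show "\<exists>t. t \<in> blocks \<rightarrow> padic_ints p \<and> is_evaluation p t \<phi>" by blast
  next
    assume "\<exists>t :: ('g \<Rightarrow>\<^sub>0 'f) set \<Rightarrow> nat \<Rightarrow> int. t \<in> blocks \<rightarrow> padic_ints p \<and> is_evaluation p t \<phi>"
    then obtain t :: "('g \<Rightarrow>\<^sub>0 'f) set \<Rightarrow> nat \<Rightarrow> int" where t: "t \<in> blocks \<rightarrow> padic_ints p"
      and \<phi>: "additive_on R_Gamma \<phi>" "\<And>N. \<phi> (B_coeff N) = mps_nth (eval_series p t) N"
      by (auto simp: is_evaluation_def)
    have "?b = eval_series p t" by (rule mps_eqI) (simp add: \<phi>)
    then show "ring_hom_on R_Gamma \<phi>"
      using multiplicative_eval_series[OF assms t] eval_series_empty[OF assms t]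
      by (simp add: ring_hom_on_iff_multiplicative[OF \<phi>(1)] \<phi>(2))
  qed
qed

end
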